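(* Let $F:\mathbb{R}^d\to\mathbb{R}^m$ be a $C^2$ smooth mapping and $h:\mathbb{R}^m\to\mathbb{R}$ a locally Lipschitz semialgebraic function. Suppose that $y\in\mathbb{R}^m$ is an isolated minimum of $h$ and define $\mathcal{X}_\ast=F^{-1}(y)$. Let $f(x)=h(F(x))$ and $$g(x)=\nabla F(x)^T\partial h(F(x))=\{\nabla F(x)^Tw: w\in\partial h(F(x))\}\qquad\text{for all }x\in\mathbb{R}^d.$$ Then for any $\bar x\in\mathcal{X}_\ast$, the function $f$ is $(b)$-regular along $\mathcal{X}_\ast$ at $\bar x$ with mapping $g$; that is, $g$ is nonempty-valued and locally bounded, and there exist $\delta,C_{(b)},\eta>0$ such that $$|f(x)+\langle v,z-x\rangle-f(z)|\le C_{(b)}\|z-x\|^{1+\eta}$$ for all $x\in B_\delta(\bar x)$, $v\in g(x)$, and $z\in\mathcal{X}_\ast\cap B_{2\delta}(\bar x)$.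
   Context: $B_r(x)$ is the open Euclidean ball. $\nabla F(x)$ is the Jacobian matrix of $F$. A function is semialgebraic if its graph is a finite union of sets each defined by finitely many polynomial inequalities. $\partial h(w)$ is the Clarke subdifferential of the locally Lipschitz function $h$: the convex hull of all limits of gradients $\nabla h(w_i)$ along sequences $w_i\to w$ of differentiability points. A set-valued mapping is locally bounded if it maps bounded sets to bounded sets. Note that $f(z)=h(y)$ for every $z\in\mathcal{X}_\ast$. *)

theory Defs
  imports "HOL-Analysis.Analysis"
begin

definition C2_smooth :: "('a::euclidean_space \<Rightarrow> 'b::euclidean_space) \<Rightarrow> bool" where
  "C2_smooth F \<longleftrightarrow>
    (\<exists>(F' :: 'a \<Rightarrow> 'a \<Rightarrow>\<^sub>L 'b) (F'' :: 'a \<Rightarrow> 'a \<Rightarrow>\<^sub>L 'a \<Rightarrow>\<^sub>L 'b).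
      (\<forall>x. (F has_derivative blinfun_apply (F' x)) (at x)) \<and>
      (\<forall>x. (F' has_derivative blinfun_apply (F'' x)) (at x)) \<and>
      continuous_on UNIV F'')"

definition locally_lipschitz :: "('a::metric_space \<Rightarrow> 'b::metric_space) \<Rightarrow> bool" where
  "locally_lipschitz h \<longleftrightarrow> (\<forall>w. \<exists>r>0. \<exists>L. L-lipschitz_on (ball w r) h)"

text \<open>
  On a Euclidean space, \<^const>\<open>real_polynomial_function\<close> describes exactly the real
  polynomials in the coordinates. Both strict and non-strict inequalities are allowed;
  an equation is a pair of non-strict ones.
\<close>

definition basic_semialgebraic_set :: "'a::euclidean_space set \<Rightarrow> bool" where
  "basic_semialgebraic_set S \<longleftrightarrow>
    (\<exists>P Q. finite P \<and> finite Q \<and>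
      (\<forall>p\<in>P. real_polynomial_function p) \<and> (\<forall>q\<in>Q. real_polynomial_function q) \<and>
      S = {x. (\<forall>p\<in>P. p x \<le> 0) \<and> (\<forall>q\<in>Q. q x < 0)})"

definition semialgebraic_set :: "'a::euclidean_space set \<Rightarrow> bool" where
  "semialgebraic_set S \<longleftrightarrow>
    (\<exists>\<U>. finite \<U> \<and> (\<forall>U\<in>\<U>. basic_semialgebraic_set U) \<and> S = \<Union>\<U>)"

definition semialgebraic_function :: "('a::euclidean_space \<Rightarrow> 'b::euclidean_space) \<Rightarrow> bool" where
  "semialgebraic_function h \<longleftrightarrow> semialgebraic_set {(w, h w) | w. True}"

definition clarke_subdifferential :: "('a::euclidean_space \<Rightarrow> real) \<Rightarrow> 'a \<Rightarrow> 'a set" where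
  "clarke_subdifferential h w =
    convex hull {v. \<exists>u G. u \<longlonglongrightarrow> w \<and> (\<forall>i. GDERIV h (u i) :> G i) \<and> G \<longlonglongrightarrow> v}"

text \<open>
  ``Isolated minimum'' is read as strict local minimum. An isolated point of the set of
  global minimizers, or of the set of local minimizers, is in particular of this kind.
\<close>

definition isolated_minimum :: "('a::metric_space \<Rightarrow> real) \<Rightarrow> 'a \<Rightarrow> bool" where
  "isolated_minimum h y \<longleftrightarrow> (\<exists>\<epsilon>>0. \<forall>w\<in>ball y \<epsilon>. w \<noteq> y \<longrightarrow> h y < h w)"

definition locally_bounded_map :: "('a::metric_space \<Rightarrow> 'b::metric_space set) \<Rightarrow> bool" where
  "locally_bounded_map g \<longleftrightarrow> (\<forall>S. bounded S \<longrightarrow> bounded (\<Union>x\<in>S. g x))"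

definition b_regular_along ::
  "('a::euclidean_space \<Rightarrow> real) \<Rightarrow> 'a set \<Rightarrow> 'a \<Rightarrow> ('a \<Rightarrow> 'a set) \<Rightarrow> bool" where
  "b_regular_along f X xbar g \<longleftrightarrow>
    (\<forall>x. g x \<noteq> {}) \<and> locally_bounded_map g \<and>
    (\<exists>\<delta>>0. \<exists>C>0. \<exists>\<eta>>0.
      \<forall>x\<in>ball xbar \<delta>. \<forall>v\<in>g x. \<forall>z\<in>X \<inter> ball xbar (2 * \<delta>).
        \<bar>f x + v \<bullet> (z - x) - f z\<bar> \<le> C * norm (z - x) powr (1 + \<eta>))"

end

theory Submission
  imports Defs
begin

text \<open>
  Everything rests on one property of \<open>h\<close>, semismoothness with a rate: there are
  \<open>C\<close> and \<open>\<eta> > 0\<close> such that \<open>\<bar>h w - h y - (w - y) \<bullet> v\<bar> \<le> C \<parallel>w - y\<parallel>\<^sup>1\<^sup>+\<^sup>\<eta>\<close> for all \<open>w\<close> near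
  \<open>y\<close> and all Clarke subgradients \<open>v\<close> at \<open>w\<close> (\<open>clarke_semismooth_at\<close>). If \<open>F z = y\<close>, then
  \<open>F'(x)(z - x) = y - F x + O(\<parallel>z - x\<parallel>\<^sup>2)\<close> because \<open>F\<close> is \<open>C\<^sup>2\<close>, and \<open>\<parallel>F x - y\<parallel> = O(\<parallel>z - x\<parallel>)\<close>, so
  the semismooth estimate at \<open>w = F x\<close> is the required one up to a quadratic error.

  For fixed \<open>w\<close> the estimate is a closed convex condition on \<open>v\<close>, and \<open>h\<close> is continuous. It
  therefore suffices to prove it at points of differentiability, for \<open>v\<close> the gradient. Take
  \<open>y = 0\<close> and \<open>h 0 = 0\<close>, and let the defect at \<open>w\<close> be \<open>\<bar>h w - w \<bullet> v\<bar>\<close>.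

  The defect is \<open>o(\<parallel>w\<parallel>)\<close> (\<open>semismooth_little_o\<close>). Otherwise definable choice gives a semialgebraic
  curve \<open>f\<close> with \<open>\<parallel>f r\<parallel> = r\<close> along which the defect is at least \<open>c r\<close>. A semialgebraic function
  \<open>\<psi>\<close> of one variable with \<open>\<psi> r = O(r)\<close> satisfies \<open>\<psi> r - r \<psi>'(r) = o(r)\<close>
  (\<open>definable_fun_radial_bound\<close>): if not, the derivative of \<open>\<psi> r / r\<close> would eventually exceed
  \<open>e / r\<close> in absolute value with a fixed sign, and \<open>\<psi> r / r\<close> would diverge like a logarithm.
  This applies to the coordinates of \<open>f\<close> and to \<open>h \<circ> f\<close>. The chain rule
  \<open>(h \<circ> f)' = f' \<bullet> v\<close> and the Lipschitz bound on \<open>v\<close> then make the defect along \<open>f\<close> equal to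
  \<open>o(r)\<close>, a contradiction.

  The little-o improves to a power (\<open>definable_lojasiewicz\<close>): a nearly worst ratio of the defect to
  \<open>r\<close> can be chosen as a semialgebraic function of \<open>r\<close>, which satisfies a nontrivial polynomial
  equation; a root of such an equation that tends to \<open>0\<close> with \<open>r\<close> is bounded by a power of \<open>r\<close>.

  These arguments use that predicates built from semialgebraic functions with quantifiers
  over Euclidean spaces are again semialgebraic. This is the Tarski-Seidenberg theorem
  (\<open>signs_of_projection\<close>), proved by the method of Cohen and Hoermander: the arrangement on the
  line of the signs of \<open>p\<close> and of some polynomials of at most the same degree is determined by
  the signs of those polynomials, of \<open>p'\<close>, and of the remainders of \<open>p\<close> modulo each of them.

  Clarke subdifferentials are nonempty because a continuous semialgebraic function is
  differentiable at a dense set of points (\<open>definable_fun_dense_differentiable\<close>): its graph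
  satisfies a polynomial equation, and for one of minimal degree in the last variable the
  implicit function argument applies somewhere in every open set.
\<close>

section \<open>Sign patterns of real polynomials in one variable\<close>

lemma poly_sgn_eq_without_roots:
  fixes p :: "real poly"
  assumes "a \<le> b" and "\<And>z. a \<le> z \<Longrightarrow> z \<le> b \<Longrightarrow> poly p z \<noteq> 0"
  shows "sgn (poly p a) = sgn (poly p b)"
proof (rule ccontr)
  assume neq: "sgn (poly p a) \<noteq> sgn (poly p b)"
  have "poly p a \<noteq> 0" "poly p b \<noteq> 0"
    using assms by auto
  with neq have "poly p a * poly p b < 0"
    by (auto simp: sgn_if mult_less_0_iff split: if_splits)
  moreover have "a < b"
    using neq assms(1) by (cases "a = b") auto
  ultimately obtain z where "a < z" "z < b" "poly p z = 0"
    using poly_IVT by blast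
  then show False
    using assms(2)[of z] by simp
qed

lemma poly_sgn_left:
  fixes q :: "real poly"
  assumes "a < b" and "poly q b \<noteq> 0"
  shows "\<exists>t. a < t \<and> t < b \<and> sgn (poly q t) = sgn (poly q b)"
proof -
  have lim: "(poly q \<longlongrightarrow> poly q b) (at_left b)"
    by (intro tendsto_intros)
  have "\<forall>\<^sub>F t in at_left b. sgn (poly q t) = sgn (poly q b)"
  proof (cases "poly q b > 0")
    case True
    show ?thesis
      using order_tendstoD(1)[OF lim True] by (rule eventually_mono) (use True in simp)
  next
    case False
    with assms(2) have neg: "poly q b < 0" by simp
    show ?thesis
      using order_tendstoD(2)[OF lim neg] by (rule eventually_mono) (use neg in simp)
  qed
  moreover have "\<forall>\<^sub>F t in at_left b. t \<in> {a<..<b}"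
    using assms(1) by (rule eventually_at_left_real)
  ultimately have "\<forall>\<^sub>F t in at_left b. a < t \<and> t < b \<and> sgn (poly q t) = sgn (poly q b)"
    by eventually_elim simp
  then show ?thesis
    using eventually_happens'[OF trivial_limit_at_left_real] by blast
qed

lemma poly_sgn_right:
  fixes q :: "real poly"
  assumes "a < b" and "poly q a \<noteq> 0"
  shows "\<exists>t. a < t \<and> t < b \<and> sgn (poly q t) = sgn (poly q a)"
proof -
  have "\<exists>t. -b < t \<and> t < -a \<and>
      sgn (poly (pcompose q [:0, -1:]) t) = sgn (poly (pcompose q [:0, -1:]) (-a))"
    using assms by (intro poly_sgn_left) (auto simp: poly_pcompose)
  then obtain t where "-b < t" "t < -a" "sgn (poly q (-t)) = sgn (poly q a)"
    by (auto simp: poly_pcompose)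
  then show ?thesis
    by (intro exI[of _ "-t"]) auto
qed

text \<open>
  The inductive step of the elimination. As \<open>p\<close> is monotone on the interval, \<open>p t\<close> lies strictly
  between \<open>p a\<close> and \<open>p b\<close>, and its sign is either that of an endpoint value or \<open>0\<close>, forced by a
  change of sign; either way \<open>q\<close>, with the same signs at the endpoints, attains it.
\<close>

lemma poly_realise_sign_between:
  fixes p q :: "real poly"
  assumes t: "a < t" "t < b" and ab': "a' < b'"
    and mono: "\<And>s. a < s \<Longrightarrow> s < b \<Longrightarrow> poly (pderiv p) s \<noteq> 0"
    and sa: "sgn (poly p a) = sgn (poly q a')" and sb: "sgn (poly p b) = sgn (poly q b')"
  shows "\<exists>t'. a' < t' \<and> t' < b' \<and> sgn (poly q t') = sgn (poly p t)"
proof -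
  obtain x where x: "a < x" "x < t" "poly p t - poly p a = (t - a) * poly (pderiv p) x"
    using poly_MVT[OF t(1)] by blast
  obtain y where y: "t < y" "y < b" "poly p b - poly p t = (b - t) * poly (pderiv p) y"
    using poly_MVT[OF t(2)] by blast
  have xy: "sgn (poly (pderiv p) x) = sgn (poly (pderiv p) y)"
    using x y by (intro poly_sgn_eq_without_roots mono) auto
  moreover have "poly (pderiv p) x \<noteq> 0"
    using mono x y by auto
  ultimately consider "poly p a < poly p t" "poly p t < poly p b"
    | "poly p a > poly p t" "poly p t > poly p b"
  proof (cases "poly (pderiv p) x > 0")
    case True
    then have "poly (pderiv p) y > 0"
      using xy by (auto simp: sgn_if split: if_splits)
    then have "(t - a) * poly (pderiv p) x > 0" "(b - t) * poly (pderiv p) y > 0"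
      using True t by auto
    then show ?thesis using that(1) x(3) y(3) by linarith
  next
    case False
    then have "poly (pderiv p) x < 0" using \<open>_ \<noteq> 0\<close> by simp
    moreover from this have "poly (pderiv p) y < 0"
      using xy by (auto simp: sgn_if split: if_splits)
    ultimately have "(t - a) * poly (pderiv p) x < 0" "(b - t) * poly (pderiv p) y < 0"
      using t by (auto simp: mult_pos_neg)
    then show ?thesis using that(2) x(3) y(3) by linarith
  qed
  then consider (zero) "poly p t = 0" "poly p a * poly p b < 0"
    | (left) "poly p a \<noteq> 0" "sgn (poly p t) = sgn (poly p a)"
    | (right) "poly p b \<noteq> 0" "sgn (poly p t) = sgn (poly p b)"
    by cases (auto simp: sgn_if mult_less_0_iff split: if_splits;
        metis less_trans linorder_neqE_linordered_idom not_less_iff_gr_or_eq)+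
  then show ?thesis
  proof cases
    case zero
    then have "poly q a' * poly q b' < 0"
      using sa sb by (metis sgn_mult sgn_less)
    then show ?thesis
      using poly_IVT[OF ab'] zero(1) by force
  next
    case left
    then have "poly q a' \<noteq> 0" using sa by (metis sgn_0_0)
    then show ?thesis
      using poly_sgn_right[OF ab'] left(2) sa by force
  next
    case right
    then have "poly q b' \<noteq> 0" using sb by (metis sgn_0_0)
    then show ?thesis
      using poly_sgn_left[OF ab'] right(2) sb by force
  qed
qed

lemma poly_sgn_at_top:
  fixes p :: "real poly"
  shows "\<exists>M. \<forall>x\<ge>M. sgn (poly p x) = sgn (lead_coeff p)"
proof (cases "p = 0")
  case False
  have pos: "\<exists>M. \<forall>x\<ge>M. sgn (poly r x) = 1" if "lead_coeff r > 0" for r :: "real poly"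
    using poly_pinfty_gt_lc[OF that] that by (metis less_le_trans sgn_pos)
  show ?thesis
  proof (cases "lead_coeff p > 0")
    case True
    then show ?thesis using pos[OF True] by simp
  next
    case neg: False
    with False have "lead_coeff p < 0"
      by (metis leading_coeff_0_iff linorder_neqE_linordered_idom)
    then show ?thesis
      using pos[of "-p"] by (simp add: sgn_minus)
  qed
qed auto

lemma poly_sgn_eq_sgn_pderiv_at_top:
  fixes p :: "real poly"
  assumes "pderiv p \<noteq> 0"
  shows "\<exists>M. \<forall>x\<ge>M. sgn (poly p x) = sgn (poly (pderiv p) x)"
proof -
  have "degree p \<noteq> 0"
    using assms by (simp add: pderiv_eq_0_iff)
  then have "sgn (lead_coeff (pderiv p)) = sgn (lead_coeff p)"
    by (simp add: degree_pderiv coeff_pderiv sgn_mult)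
  moreover obtain M N where "\<forall>x\<ge>M. sgn (poly p x) = sgn (lead_coeff p)"
    "\<forall>x\<ge>N. sgn (poly (pderiv p) x) = sgn (lead_coeff (pderiv p))"
    using poly_sgn_at_top by metis
  ultimately show ?thesis
    by (intro exI[of _ "max M N"]) auto
qed

lemma poly_sgn_eq_sgn_pderiv_at_bot:
  fixes p :: "real poly"
  assumes "pderiv p \<noteq> 0"
  shows "\<exists>M. \<forall>x\<ge>M. sgn (poly p (-x)) = - sgn (poly (pderiv p) (-x))"
proof -
  define r where "r = pcompose p [:0, -1:]"
  have r': "pderiv r = - pcompose (pderiv p) [:0, -1:]"
    by (simp add: r_def pderiv_pcompose pderiv_pCons)
  have "pderiv r \<noteq> 0"
    using assms by (simp add: r' pcompose_eq_0_iff)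
  then obtain M where "\<forall>x\<ge>M. sgn (poly r x) = sgn (poly (pderiv r) x)"
    using poly_sgn_eq_sgn_pderiv_at_top by blast
  moreover have r: "poly r x = poly p (-x)" "poly (pderiv r) x = - poly (pderiv p) (-x)" for x
    by (simp add: r_def poly_pcompose, simp add: r' poly_pcompose)
  ultimately show ?thesis
    unfolding r sgn_minus by blast
qed

text \<open>
  The polynomials are indexed so that \<open>P j\<close> and \<open>Q j\<close> correspond. Mutual embeddability says
  that both families have the same arrangement of signs along the line. Finite sets \<open>T\<close> of
  arbitrary size are enough, and asking for an embedding of \<open>T\<close> rather than for a homeomorphism
  of the line allows images to be chosen point by point.
\<close>

definition sign_embeds :: "'i set \<Rightarrow> ('i \<Rightarrow> real poly) \<Rightarrow> ('i \<Rightarrow> real poly) \<Rightarrow> bool" where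
  "sign_embeds J P Q \<longleftrightarrow>
    (\<forall>T. finite T \<longrightarrow> (\<exists>\<theta>. strict_mono_on T \<theta> \<and>
      (\<forall>t\<in>T. \<forall>j\<in>J. sgn (poly (P j) t) = sgn (poly (Q j) (\<theta> t)))))"

lemma sign_embedsE:
  assumes "sign_embeds J P Q" "finite T"
  obtains \<theta> where "strict_mono_on T \<theta>"
    "\<And>t j. t \<in> T \<Longrightarrow> j \<in> J \<Longrightarrow> sgn (poly (P j) t) = sgn (poly (Q j) (\<theta> t))"
proof -
  obtain \<theta> where "strict_mono_on T \<theta> \<and> (\<forall>t\<in>T. \<forall>j\<in>J. sgn (poly (P j) t) = sgn (poly (Q j) (\<theta> t)))"
    using assms unfolding sign_embeds_def by meson
  then show thesis
    by (intro that[of \<theta>]) simp_all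
qed

text \<open>
  A nonzero polynomial has a nonzero value, whose sign a zero polynomial cannot match.
\<close>

lemma sign_embeds_eq_0:
  assumes "sign_embeds J P Q" "j \<in> J" "Q j = 0"
  shows "P j = 0"
proof (rule ccontr)
  assume "P j \<noteq> 0"
  then have "{t. poly (P j) t = 0} \<noteq> UNIV"
    using poly_roots_finite infinite_UNIV_char_0 by metis
  then obtain t where t: "poly (P j) t \<noteq> 0" by auto
  obtain \<theta> where "sgn (poly (P j) t) = sgn (poly (Q j) (\<theta> t))"
    using sign_embedsE[OF assms(1), of "{t}"] assms(2) by (metis finite.emptyI finite_insert insertI1)
  with t assms(3) show False by (simp add: sgn_0_0)
qed

lemma finite_neighbours:
  fixes U :: "real set"
  assumes fin: "finite U" and "l \<in> U" "l < t" "m \<in> U" "t < m"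
  obtains a b where "a \<in> U" "a < t" "\<And>u. u \<in> U \<Longrightarrow> u < t \<Longrightarrow> u \<le> a"
    "b \<in> U" "t < b" "\<And>u. u \<in> U \<Longrightarrow> t < u \<Longrightarrow> b \<le> u"
proof -
  let ?A = "{u\<in>U. u < t}" and ?B = "{u\<in>U. t < u}"
  have A: "finite ?A" "?A \<noteq> {}" and B: "finite ?B" "?B \<noteq> {}"
    using assms by auto
  show thesis
  proof (rule that[of "Max ?A" "Min ?B"])
    show "Max ?A \<in> U" "Max ?A < t" "Min ?B \<in> U" "t < Min ?B"
      using Max_in[OF A] Min_in[OF B] by auto
    show "u \<le> Max ?A" if "u \<in> U" "u < t" for u
      using that A(1) by (intro Max_ge) auto
    show "Min ?B \<le> u" if "u \<in> U" "t < u" for u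
      using that B(1) by (intro Min_le) auto
  qed
qed

text \<open>
  The step of Cohen and Hoermander. The family \<open>J\<close> contains, besides the polynomials \<open>J0\<close> to be
  kept, auxiliary ones that reveal the sign of \<open>p\<close> at the roots of each member of \<open>J0\<close>; this is
  the assumption on \<open>k\<close>, met by remainders of \<open>p\<close>. As \<open>pderiv p\<close> belongs to \<open>J0\<close>, the new
  polynomial is monotone between consecutive roots of \<open>J0\<close>, so its signs there are governed by
  those at the endpoints.
\<close>

lemma sign_embeds_extend:
  fixes P Q :: "'i \<Rightarrow> real poly"
  assumes fin: "finite J" and sub: "J0 \<subseteq> J"
    and PQ: "sign_embeds J P Q" and QP: "sign_embeds J Q P"
    and d: "d \<in> J0" "P d = pderiv p" "Q d = pderiv q"
    and key: "\<And>j. j \<in> J0 \<Longrightarrow> P j \<noteq> 0 \<Longrightarrow> \<exists>k\<in>J.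
        (\<forall>z. poly (P j) z = 0 \<longrightarrow> sgn (poly (P k) z) = sgn (poly p z)) \<and>
        (\<forall>z. poly (Q j) z = 0 \<longrightarrow> sgn (poly (Q k) z) = sgn (poly q z))"
    and nz: "pderiv p \<noteq> 0"
    and T: "finite T"
  shows "\<exists>\<theta>. strict_mono_on T \<theta> \<and>
    (\<forall>t\<in>T. (\<forall>j\<in>J0. sgn (poly (P j) t) = sgn (poly (Q j) (\<theta> t))) \<and> sgn (poly p t) = sgn (poly q (\<theta> t)))"
proof -
  define Z where "Z = (\<lambda>R :: 'i \<Rightarrow> real poly. {z. \<exists>j\<in>J0. R j \<noteq> 0 \<and> poly (R j) z = 0})"
  have zero_iff: "P j = 0 \<longleftrightarrow> Q j = 0" if "j \<in> J" for j
    using sign_embeds_eq_0[OF PQ that] sign_embeds_eq_0[OF QP that] by blast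
  have finZ: "finite (Z R)" for R
  proof -
    have "Z R = (\<Union>j\<in>{j\<in>J0. R j \<noteq> 0}. {z. poly (R j) z = 0})"
      by (auto simp: Z_def)
    then show ?thesis
      using fin sub by (auto intro!: poly_roots_finite dest: finite_subset)
  qed
  have image_sub: "\<theta> ` Z R \<subseteq> Z R'" "inj_on \<theta> (Z R)"
    if "strict_mono_on S \<theta>" "Z R \<subseteq> S" "\<And>j. j \<in> J \<Longrightarrow> R j = 0 \<longleftrightarrow> R' j = 0"
      "\<And>t j. t \<in> S \<Longrightarrow> j \<in> J \<Longrightarrow> sgn (poly (R j) t) = sgn (poly (R' j) (\<theta> t))"
    for \<theta> S and R R' :: "'i \<Rightarrow> real poly"
  proof -
    show "\<theta> ` Z R \<subseteq> Z R'"
    proof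
      fix u assume "u \<in> \<theta> ` Z R"
      then obtain z j where z: "u = \<theta> z" "z \<in> Z R" "j \<in> J0" "R j \<noteq> 0" "poly (R j) z = 0"
        by (auto simp: Z_def)
      have "z \<in> S" "j \<in> J"
        using z(2,3) that(2) sub by blast+
      then have "sgn (poly (R' j) (\<theta> z)) = 0"
        using that(4)[of z j] z(5) by simp
      then have "poly (R' j) u = 0"
        using z(1) by (simp add: sgn_0_0)
      moreover have "R' j \<noteq> 0"
        using z(4) that(3)[OF \<open>j \<in> J\<close>] by simp
      ultimately show "u \<in> Z R'" using z(3) by (auto simp: Z_def)
    qed
    show "inj_on \<theta> (Z R)"
      using that(1,2) strict_mono_on_imp_inj_on inj_on_subset by blast
  qed
  \<comment> \<open>Counting roots in both directions shows that an embedding maps the roots onto the roots.\<close>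
  have card_le: "card (Z Q) \<le> card (Z P)"
  proof -
    obtain \<theta> where "strict_mono_on (Z Q) \<theta>"
      "\<And>t j. t \<in> Z Q \<Longrightarrow> j \<in> J \<Longrightarrow> sgn (poly (Q j) t) = sgn (poly (P j) (\<theta> t))"
      using sign_embedsE[OF QP finZ[of Q]] by blast
    then show ?thesis
      using image_sub[of "Z Q" \<theta> Q P, OF _ order_refl zero_iff[symmetric]] finZ[of P]
      by (intro card_inj_on_le[of \<theta>]) simp_all
  qed
  obtain M1 M2 where M1: "\<forall>x\<ge>M1. sgn (poly p x) = sgn (poly (pderiv p) x)"
    and M2: "\<forall>x\<ge>M2. sgn (poly p (-x)) = - sgn (poly (pderiv p) (-x))"
    using poly_sgn_eq_sgn_pderiv_at_top[OF nz] poly_sgn_eq_sgn_pderiv_at_bot[OF nz] by blast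
  have "pderiv q \<noteq> 0"
    using nz zero_iff[of d] d sub by auto
  then obtain N1 N2 where N1: "\<forall>x\<ge>N1. sgn (poly q x) = sgn (poly (pderiv q) x)"
    and N2: "\<forall>x\<ge>N2. sgn (poly q (-x)) = - sgn (poly (pderiv q) (-x))"
    using poly_sgn_eq_sgn_pderiv_at_top poly_sgn_eq_sgn_pderiv_at_bot by blast
  obtain B where B: "B > 0" "\<And>z. z \<in> Z P \<union> T \<Longrightarrow> \<bar>z\<bar> \<le> B"
    using finite_imp_bounded[of "Z P \<union> T"] finZ T unfolding bounded_pos by auto
  \<comment> \<open>Beyond \<open>\<plusminus>M\<close> the sign of \<open>p\<close> is governed by that of \<open>p'\<close>. With these two points added,
    every point to be inserted later has a neighbour on each side.\<close>
  define M where "M = max (B + 1) (max M1 M2)"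
  have M: "\<And>z. z \<in> Z P \<union> T \<Longrightarrow> -M < z \<and> z < M" "M \<ge> M1" "M \<ge> M2" "M > 0"
    using B by (force simp: M_def)+
  obtain \<theta>0 where mono0: "strict_mono_on (Z P \<union> T \<union> {-M, M}) \<theta>0"
    and sgn0: "\<And>t j. t \<in> Z P \<union> T \<union> {-M, M} \<Longrightarrow> j \<in> J \<Longrightarrow>
        sgn (poly (P j) t) = sgn (poly (Q j) (\<theta>0 t))"
    using sign_embedsE[OF PQ, of "Z P \<union> T \<union> {-M, M}"] finZ T by auto
  have ZQ: "Z Q = \<theta>0 ` Z P"
  proof -
    have sub0: "Z P \<subseteq> Z P \<union> T \<union> {-M, M}" by auto
    have "\<theta>0 ` Z P \<subseteq> Z Q" "inj_on \<theta>0 (Z P)"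
      using image_sub[where R = P and R' = Q, OF mono0 sub0] zero_iff sgn0 by simp_all
    moreover from this have "card (\<theta>0 ` Z P) = card (Z Q)"
      using card_le finZ[of Q] by (metis card_image card_mono le_antisym)
    ultimately show ?thesis
      using card_subset_eq[OF finZ] by metis
  qed
  have same_sgn: "sgn (poly (Q j) u) = sgn (poly (Q j) v)"
    if "j \<in> J0" and "\<And>z. z \<in> Z P \<Longrightarrow> \<not> (u \<le> \<theta>0 z \<and> \<theta>0 z \<le> v) \<and> \<not> (v \<le> \<theta>0 z \<and> \<theta>0 z \<le> u)" for j u v
  proof (cases "Q j = 0")
    case False
    then have "w \<in> Z Q" if "poly (Q j) w = 0" for w
      using that \<open>j \<in> J0\<close> by (auto simp: Z_def)
    then have *: "\<exists>z\<in>Z P. w = \<theta>0 z" if "poly (Q j) w = 0" for w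
      using that ZQ by auto
    show ?thesis
    proof (cases "u \<le> v")
      case True
      then show ?thesis
        using * that(2) by (intro poly_sgn_eq_without_roots) auto
    next
      case False
      then show ?thesis
        using * that(2) by (intro poly_sgn_eq_without_roots[symmetric]) auto
    qed
  qed auto
  define good where "good = (\<lambda>u v. (\<forall>j\<in>J0. sgn (poly (P j) u) = sgn (poly (Q j) v)) \<and>
    sgn (poly p u) = sgn (poly q v))"
  have good_Z: "good z (\<theta>0 z)" if z: "z \<in> Z P" for z
  proof -
    obtain j where j: "j \<in> J0" "P j \<noteq> 0" "poly (P j) z = 0"
      using z by (auto simp: Z_def)
    have s: "sgn (poly (P i) z) = sgn (poly (Q i) (\<theta>0 z))" if "i \<in> J" for i
      using sgn0[OF _ that] z by simp
    have "poly (Q j) (\<theta>0 z) = 0"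
      using s[of j] j sub by (auto simp: sgn_0_0)
    then show ?thesis
      using key[OF j(1,2)] j(3) s sub unfolding good_def by (metis subsetD)
  qed
  \<comment> \<open>The images of \<open>\<plusminus>M\<close> are moved further out so that the sign of \<open>q\<close>, too, is governed by \<open>q'\<close>.\<close>
  define N where "N = max (max N1 N2) (max \<bar>\<theta>0 M\<bar> \<bar>\<theta>0 (-M)\<bar> + 1)"
  have N: "N \<ge> N1" "N \<ge> N2" "\<theta>0 M < N" "-N < \<theta>0 (-M)" "N > 0"
    by (auto simp: N_def)
  have Z_less: "\<theta>0 (-M) < \<theta>0 z \<and> \<theta>0 z < \<theta>0 M" if "z \<in> Z P" for z
    using strict_mono_onD[OF mono0] M(1)[of z] that by auto
  have good_M: "good M N"
  proof -
    have J: "sgn (poly (P j) M) = sgn (poly (Q j) N)" if "j \<in> J0" for j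
    proof -
      have "sgn (poly (Q j) (\<theta>0 M)) = sgn (poly (Q j) N)"
        using N Z_less by (intro same_sgn[OF that]) fastforce
      then show ?thesis
        using sgn0[of M j] that sub by auto
    qed
    show ?thesis
      using J[OF d(1)] J M1 N1 M(2) N(1) d unfolding good_def by auto
  qed
  have good_mM: "good (-M) (-N)"
  proof -
    have J: "sgn (poly (P j) (-M)) = sgn (poly (Q j) (-N))" if "j \<in> J0" for j
    proof -
      have "sgn (poly (Q j) (\<theta>0 (-M))) = sgn (poly (Q j) (-N))"
        using N Z_less by (intro same_sgn[OF that]) fastforce
      then show ?thesis
        using sgn0[of "-M" j] that sub by auto
    qed
    show ?thesis
      using J[OF d(1)] J M2 N2 M(3) N(2) d unfolding good_def by auto
  qed
  define U where "U = Z P \<union> {-M, M}"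
  \<comment> \<open>Insertion of the points of \<open>T\<close> one by one. A new image may be anywhere between the images of
    the neighbours as far as \<open>J0\<close> is concerned, since there are no roots in between; it is chosen to
    give \<open>q\<close> the right sign.\<close>
  have ext: "\<exists>\<theta>. strict_mono_on (U \<union> V) \<theta> \<and> (\<forall>z\<in>Z P. \<theta> z = \<theta>0 z) \<and> (\<forall>u\<in>U \<union> V. good u (\<theta> u))"
    if "finite V" "V \<subseteq> T" for V
    using that
  proof (induction V)
    case empty
    define \<theta> where "\<theta> = \<theta>0(M := N, -M := -N)"
    have vals: "\<theta> M = N" "\<theta> (-M) = -N" "\<And>z. z \<in> Z P \<Longrightarrow> \<theta> z = \<theta>0 z"
      using M(1,4) by (auto simp: \<theta>_def)
    have "strict_mono_on U \<theta>"
    proof (rule strict_mono_onI)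
      fix r s assume rs: "r \<in> U" "s \<in> U" "r < s"
      consider "r \<in> Z P" "s \<in> Z P" | "r = -M" "s \<in> Z P" | "r \<in> Z P" "s = M" | "r = -M" "s = M"
        using rs M(1)[of r] M(1)[of s] M(4) by (auto simp: U_def)
      then show "\<theta> r < \<theta> s"
      proof cases
        case 1
        then show ?thesis
          using strict_mono_onD[OF mono0, of r s] rs by (simp add: vals)
      next
        case 2
        then show ?thesis using Z_less[of s] N by (simp add: vals)
      next
        case 3
        then show ?thesis using Z_less[of r] N by (simp add: vals)
      next
        case 4
        then show ?thesis using N by (simp add: vals)
      qed
    qed
    moreover have "\<forall>u\<in>U. good u (\<theta> u)"
      using good_Z good_M good_mM by (auto simp: U_def vals)
    ultimately show ?case using vals(3) by auto
  next
    case (insert t V)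
    then obtain \<theta> where mono: "strict_mono_on (U \<union> V) \<theta>" and eq0: "\<And>z. z \<in> Z P \<Longrightarrow> \<theta> z = \<theta>0 z"
      and good: "\<And>u. u \<in> U \<union> V \<Longrightarrow> good u (\<theta> u)"
      by auto
    show ?case
    proof (cases "t \<in> U \<union> V")
      case True
      then have "U \<union> insert t V = U \<union> V" by auto
      then show ?thesis using mono eq0 good by auto
    next
      case False
      have t: "t \<in> T" "-M < t" "t < M"
        using insert.prems M(1) by auto
      have finUV: "finite (U \<union> V)"
        using finZ insert.hyps by (simp add: U_def)
      have "-M \<in> U \<union> V" "M \<in> U \<union> V"
        by (auto simp: U_def)
      then obtain a b where a: "a \<in> U \<union> V" "a < t" and le_a: "\<And>u. u \<in> U \<union> V \<Longrightarrow> u < t \<Longrightarrow> u \<le> a"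
        and b: "b \<in> U \<union> V" "t < b" and ge_b: "\<And>u. u \<in> U \<union> V \<Longrightarrow> t < u \<Longrightarrow> b \<le> u"
        using finite_neighbours[OF finUV _ t(2) _ t(3)] by metis
      have mono_le: "\<theta> u \<le> \<theta> v" if "u \<in> U \<union> V" "v \<in> U \<union> V" "u \<le> v" for u v
        using strict_mono_onD[OF mono that(1,2)] that(3) by (cases "u = v") auto
      have "\<exists>t'. \<theta> a < t' \<and> t' < \<theta> b \<and> sgn (poly q t') = sgn (poly p t)"
      proof (rule poly_realise_sign_between[OF a(2) b(2)])
        show "\<theta> a < \<theta> b"
          using strict_mono_onD[OF mono a(1) b(1)] a b by simp
        show "poly (pderiv p) s \<noteq> 0" if s: "a < s" "s < b" for s
        proof
          assume "poly (pderiv p) s = 0"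
          then have "s \<in> Z P"
            unfolding Z_def using d nz by (intro CollectI bexI[of _ d]) simp_all
          then have "s \<in> U \<union> V"
            by (simp add: U_def)
          then show False
            using s le_a[of s] ge_b[of s] False by (cases "s < t"; cases "s = t") auto
        qed
        show "sgn (poly p a) = sgn (poly q (\<theta> a))" "sgn (poly p b) = sgn (poly q (\<theta> b))"
          using good a b by (auto simp: good_def)
      qed
      then obtain t' where t': "\<theta> a < t'" "t' < \<theta> b" "sgn (poly q t') = sgn (poly p t)"
        by blast
      have sgn_t': "sgn (poly (P j) t) = sgn (poly (Q j) t')" if "j \<in> J0" for j
      proof -
        have "\<not> (\<theta>0 t \<le> \<theta>0 z \<and> \<theta>0 z \<le> t') \<and> \<not> (t' \<le> \<theta>0 z \<and> \<theta>0 z \<le> \<theta>0 t)" if z: "z \<in> Z P" for z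
        proof -
          have zU: "z \<in> U \<union> V" "z \<noteq> t" using z False by (auto simp: U_def)
          show ?thesis
          proof (cases "z < t")
            case True
            then have "\<theta>0 z < \<theta>0 t"
              using strict_mono_onD[OF mono0, of z t] z t by auto
            moreover have "\<theta>0 z < t'"
              using mono_le[OF zU(1) a(1) le_a[OF zU(1) True]] t'(1) eq0[OF z] by simp
            ultimately show ?thesis by auto
          next
            case not_less: False
            with zU have "t < z" by simp
            then have "\<theta>0 t < \<theta>0 z"
              using strict_mono_onD[OF mono0, of t z] z t by auto
            moreover have "t' < \<theta>0 z"
              using mono_le[OF b(1) zU(1) ge_b[OF zU(1) \<open>t < z\<close>]] t'(2) eq0[OF z] by simp
            ultimately show ?thesis by auto
          qed
        qed
        then have "sgn (poly (Q j) (\<theta>0 t)) = sgn (poly (Q j) t')"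
          by (intro same_sgn that)
        then show ?thesis using sgn0[of t j] t that sub by auto
      qed
      have good_t: "good t t'"
        using sgn_t' t'(3) by (simp add: good_def)
      have "strict_mono_on (U \<union> insert t V) (\<theta>(t := t'))"
      proof (rule strict_mono_onI)
        fix r s assume rs: "r \<in> U \<union> insert t V" "s \<in> U \<union> insert t V" "r < s"
        consider "r = t" "s \<in> U \<union> V" "s \<noteq> t" | "s = t" "r \<in> U \<union> V" "r \<noteq> t"
          | "r \<in> U \<union> V" "s \<in> U \<union> V" "r \<noteq> t" "s \<noteq> t"
          using rs by auto
        then show "(\<theta>(t := t')) r < (\<theta>(t := t')) s"
        proof cases
          case 1
          then show ?thesis
            using mono_le[OF b(1) 1(2) ge_b] rs t'(2) by auto
        next
          case 2
          then show ?thesis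
            using mono_le[OF 2(2) a(1) le_a] rs t'(1) by auto
        next
          case 3
          then show ?thesis using strict_mono_onD[OF mono 3(1,2)] rs by auto
        qed
      qed
      moreover have "\<forall>z\<in>Z P. (\<theta>(t := t')) z = \<theta>0 z"
        using eq0 False by (auto simp: U_def)
      moreover have "\<forall>u\<in>U \<union> insert t V. good u ((\<theta>(t := t')) u)"
        using good good_t False by auto
      ultimately show ?thesis by blast
    qed
  qed
  obtain \<theta> where \<theta>: "strict_mono_on (U \<union> T) \<theta>" "\<forall>u\<in>U \<union> T. good u (\<theta> u)"
    using ext[OF T] by auto
  have "strict_mono_on T \<theta>"
    using \<theta>(1) by (rule monotone_on_subset) auto
  then show ?thesis
    using \<theta>(2) unfolding good_def by auto
qed

section \<open>Families of polynomials and elimination of one variable\<close>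

text \<open>
  A polynomial in one variable whose coefficients are polynomial functions of a parameter. The
  number \<open>n\<close> bounds the degree for every parameter; the actual degree may drop.
\<close>

definition poly_family :: "nat \<Rightarrow> ('a::euclidean_space \<Rightarrow> real poly) \<Rightarrow> bool" where
  "poly_family n c \<longleftrightarrow>
    (\<forall>i. real_polynomial_function (\<lambda>x. coeff (c x) i)) \<and> (\<forall>x. degree (c x) \<le> n)"

lemma poly_family_coeff: "poly_family n c \<Longrightarrow> real_polynomial_function (\<lambda>x. coeff (c x) i)"
  by (simp add: poly_family_def)

lemma poly_family_degree: "poly_family n c \<Longrightarrow> degree (c x) \<le> n"
  by (simp add: poly_family_def)

lemma poly_family_mono: "poly_family n c \<Longrightarrow> n \<le> m \<Longrightarrow> poly_family m c"
  unfolding poly_family_def using le_trans by blast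

lemma poly_family_pderiv:
  assumes "poly_family n c"
  shows "poly_family (n - 1) (\<lambda>x. pderiv (c x))"
  unfolding poly_family_def coeff_pderiv degree_pderiv
  using poly_family_coeff[OF assms] poly_family_degree[OF assms]
  by (auto intro!: real_polynomial_function.intros(4) real_polynomial_function.intros(2) diff_le_mono)

lemma poly_family_add:
  assumes "poly_family n c" "poly_family m d"
  shows "poly_family (max n m) (\<lambda>x. c x + d x)"
  unfolding poly_family_def coeff_add
  using poly_family_coeff[OF assms(1)] poly_family_coeff[OF assms(2)]
  by (intro conjI allI real_polynomial_function.intros(3) order_trans[OF degree_add_le_max max.mono]
      poly_family_degree[OF assms(1)] poly_family_degree[OF assms(2)])

lemma poly_family_mult:
  assumes "poly_family n c" "poly_family m d"
  shows "poly_family (n + m) (\<lambda>x. c x * d x)"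
  unfolding poly_family_def coeff_mult
proof (intro conjI allI)
  show "real_polynomial_function (\<lambda>x. \<Sum>i\<le>k. coeff (c x) i * coeff (d x) (k - i))" for k
    by (intro real_polynomial_function_sum real_polynomial_function.intros(4)
        poly_family_coeff[OF assms(1)] poly_family_coeff[OF assms(2)]) auto
  show "degree (c x * d x) \<le> n + m" for x
    using degree_mult_le[of "c x" "d x"] poly_family_degree[OF assms(1), of x]
      poly_family_degree[OF assms(2), of x] by linarith
qed

text \<open>
  Division of \<open>c x\<close> by \<open>d x\<close> on the set of parameters where \<open>d x\<close> has exact degree \<open>m\<close>.
  Coefficients must remain polynomial, so the leading coefficient \<open>b\<close> of the divisor is not
  inverted; each step multiplies the dividend by \<open>b\<^sup>2\<close>, which preserves signs.
\<close>

lemma poly_family_remainder: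
  fixes c d :: "'a::euclidean_space \<Rightarrow> real poly"
  assumes "poly_family n c" and d: "poly_family l d" and m: "m > 0"
  shows "\<exists>r. poly_family (m - 1) r \<and>
    (\<forall>x. degree (d x) = m \<longrightarrow> (\<forall>z. poly (d x) z = 0 \<longrightarrow> sgn (poly (r x) z) = sgn (poly (c x) z)))"
  using assms(1)
proof (induction n arbitrary: c)
  case 0
  then have "poly_family (m - 1) c"
    by (rule poly_family_mono) simp
  then show ?case by blast
next
  case (Suc n)
  show ?case
  proof (cases "Suc n \<le> m - 1")
    case True
    then have "poly_family (m - 1) c"
      using Suc.prems poly_family_mono by blast
    then show ?thesis by blast
  next
    case False
    then have mn: "m \<le> Suc n" using m by linarith
    define b where "b = (\<lambda>x. coeff (d x) m)"
    define a where "a = (\<lambda>x. coeff (c x) (Suc n))"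
    \<comment> \<open>The formal leading terms cancel. The cutoff keeps the degree bound valid also where
      \<open>d x\<close> has degree greater than \<open>m\<close>.\<close>
    define c' where "c' = (\<lambda>x. smult (b x * b x) (c x)
      - monom (b x * a x) (Suc n - m) * poly_cutoff (Suc m) (d x))"
    have coeff: "coeff (c' x) i = b x * b x * coeff (c x) i -
      (if Suc n - m \<le> i then b x * a x * (if i - (Suc n - m) < Suc m then coeff (d x) (i - (Suc n - m)) else 0)
       else 0)" for x i
      by (simp add: c'_def coeff_monom_mult coeff_poly_cutoff)
    have "poly_family n c'"
      unfolding poly_family_def
    proof (intro conjI allI)
      fix i
      show "real_polynomial_function (\<lambda>x. coeff (c' x) i)"
        unfolding coeff b_def a_def
        using poly_family_coeff[OF Suc.prems] poly_family_coeff[OF d]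
        by (cases "Suc n - m \<le> i"; cases "i - (Suc n - m) < Suc m")
          (auto intro!: real_polynomial_function.intros(4) real_polynomial_function_diff
            real_polynomial_function.intros(2) simp del: diff_Suc_Suc)
    next
      fix x
      show "degree (c' x) \<le> n"
      proof (rule degree_le, intro allI impI)
        fix i assume i: "n < i"
        show "coeff (c' x) i = 0"
        proof (cases "i = Suc n")
          case True
          then show ?thesis
            using mn by (simp add: coeff a_def b_def)
        next
          case False
          with i have "coeff (c x) i = 0" "\<not> i - (Suc n - m) < Suc m"
            using poly_family_degree[OF Suc.prems, of x] mn by (auto intro!: coeff_eq_0)
          then show ?thesis by (simp add: coeff)
        qed
      qed
    qed
    then obtain r where r: "poly_family (m - 1) r"
      "\<And>x z. degree (d x) = m \<Longrightarrow> poly (d x) z = 0 \<Longrightarrow> sgn (poly (r x) z) = sgn (poly (c' x) z)"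
      using Suc.IH by blast
    have "sgn (poly (c' x) z) = sgn (poly (c x) z)" if x: "degree (d x) = m" "poly (d x) z = 0" for x z
    proof -
      have "poly_cutoff (Suc m) (d x) = d x"
        using x(1) by (auto simp: poly_eq_iff coeff_poly_cutoff intro!: coeff_eq_0)
      moreover have "b x \<noteq> 0"
        using x(1) m by (metis b_def degree_0 leading_coeff_0_iff less_numeral_extra(3))
      ultimately show ?thesis
        using x(2) by (auto simp: c'_def sgn_if zero_less_mult_iff)
    qed
    with r show ?thesis by (intro exI[of _ r]) auto
  qed
qed

definition same_signs :: "('a \<Rightarrow> real) set \<Rightarrow> 'a \<Rightarrow> 'a \<Rightarrow> bool" where
  "same_signs \<Psi> x x' \<longleftrightarrow> (\<forall>p\<in>\<Psi>. sgn (p x) = sgn (p x'))"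

lemma same_signs_sym: "same_signs \<Psi> x x' \<Longrightarrow> same_signs \<Psi> x' x"
  by (simp add: same_signs_def)

lemma same_signs_subset: "same_signs \<Psi> x x' \<Longrightarrow> \<Phi> \<subseteq> \<Psi> \<Longrightarrow> same_signs \<Phi> x x'"
  by (auto simp: same_signs_def)

lemma poly_const_eval: "degree p = 0 \<Longrightarrow> poly p t = coeff p 0" for p :: "real poly"
  by (auto elim!: degree_eq_zeroE)

lemma degree_eq_if_coeffs_vanish_together:
  assumes "\<And>i. coeff p i = 0 \<longleftrightarrow> coeff q i = 0"
  shows "degree p = degree q"
  by (rule antisym; rule degree_le) (use assms coeff_eq_0 in blast)+

text \<open>
  Induction on the degree bound and, within it, on the number of polynomials of top
  degree. Replacing one of them, \<open>p\<close>, by its derivative and by its remainders adds only members of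
  smaller degree. There is one remainder for each possible exact degree of the divisor, and the
  signs of the coefficients decide which of them is relevant at a given parameter.
\<close>

lemma signs_determine_sign_embeds:
  fixes \<Phi> :: "('a::euclidean_space \<Rightarrow> real poly) set"
  assumes "finite \<Phi>" and "\<forall>c\<in>\<Phi>. poly_family n c"
  shows "\<exists>\<Psi>. finite \<Psi> \<and> (\<forall>p\<in>\<Psi>. real_polynomial_function p) \<and>
    (\<forall>x x'. same_signs \<Psi> x x' \<longrightarrow> sign_embeds \<Phi> (\<lambda>c. c x) (\<lambda>c. c x'))"
  using assms
proof (induction n arbitrary: \<Phi>)
  case 0
  let ?\<Psi> = "(\<lambda>c x. coeff (c x) 0) ` \<Phi>"
  have "sign_embeds \<Phi> (\<lambda>c. c x) (\<lambda>c. c x')" if "same_signs ?\<Psi> x x'" for x x'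
  proof -
    have "sgn (poly (c x) t) = sgn (poly (c x') t)" if c: "c \<in> \<Phi>" for c t
    proof -
      have "degree (c x) = 0" "degree (c x') = 0"
        using poly_family_degree[of 0 c] 0(2) c by auto
      then show ?thesis
        using \<open>same_signs ?\<Psi> x x'\<close> c by (simp add: poly_const_eval same_signs_def)
    qed
    then show ?thesis
      unfolding sign_embeds_def by (intro allI impI exI[of _ "\<lambda>t. t"]) (auto simp: strict_mono_on_def)
  qed
  then show ?case
    using 0 poly_family_coeff by (intro exI[of _ ?\<Psi>]) blast
next
  case (Suc n)
  have "\<exists>\<Psi>. finite \<Psi> \<and> (\<forall>p\<in>\<Psi>. real_polynomial_function p) \<and>
      (\<forall>x x'. same_signs \<Psi> x x' \<longrightarrow> sign_embeds (G \<union> H) (\<lambda>c. c x) (\<lambda>c. c x'))"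
    if "finite H" "\<forall>c\<in>H. poly_family (Suc n) c" "finite G" "\<forall>c\<in>G. poly_family n c"
    for G H :: "('a \<Rightarrow> real poly) set"
    using that
  proof (induction H arbitrary: G)
    case empty
    then show ?case using Suc.IH[of G] by simp
  next
    case (insert p H)
    define p' where "p' = (\<lambda>x. pderiv (p x))"
    define J0 where "J0 = G \<union> {p'} \<union> H"
    have p: "poly_family (Suc n) p" and p': "poly_family n p'"
      using insert.prems poly_family_pderiv[of "Suc n" p] by (auto simp: p'_def)
    have J0: "finite J0" "\<And>j. j \<in> J0 \<Longrightarrow> poly_family (Suc n) j"
      using insert.prems insert.hyps p' poly_family_mono[of n _ "Suc n"] by (auto simp: J0_def)
    have "\<forall>j\<in>J0. \<forall>m\<in>{1..Suc n}. \<exists>r. poly_family (m - 1) r \<and>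
        (\<forall>x. degree (j x) = m \<longrightarrow> (\<forall>z. poly (j x) z = 0 \<longrightarrow> sgn (poly (r x) z) = sgn (poly (p x) z)))"
      using poly_family_remainder[OF p J0(2)] by auto
    then obtain rem where rem: "\<And>j m. j \<in> J0 \<Longrightarrow> m \<in> {1..Suc n} \<Longrightarrow> poly_family (m - 1) (rem j m)"
      "\<And>j m x z. j \<in> J0 \<Longrightarrow> m \<in> {1..Suc n} \<Longrightarrow> degree (j x) = m \<Longrightarrow> poly (j x) z = 0 \<Longrightarrow>
         sgn (poly (rem j m x) z) = sgn (poly (p x) z)"
      by metis
    define R where "R = (\<lambda>(j, m). rem j m) ` (J0 \<times> {1..Suc n})"
    have R: "finite R" "\<forall>c\<in>R. poly_family n c"
      using J0(1) by (auto simp: R_def intro!: poly_family_mono[OF rem(1)])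
    define J where "J = G \<union> {p'} \<union> R \<union> H"
    have J: "finite J" "J0 \<subseteq> J"
      using insert.prems insert.hyps R by (auto simp: J_def J0_def)
    obtain \<Psi>0 where \<Psi>0: "finite \<Psi>0" "\<forall>p\<in>\<Psi>0. real_polynomial_function p"
      "\<And>x x'. same_signs \<Psi>0 x x' \<Longrightarrow> sign_embeds J (\<lambda>c. c x) (\<lambda>c. c x')"
      using insert.IH[of "G \<union> {p'} \<union> R"] insert.prems p' R by (auto simp: J_def)
    define C where "C = (\<lambda>(j, i) x. coeff (j x) i) ` (insert p J0 \<times> {..Suc n})"
    define \<Psi> where "\<Psi> = \<Psi>0 \<union> C"
    have "finite \<Psi>" "\<forall>p\<in>\<Psi>. real_polynomial_function p"
      using \<Psi>0 J0(1) poly_family_coeff[OF J0(2)] poly_family_coeff[OF p] by (auto simp: \<Psi>_def C_def)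
    moreover have "sign_embeds (G \<union> insert p H) (\<lambda>c. c x) (\<lambda>c. c x')"
      if same: "same_signs \<Psi> x x'" for x x'
    proof -
      have emb: "sign_embeds J (\<lambda>c. c x) (\<lambda>c. c x')" "sign_embeds J (\<lambda>c. c x') (\<lambda>c. c x)"
        using \<Psi>0(3) same_signs_subset[OF same] same_signs_subset[OF same_signs_sym[OF same]]
        by (simp_all add: \<Psi>_def)
      have coeff_sgn: "sgn (coeff (j x) i) = sgn (coeff (j x') i)" if "j \<in> insert p J0" "i \<le> Suc n" for j i
      proof -
        have "(\<lambda>x. coeff (j x) i) \<in> C"
          using that unfolding C_def by (intro image_eqI[of _ _ "(j, i)"]) auto
        then show ?thesis
          using bspec[OF same[unfolded same_signs_def], of "\<lambda>x. coeff (j x) i"] by (simp add: \<Psi>_def)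
      qed
      have p'J: "p' \<in> J" by (simp add: J_def)
      show ?thesis
      proof (cases "p' x = 0")
        case True
        then have "p' x' = 0"
          using sign_embeds_eq_0[OF emb(2) p'J] by simp
        then have "degree (p x) = 0" "degree (p x') = 0"
          using True by (auto simp: p'_def pderiv_eq_0_iff)
        then have p_sgn: "sgn (poly (p x) t) = sgn (poly (p x') s)" for s t
          using coeff_sgn[of p 0] by (simp add: poly_const_eval)
        show ?thesis
          unfolding sign_embeds_def
        proof (intro allI impI)
          fix T :: "real set" assume "finite T"
          then obtain \<theta> where "strict_mono_on T \<theta>"
            "\<And>t j. t \<in> T \<Longrightarrow> j \<in> J \<Longrightarrow> sgn (poly (j x) t) = sgn (poly (j x') (\<theta> t))"
            using sign_embedsE[OF emb(1)] by metis
          then show "\<exists>\<theta>. strict_mono_on T \<theta> \<and>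
            (\<forall>t\<in>T. \<forall>j\<in>G \<union> insert p H. sgn (poly (j x) t) = sgn (poly (j x') (\<theta> t)))"
            using p_sgn by (intro exI[of _ \<theta>]) (auto simp: J_def)
        qed
      next
        case False
        have deg: "degree (j x) = degree (j x')" if "j \<in> J0" for j
        proof (rule degree_eq_if_coeffs_vanish_together)
          fix i
          show "coeff (j x) i = 0 \<longleftrightarrow> coeff (j x') i = 0"
          proof (cases "i \<le> Suc n")
            case True
            then show ?thesis using coeff_sgn[of j i] that by (metis insertCI sgn_0_0)
          next
            case False
            then have "coeff (j x) i = 0" "coeff (j x') i = 0"
              using poly_family_degree[OF J0(2)[OF that]] by (meson coeff_eq_0 le_less_trans not_le)+
            then show ?thesis by simp
          qed
        qed
        have key: "\<exists>k\<in>J. (\<forall>z. poly (j x) z = 0 \<longrightarrow> sgn (poly (k x) z) = sgn (poly (p x) z)) \<and>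
            (\<forall>z. poly (j x') z = 0 \<longrightarrow> sgn (poly (k x') z) = sgn (poly (p x') z))"
          if j: "j \<in> J0" "j x \<noteq> 0" for j
        proof (cases "degree (j x) = 0")
          case True
          have "j x' \<noteq> 0"
            using sign_embeds_eq_0[OF emb(1)] j J(2) by blast
          then have "poly (j x) z \<noteq> 0" "poly (j x') z \<noteq> 0" for z
            using j(2) True deg[OF j(1)] by (auto elim!: degree_eq_zeroE)
          \<comment> \<open>A nonzero constant has no roots, so any member of \<open>J\<close> will do.\<close>
          then show ?thesis using p'J by auto
        next
          case False
          let ?m = "degree (j x)"
          have m: "?m \<in> {1..Suc n}"
            using False poly_family_degree[OF J0(2)[OF j(1)], of x] by auto
          have "rem j ?m \<in> J"
            using m j(1) by (auto simp: J_def R_def)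
          moreover have "sgn (poly (rem j ?m y) z) = sgn (poly (p y) z)"
            if "degree (j y) = ?m" "poly (j y) z = 0" for y z
            by (rule rem(2)[OF j(1) m that])
          ultimately show ?thesis
            using deg[OF j(1)] by auto
        qed
        show ?thesis
          unfolding sign_embeds_def
        proof (intro allI impI)
          fix T :: "real set" assume T: "finite T"
          have "\<exists>\<theta>. strict_mono_on T \<theta> \<and> (\<forall>t\<in>T.
            (\<forall>j\<in>J0. sgn (poly (j x) t) = sgn (poly (j x') (\<theta> t))) \<and> sgn (poly (p x) t) = sgn (poly (p x') (\<theta> t)))"
            by (rule sign_embeds_extend[OF J emb, of p']) (use False key T in \<open>auto simp: J0_def p'_def\<close>)
          then show "\<exists>\<theta>. strict_mono_on T \<theta> \<and>
            (\<forall>t\<in>T. \<forall>j\<in>G \<union> insert p H. sgn (poly (j x) t) = sgn (poly (j x') (\<theta> t)))"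
            by (auto simp: J0_def)
        qed
      qed
    qed
    ultimately show ?case by (intro exI[of _ \<Psi>]) auto
  qed
  from this[of \<Phi> "{}"] show ?case using Suc.prems by simp
qed

lemma real_polynomial_function_as_poly_family:
  fixes p :: "'a::euclidean_space \<times> real \<Rightarrow> real"
  assumes "real_polynomial_function p"
  shows "\<exists>n c. poly_family n c \<and> (\<forall>x t. p (x, t) = poly (c x) t)"
  using assms
proof induction
  case (linear f)
  interpret bounded_linear f by fact
  define c where "c = (\<lambda>x. [:f (x, 0), f (0, 1):])"
  have "f (x, t) = poly (c x) t" for x t
  proof -
    have "f (x, t) = f ((x, 0) + t *\<^sub>R (0, 1))" by simp
    then show ?thesis unfolding add scale by (simp add: c_def)
  qed
  moreover have "poly_family 1 c"
    unfolding poly_family_def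
  proof (intro conjI allI)
    have "bounded_linear (\<lambda>x. f (x, 0))"
      by (intro bounded_linear_compose[OF bounded_linear_axioms] bounded_linear_Pair bounded_linear_ident bounded_linear_zero)
    then show "real_polynomial_function (\<lambda>x. coeff (c x) i)" for i
      by (cases i; cases "i - 1")
        (auto simp: c_def intro: real_polynomial_function.intros(1) real_polynomial_function.intros(2))
    show "degree (c x) \<le> 1" for x
      by (simp add: c_def)
  qed
  ultimately show ?case by blast
next
  case (const a)
  show ?case
    by (intro exI[of _ 0] exI[of _ "\<lambda>x. [:a:]"]) (auto simp: poly_family_def intro: real_polynomial_function.intros(2))
next
  case (add f g)
  then obtain n c m d where "poly_family n c" "poly_family m d"
    "\<And>x t. f (x, t) = poly (c x) t" "\<And>x t. g (x, t) = poly (d x) t" by blast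
  then show ?case
    using poly_family_add[of n c m d] by (intro exI[of _ "max n m"] exI[of _ "\<lambda>x. c x + d x"]) simp
next
  case (mult f g)
  then obtain n c m d where "poly_family n c" "poly_family m d"
    "\<And>x t. f (x, t) = poly (c x) t" "\<And>x t. g (x, t) = poly (d x) t" by blast
  then show ?case
    using poly_family_mult[of n c m d] by (intro exI[of _ "n + m"] exI[of _ "\<lambda>x. c x * d x"]) simp
qed

text \<open>
  Tarski-Seidenberg in the form of a back-and-forth property: if the signs in \<open>\<Psi>\<close> agree at \<open>x\<close>
  and \<open>x'\<close>, then any sign pattern of \<open>\<Phi>\<close> above \<open>x\<close> also occurs above \<open>x'\<close>.
\<close>

theorem signs_of_projection:
  fixes \<Phi> :: "('a::euclidean_space \<times> real \<Rightarrow> real) set"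
  assumes "finite \<Phi>" and "\<forall>p\<in>\<Phi>. real_polynomial_function p"
  shows "\<exists>\<Psi>. finite \<Psi> \<and> (\<forall>p\<in>\<Psi>. real_polynomial_function p) \<and>
    (\<forall>x x' t. same_signs \<Psi> x x' \<longrightarrow> (\<exists>t'. same_signs \<Phi> (x, t) (x', t')))"
proof -
  have "\<forall>p\<in>\<Phi>. \<exists>n c. poly_family n c \<and> (\<forall>x t. p (x, t) = poly (c x) t)"
    using real_polynomial_function_as_poly_family assms(2) by blast
  then obtain n c where c: "\<And>p. p \<in> \<Phi> \<Longrightarrow> poly_family (n p) (c p)"
    "\<And>p x t. p \<in> \<Phi> \<Longrightarrow> p (x, t) = poly (c p x) t"
    by metis
  define N where "N = (\<Sum>p\<in>\<Phi>. n p)"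
  have "\<forall>d\<in>c ` \<Phi>. poly_family N d"
    using c(1) assms(1) by (auto simp: N_def intro!: poly_family_mono[OF c(1)] member_le_sum)
  then obtain \<Psi> where \<Psi>: "finite \<Psi>" "\<forall>p\<in>\<Psi>. real_polynomial_function p"
    "\<And>x x'. same_signs \<Psi> x x' \<Longrightarrow> sign_embeds (c ` \<Phi>) (\<lambda>d. d x) (\<lambda>d. d x')"
    using signs_determine_sign_embeds[of "c ` \<Phi>" N] assms(1) by auto
  have "\<exists>t'. same_signs \<Phi> (x, t) (x', t')" if same: "same_signs \<Psi> x x'" for x x' t
  proof -
    have "\<exists>\<theta>. strict_mono_on {t} \<theta> \<and>
        (\<forall>s\<in>{t}. \<forall>d\<in>c ` \<Phi>. sgn (poly (d x) s) = sgn (poly (d x') (\<theta> s)))"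
      using \<Psi>(3)[OF same] unfolding sign_embeds_def by (meson finite.emptyI finite.insertI)
    then obtain \<theta> where "\<forall>d\<in>c ` \<Phi>. sgn (poly (d x) t) = sgn (poly (d x') (\<theta> t))"
      by blast
    then show ?thesis
      unfolding same_signs_def by (intro exI[of _ "\<theta> t"] ballI) (simp add: c(2))
  qed
  with \<Psi> show ?thesis by blast
qed

section \<open>Predicates and functions definable over the reals\<close>

text \<open>
  The semialgebraic predicates, described as unions of cells given by the signs of finitely many
  polynomials. In this form Boolean combinations and polynomial substitutions are immediate, and
  existential quantification is exactly \<open>signs_of_projection\<close>.
\<close>

definition definable :: "('a::euclidean_space \<Rightarrow> bool) \<Rightarrow> bool" where
  "definable \<phi> \<longleftrightarrow> (\<exists>\<Psi>. finite \<Psi> \<and> (\<forall>p\<in>\<Psi>. real_polynomial_function p) \<and>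
    (\<forall>x x'. same_signs \<Psi> x x' \<longrightarrow> \<phi> x \<longrightarrow> \<phi> x'))"

lemma definable_const: "definable (\<lambda>x. P)"
  unfolding definable_def by (intro exI[of _ "{}"]) auto

lemma definable_not: "definable \<phi> \<Longrightarrow> definable (\<lambda>x. \<not> \<phi> x)"
  unfolding definable_def by (meson same_signs_sym)

lemma definable_conj:
  assumes "definable \<phi>" "definable \<psi>"
  shows "definable (\<lambda>x. \<phi> x \<and> \<psi> x)"
proof -
  obtain \<Phi> \<Psi> where *: "finite \<Phi>" "\<forall>p\<in>\<Phi>. real_polynomial_function p"
      "\<And>x x'. same_signs \<Phi> x x' \<Longrightarrow> \<phi> x \<Longrightarrow> \<phi> x'"
    "finite \<Psi>" "\<forall>p\<in>\<Psi>. real_polynomial_function p"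
      "\<And>x x'. same_signs \<Psi> x x' \<Longrightarrow> \<psi> x \<Longrightarrow> \<psi> x'"
    using assms unfolding definable_def by metis
  have "\<forall>x x'. same_signs (\<Phi> \<union> \<Psi>) x x' \<longrightarrow> \<phi> x \<and> \<psi> x \<longrightarrow> \<phi> x' \<and> \<psi> x'"
    using *(3,6) by (meson same_signs_subset sup_ge1 sup_ge2)
  then show ?thesis
    unfolding definable_def using *(1,2,4,5) by (intro exI[of _ "\<Phi> \<union> \<Psi>"]) auto
qed

lemma definable_disj:
  assumes "definable \<phi>" "definable \<psi>"
  shows "definable (\<lambda>x. \<phi> x \<or> \<psi> x)"
proof -
  have "definable (\<lambda>x. \<not> (\<not> \<phi> x \<and> \<not> \<psi> x))"
    by (intro definable_not definable_conj assms)
  then show ?thesis by simp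
qed

lemma definable_imp:
  assumes "definable \<phi>" "definable \<psi>"
  shows "definable (\<lambda>x. \<phi> x \<longrightarrow> \<psi> x)"
proof -
  have "definable (\<lambda>x. \<not> \<phi> x \<or> \<psi> x)"
    by (intro definable_disj definable_not assms)
  then show ?thesis by (simp only: imp_conv_disj)
qed

lemma definable_finite_Ball:
  assumes "finite I" and "\<And>i. i \<in> I \<Longrightarrow> definable (\<phi> i)"
  shows "definable (\<lambda>x. \<forall>i\<in>I. \<phi> i x)"
  using assms
proof (induction I)
  case empty
  then show ?case by (simp add: definable_const)
next
  case (insert i I)
  then have "definable (\<lambda>x. \<phi> i x \<and> (\<forall>i\<in>I. \<phi> i x))"
    by (intro definable_conj) auto
  then show ?case by simp
qed

lemma definable_pos: "real_polynomial_function p \<Longrightarrow> definable (\<lambda>x. 0 < p x)"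
  unfolding definable_def
  by (intro exI[of _ "{p}"]) (auto simp: same_signs_def sgn_if split: if_splits)

lemma definable_vimage:
  assumes "definable \<phi>" "polynomial_function q"
  shows "definable (\<lambda>x. \<phi> (q x))"
proof -
  obtain \<Phi> where *: "finite \<Phi>" "\<forall>p\<in>\<Phi>. real_polynomial_function p"
      "\<And>x x'. same_signs \<Phi> x x' \<Longrightarrow> \<phi> x \<Longrightarrow> \<phi> x'"
    using assms unfolding definable_def by metis
  let ?\<Psi> = "(\<lambda>p. p \<circ> q) ` \<Phi>"
  have "same_signs \<Phi> (q x) (q x')" if "same_signs ?\<Psi> x x'" for x x'
    using that by (auto simp: same_signs_def)
  then have "\<forall>x x'. same_signs ?\<Psi> x x' \<longrightarrow> \<phi> (q x) \<longrightarrow> \<phi> (q x')"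
    using *(3) by meson
  moreover have "finite ?\<Psi>" "\<forall>p\<in>?\<Psi>. real_polynomial_function p"
    using *(1,2) assms(2) by (auto intro: real_polynomial_function_compose)
  ultimately show ?thesis
    unfolding definable_def by meson
qed

lemma definable_ex_real:
  fixes \<phi> :: "'a::euclidean_space \<Rightarrow> real \<Rightarrow> bool"
  assumes "definable (\<lambda>z. \<phi> (fst z) (snd z))"
  shows "definable (\<lambda>x. \<exists>t. \<phi> x t)"
proof -
  obtain \<Phi> where \<Phi>: "finite \<Phi>" "\<forall>p\<in>\<Phi>. real_polynomial_function p"
      "\<And>z z'. same_signs \<Phi> z z' \<Longrightarrow> \<phi> (fst z) (snd z) \<Longrightarrow> \<phi> (fst z') (snd z')"
    using assms unfolding definable_def by metis
  obtain \<Psi> where \<Psi>: "finite \<Psi>" "\<forall>p\<in>\<Psi>. real_polynomial_function p"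
    "\<And>x x' t. same_signs \<Psi> x x' \<Longrightarrow> \<exists>t'. same_signs \<Phi> (x, t) (x', t')"
    using signs_of_projection[OF \<Phi>(1,2)] by blast
  have "\<exists>t'. \<phi> x' t'" if same: "same_signs \<Psi> x x'" and t: "\<phi> x t" for x x' t
  proof -
    obtain t' where "same_signs \<Phi> (x, t) (x', t')"
      using \<Psi>(3)[OF same] by blast
    then show ?thesis using \<Phi>(3)[of "(x, t)" "(x', t')"] t by auto
  qed
  then show ?thesis
    unfolding definable_def using \<Psi>(1,2) by blast
qed

lemma polynomial_function_fst: "polynomial_function f \<Longrightarrow> polynomial_function (\<lambda>x. fst (f x))"
  and polynomial_function_snd: "polynomial_function f \<Longrightarrow> polynomial_function (\<lambda>x. snd (f x))"
  using polynomial_function_compose[of f fst] polynomial_function_compose[of f snd]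
  by (auto simp: o_def intro: polynomial_function_bounded_linear bounded_linear_fst bounded_linear_snd)

lemma polynomial_function_Pair:
  assumes "polynomial_function f" "polynomial_function g"
  shows "polynomial_function (\<lambda>x. (f x, g x))"
proof -
  have 1: "polynomial_function (\<lambda>x. (f x, 0))"
    using polynomial_function_compose[OF assms(1) polynomial_function_bounded_linear[of "\<lambda>u. (u, 0)"]]
    by (simp add: o_def bounded_linear_Pair bounded_linear_ident)
  have 2: "polynomial_function (\<lambda>x. (0, g x))"
    using polynomial_function_compose[OF assms(2) polynomial_function_bounded_linear[of "\<lambda>u. (0, u)"]]
    by (simp add: o_def bounded_linear_Pair bounded_linear_ident)
  show ?thesis
    using polynomial_function_add[OF 1 2] by simp
qed

lemma real_polynomial_function_inner:
  fixes f g :: "'a::euclidean_space \<Rightarrow> 'b::euclidean_space"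
  assumes "polynomial_function f" "polynomial_function g"
  shows "polynomial_function (\<lambda>x. f x \<bullet> g x)"
proof -
  have "polynomial_function (\<lambda>x. \<Sum>b\<in>Basis. (f x \<bullet> b) *\<^sub>R (g x \<bullet> b))"
    using assms by (intro polynomial_function_sum polynomial_function_mult polynomial_function_inner) auto
  then show ?thesis
    by (simp add: euclidean_inner[of "f _" "g _"])
qed

lemmas polynomial_function_intros =
  polynomial_function_fst polynomial_function_snd polynomial_function_Pair
  polynomial_function_id polynomial_function_const polynomial_function_add polynomial_function_diff
  polynomial_function_minus polynomial_function_mult real_polynomial_function_inner

text \<open>
  Quantification over a subspace, one basis vector at a time. This reduces quantifiers over a
  Euclidean space to quantifiers over the reals.
\<close>

lemma definable_translate_span:
  fixes \<phi> :: "'a::euclidean_space \<Rightarrow> bool"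
  assumes "definable \<phi>" "finite B"
  shows "definable (\<lambda>z. \<exists>s\<in>span B. \<phi> (z + s))"
  using assms(2)
proof (induction B)
  case empty
  then show ?case using assms(1) by simp
next
  case (insert b B)
  let ?\<psi> = "\<lambda>z. \<exists>s\<in>span B. \<phi> (z + s)"
  have "definable (\<lambda>z. ?\<psi> (fst z + snd z *\<^sub>R b))"
    by (intro definable_vimage[OF insert.IH] polynomial_function_intros)
  then have "definable (\<lambda>z. \<exists>t. ?\<psi> (z + t *\<^sub>R b))"
    by (rule definable_ex_real)
  moreover have "(\<exists>t. ?\<psi> (z + t *\<^sub>R b)) \<longleftrightarrow> (\<exists>s\<in>span (insert b B). \<phi> (z + s))" for z
  proof
    assume "\<exists>t. ?\<psi> (z + t *\<^sub>R b)"
    then obtain t s where "s \<in> span B" "\<phi> (z + (t *\<^sub>R b + s))"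
      by (auto simp: add.assoc)
    moreover from this have "t *\<^sub>R b + s \<in> span (insert b B)"
      using span_mono[of B "insert b B"] by (intro span_add span_scale span_base[of b]) auto
    ultimately show "\<exists>s\<in>span (insert b B). \<phi> (z + s)" by blast
  next
    assume "\<exists>s\<in>span (insert b B). \<phi> (z + s)"
    then obtain s k where "\<phi> (z + s)" "s - k *\<^sub>R b \<in> span B"
      by (auto simp: span_breakdown_eq)
    then show "\<exists>t. ?\<psi> (z + t *\<^sub>R b)"
      by (intro exI[of _ k] bexI[of _ "s - k *\<^sub>R b"]) (auto simp: algebra_simps)
  qed
  ultimately show ?case by simp
qed

lemma definable_ex:
  fixes \<phi> :: "'a::euclidean_space \<Rightarrow> 'b::euclidean_space \<Rightarrow> bool"
  assumes "definable (\<lambda>z. \<phi> (fst z) (snd z))"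
  shows "definable (\<lambda>x. \<exists>t. \<phi> x t)"
proof -
  let ?i = "\<lambda>t::'b. (0::'a, t)"
  have "linear ?i"
    by (intro bounded_linear.linear bounded_linear_Pair bounded_linear_ident bounded_linear_zero)
  then have span: "span (?i ` Basis) = range ?i"
    by (simp add: linear_span_image)
  have "definable (\<lambda>z. \<exists>s\<in>span (?i ` Basis). \<phi> (fst (z + s)) (snd (z + s)))"
    by (intro definable_translate_span assms) auto
  then have "definable (\<lambda>x. \<exists>s\<in>span (?i ` Basis). \<phi> (fst ((x, 0) + s)) (snd ((x, 0) + s)))"
    by (rule definable_vimage) (intro polynomial_function_intros)
  then show ?thesis
    unfolding span by simp
qed

lemma definable_all:
  fixes \<phi> :: "'a::euclidean_space \<Rightarrow> 'b::euclidean_space \<Rightarrow> bool"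
  assumes "definable (\<lambda>z. \<phi> (fst z) (snd z))"
  shows "definable (\<lambda>x. \<forall>t. \<phi> x t)"
  using definable_not[of "\<lambda>x. \<exists>t. \<not> \<phi> x t"] definable_ex[of "\<lambda>x t. \<not> \<phi> x t"] definable_not[OF assms]
  by simp

definition definable_fun :: "('a::euclidean_space \<Rightarrow> 'b::euclidean_space) \<Rightarrow> bool" where
  "definable_fun f \<longleftrightarrow> definable (\<lambda>z. snd z = f (fst z))"

lemma definable_eq_poly:
  fixes f g :: "'a::euclidean_space \<Rightarrow> 'b::euclidean_space"
  assumes "polynomial_function f" "polynomial_function g"
  shows "definable (\<lambda>x. f x = g x)"
proof -
  have "real_polynomial_function (\<lambda>x. (f x - g x) \<bullet> (f x - g x))"
    unfolding real_polynomial_function_eq by (intro polynomial_function_intros assms)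
  then have "definable (\<lambda>x. \<not> 0 < (f x - g x) \<bullet> (f x - g x))"
    by (intro definable_not definable_pos)
  then show ?thesis by (simp add: inner_gt_zero_iff)
qed

lemma definable_fun_polynomial: "polynomial_function f \<Longrightarrow> definable_fun f"
  using polynomial_function_compose[OF polynomial_function_fst[OF polynomial_function_id], of f]
  unfolding definable_fun_def o_def by (intro definable_eq_poly polynomial_function_intros)

lemma definable_fun_vimage:
  fixes f :: "'b::euclidean_space \<Rightarrow> 'c::euclidean_space" and q :: "'a::euclidean_space \<Rightarrow> 'b"
  assumes "definable_fun f" "polynomial_function q"
  shows "definable_fun (\<lambda>x. f (q x))"
proof -
  have "polynomial_function (\<lambda>z::'a \<times> 'c. q (fst z))"
    using polynomial_function_compose[OF polynomial_function_fst[OF polynomial_function_id] assms(2)]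
    by (simp add: o_def)
  then have "polynomial_function (\<lambda>z::'a \<times> 'c. (q (fst z), snd z))"
    by (intro polynomial_function_intros)
  from definable_vimage[OF assms(1)[unfolded definable_fun_def] this]
  show ?thesis by (simp add: definable_fun_def)
qed

text \<open>
  Substituting a definable function amounts to quantifying over its value.
\<close>

lemma definable_fun_subst:
  assumes "definable (\<lambda>z. \<phi> (fst z) (snd z))" "definable_fun f"
  shows "definable (\<lambda>x. \<phi> x (f x))"
proof -
  have "definable (\<lambda>x. \<exists>t. t = f x \<and> \<phi> x t)"
    using assms unfolding definable_fun_def by (intro definable_ex definable_conj)
  then show ?thesis by simp
qed

lemma definable_rel:
  fixes f :: "'a::euclidean_space \<Rightarrow> 'b::euclidean_space"
  assumes "definable R" "definable_fun f"
  shows "definable (\<lambda>x. R (f x))"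
  by (rule definable_fun_subst[OF _ assms(2)], rule definable_vimage[OF assms(1)])
    (intro polynomial_function_intros)

lemma definable_fun_Pair:
  assumes "definable_fun f" "definable_fun g"
  shows "definable_fun (\<lambda>x. (f x, g x))"
proof -
  have "definable (\<lambda>z. snd (fst z, fst (snd z)) = f (fst (fst z, fst (snd z))))"
    by (rule definable_vimage[OF assms(1)[unfolded definable_fun_def]]) (intro polynomial_function_intros)
  moreover have "definable (\<lambda>z. snd (fst z, snd (snd z)) = g (fst (fst z, snd (snd z))))"
    by (rule definable_vimage[OF assms(2)[unfolded definable_fun_def]]) (intro polynomial_function_intros)
  ultimately have "definable (\<lambda>z. fst (snd z) = f (fst z) \<and> snd (snd z) = g (fst z))"
    by (intro definable_conj) simp_all
  then show ?thesis
    unfolding definable_fun_def by (simp add: prod_eq_iff)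
qed

lemma definable_rel2:
  assumes "definable (\<lambda>z. \<phi> (fst z) (snd z))" "definable_fun a" "definable_fun b"
  shows "definable (\<lambda>x. \<phi> (a x) (b x))"
  using definable_rel[OF assms(1) definable_fun_Pair[OF assms(2,3)]] by simp

lemma definable_fun_comp:
  fixes f :: "'b::euclidean_space \<Rightarrow> 'c::euclidean_space" and g :: "'a::euclidean_space \<Rightarrow> 'b"
  assumes "definable_fun f" "definable_fun g"
  shows "definable_fun (\<lambda>x. f (g x))"
proof -
  have "definable_fun (\<lambda>z::'a \<times> 'c. (g (fst z), snd z))"
    by (intro definable_fun_Pair definable_fun_vimage[OF assms(2)] definable_fun_polynomial
        polynomial_function_intros)
  from definable_rel[OF assms(1)[unfolded definable_fun_def] this]
  show ?thesis by (simp add: definable_fun_def)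
qed

lemma definable_fun_id: "definable_fun (\<lambda>x. x)"
  by (intro definable_fun_polynomial polynomial_function_intros)

lemma definable_fun_const: "definable_fun (\<lambda>x. c)"
  by (intro definable_fun_polynomial polynomial_function_intros)

lemma definable_fun_fst: "definable_fun f \<Longrightarrow> definable_fun (\<lambda>x. fst (f x))"
  by (rule definable_fun_comp) (intro definable_fun_polynomial polynomial_function_intros)

lemma definable_fun_snd: "definable_fun f \<Longrightarrow> definable_fun (\<lambda>x. snd (f x))"
  by (rule definable_fun_comp) (intro definable_fun_polynomial polynomial_function_intros)

lemma definable_fun_binary:
  assumes "definable_fun f" "definable_fun g" "polynomial_function (\<lambda>z. q (fst z) (snd z))"
  shows "definable_fun (\<lambda>x. q (f x) (g x))"
  using definable_fun_comp[OF definable_fun_polynomial[OF assms(3)] definable_fun_Pair[OF assms(1,2)]]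
  by simp

lemma definable_fun_add: "definable_fun f \<Longrightarrow> definable_fun g \<Longrightarrow> definable_fun (\<lambda>x. f x + g x)"
  and definable_fun_diff: "definable_fun f \<Longrightarrow> definable_fun g \<Longrightarrow> definable_fun (\<lambda>x. f x - g x)"
  and definable_fun_inner: "definable_fun f \<Longrightarrow> definable_fun g \<Longrightarrow> definable_fun (\<lambda>x. f x \<bullet> g x)"
  by (rule definable_fun_binary; assumption?; intro polynomial_function_intros)+

lemma definable_fun_minus: "definable_fun f \<Longrightarrow> definable_fun (\<lambda>x. - f x)"
  using definable_fun_diff[OF definable_fun_const[of 0], of f] by simp

lemma definable_fun_scaleR: "definable_fun c \<Longrightarrow> definable_fun f \<Longrightarrow> definable_fun (\<lambda>x. c x *\<^sub>R f x)"
  by (rule definable_fun_binary; assumption?; intro polynomial_function_intros)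

lemma definable_fun_mult:
  fixes f g :: "'a::euclidean_space \<Rightarrow> real"
  shows "definable_fun f \<Longrightarrow> definable_fun g \<Longrightarrow> definable_fun (\<lambda>x. f x * g x)"
  using definable_fun_scaleR[of f g] by simp

lemma definable_eq:
  assumes "definable_fun f" "definable_fun g"
  shows "definable (\<lambda>x. f x = g x)"
proof -
  have "definable (\<lambda>z::'b \<times> 'b. fst z = snd z)"
    by (intro definable_eq_poly polynomial_function_intros)
  from definable_rel[OF this definable_fun_Pair[OF assms]] show ?thesis by simp
qed

lemma definable_less:
  fixes f g :: "'a::euclidean_space \<Rightarrow> real"
  assumes "definable_fun f" "definable_fun g"
  shows "definable (\<lambda>x. f x < g x)"
proof -
  have "real_polynomial_function (\<lambda>z::real \<times> real. snd z - fst z)"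
    unfolding real_polynomial_function_eq by (intro polynomial_function_intros)
  then have "definable (\<lambda>z::real \<times> real. 0 < snd z - fst z)"
    by (rule definable_pos)
  from definable_rel[OF this definable_fun_Pair[OF assms]] show ?thesis by simp
qed

lemma definable_le:
  fixes f g :: "'a::euclidean_space \<Rightarrow> real"
  shows "definable_fun f \<Longrightarrow> definable_fun g \<Longrightarrow> definable (\<lambda>x. f x \<le> g x)"
  using definable_not[OF definable_less[of g f]] by (simp add: not_less)

lemma definable_fun_norm:
  assumes "definable_fun f"
  shows "definable_fun (\<lambda>x. norm (f x))"
proof (rule definable_fun_comp[OF _ assms])
  have "definable (\<lambda>z::'b \<times> real. 0 \<le> snd z \<and> snd z * snd z = fst z \<bullet> fst z)"
    by (intro definable_conj definable_le definable_eq definable_fun_const definable_fun_mult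
        definable_fun_snd definable_fun_fst definable_fun_id definable_fun_inner)
  moreover have "(0 \<le> t \<and> t * t = u \<bullet> u) \<longleftrightarrow> t = norm u" for u :: 'b and t
    by (metis abs_of_nonneg norm_ge_zero power2_eq_iff_nonneg power2_eq_square power2_norm_eq_inner)
  ultimately show "definable_fun (norm :: 'b \<Rightarrow> real)"
    by (simp add: definable_fun_def)
qed

lemma definable_fun_abs:
  fixes f :: "'a::euclidean_space \<Rightarrow> real"
  shows "definable_fun f \<Longrightarrow> definable_fun (\<lambda>x. \<bar>f x\<bar>)"
  using definable_fun_norm[of f] by simp

lemmas definable_intros =
  definable_const definable_not definable_conj definable_disj definable_imp definable_all definable_ex
  definable_less definable_le definable_eq
  definable_fun_const definable_fun_id definable_fun_fst definable_fun_snd definable_fun_Pair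
  definable_fun_add definable_fun_diff definable_fun_minus definable_fun_inner definable_fun_mult
  definable_fun_scaleR definable_fun_norm definable_fun_abs

lemma semialgebraic_set_definable:
  assumes "semialgebraic_set S"
  shows "definable (\<lambda>x. x \<in> S)"
proof -
  have basic: "definable (\<lambda>x. x \<in> U)" if U: "basic_semialgebraic_set U" for U :: "'a set"
  proof -
    obtain P Q where *: "finite P \<and> finite Q \<and> (\<forall>p\<in>P. real_polynomial_function p) \<and>
      (\<forall>q\<in>Q. real_polynomial_function q) \<and> U = {x. (\<forall>p\<in>P. p x \<le> 0) \<and> (\<forall>q\<in>Q. q x < 0)}"
      using U unfolding basic_semialgebraic_set_def by (elim exE)
    then have PQ: "finite P" "finite Q" "\<And>p. p \<in> P \<Longrightarrow> real_polynomial_function p"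
      "\<And>q. q \<in> Q \<Longrightarrow> real_polynomial_function q" "U = {x. (\<forall>p\<in>P. p x \<le> 0) \<and> (\<forall>q\<in>Q. q x < 0)}"
      by simp_all
    have poly: "definable_fun p" if "real_polynomial_function p" for p :: "'a \<Rightarrow> real"
      using that by (intro definable_fun_polynomial) (simp add: real_polynomial_function_eq)
    have "definable (\<lambda>x. \<forall>p\<in>P. p x \<le> 0)"
      using PQ(1) by (rule definable_finite_Ball) (rule definable_le[OF poly[OF PQ(3)] definable_fun_const])
    moreover have "definable (\<lambda>x. \<forall>q\<in>Q. q x < 0)"
      using PQ(2) by (rule definable_finite_Ball) (rule definable_less[OF poly[OF PQ(4)] definable_fun_const])
    ultimately have "definable (\<lambda>x. (\<forall>p\<in>P. p x \<le> 0) \<and> (\<forall>q\<in>Q. q x < 0))"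
      by (rule definable_conj)
    then show ?thesis by (simp add: PQ(5))
  qed
  obtain \<U> where \<U>: "finite \<U>" "\<forall>U\<in>\<U>. basic_semialgebraic_set U" "S = \<Union>\<U>"
    using assms unfolding semialgebraic_set_def by blast
  have "definable (\<lambda>x. \<not> (\<forall>U\<in>\<U>. x \<notin> U))"
    using \<U> basic by (intro definable_not definable_finite_Ball) auto
  then show ?thesis by (simp add: \<U>(3))
qed

lemma semialgebraic_function_definable_fun:
  assumes "semialgebraic_function h"
  shows "definable_fun h"
proof -
  have "definable (\<lambda>z. z \<in> {(w, h w) | w. True})"
    using assms unfolding semialgebraic_function_def by (rule semialgebraic_set_definable)
  moreover have "(\<lambda>z. z \<in> {(w, h w) | w. True}) = (\<lambda>z. snd z = h (fst z))"
    by (auto simp: fun_eq_iff)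
  ultimately show ?thesis
    unfolding definable_fun_def by simp
qed

text \<open>
  Differentiability as a first-order formula with quantifiers over points and real numbers only,
  so that the closure properties of definable predicates apply to it.
\<close>

lemma GDERIV_iff:
  "GDERIV h w :> v \<longleftrightarrow>
    (\<forall>e. 0 < e \<longrightarrow> (\<exists>d. 0 < d \<and> (\<forall>u. norm (u - w) < d \<longrightarrow>
      \<bar>h u - h w - (u - w) \<bullet> v\<bar> \<le> e * norm (u - w))))"
  unfolding gderiv_def has_derivative_at_alt
  by (simp add: bounded_linear_inner_left real_norm_def)

lemma definable_GDERIV:
  fixes h :: "'b::euclidean_space \<Rightarrow> real" and a b :: "'a::euclidean_space \<Rightarrow> 'b"
  assumes h: "definable_fun h" and "definable_fun a" "definable_fun b"
  shows "definable (\<lambda>x. GDERIV h (a x) :> b x)"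
proof -
  have "definable (\<lambda>z. GDERIV h (fst z) :> snd z)"
    unfolding GDERIV_iff
    by (intro definable_intros definable_fun_comp[OF h])
  from definable_rel[OF this definable_fun_Pair[OF assms(2,3)]] show ?thesis by simp
qed

section \<open>Definable functions of one real variable\<close>

lemma real_polynomial_function_as_poly:
  fixes p :: "real \<Rightarrow> real"
  assumes "real_polynomial_function p"
  obtains c where "p = poly c"
proof -
  obtain a n where p: "p = (\<lambda>x. \<Sum>i\<le>n. a i * x ^ i)"
    using real_polynomial_function_imp_sum[OF assms] by blast
  show thesis
    by (rule that[of "\<Sum>i\<le>n. monom (a i) i"]) (simp add: p poly_sum poly_monom fun_eq_iff)
qed

lemma poly_eventually_constant_sign:
  fixes c :: "real poly"
  shows "\<exists>s. \<forall>\<^sub>F r in at_right a. sgn (poly c r) = s"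
proof (cases "c = 0")
  case False
  obtain d where d: "d > 0" "\<And>x. poly c x = 0 \<Longrightarrow> x \<noteq> a \<Longrightarrow> d \<le> dist a x"
    using finite_set_avoid[OF poly_roots_finite[OF False], of a] by blast
  have "sgn (poly c r) = sgn (poly c (a + d / 2))" if r: "r \<in> {a<..<a + d}" for r
  proof -
    have no_root: "poly c x \<noteq> 0" if "a < x" "x < a + d" for x
      using d(2)[of x] that by (auto simp: dist_real_def)
    show ?thesis
    proof (cases "r \<le> a + d / 2")
      case True
      then show ?thesis
        using no_root r d(1) by (intro poly_sgn_eq_without_roots) auto
    next
      case False
      then show ?thesis
        using no_root r d(1) by (intro poly_sgn_eq_without_roots[symmetric]) auto
    qed
  qed
  moreover have "a < a + d" using d(1) by simp
  ultimately have "\<forall>\<^sub>F r in at_right a. sgn (poly c r) = sgn (poly c (a + d / 2))"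
    by (rule eventually_at_rightI)
  then show ?thesis by blast
qed auto

text \<open>
  A nonzero polynomial in one variable has finitely many roots, hence a constant sign on an
  interval to the right of \<open>a\<close>. This is the source of all tameness of definable functions of one
  variable.
\<close>

lemma definable_dichotomy_at_right:
  fixes \<phi> :: "real \<Rightarrow> bool"
  assumes "definable \<phi>"
  shows "(\<forall>\<^sub>F r in at_right a. \<phi> r) \<or> (\<forall>\<^sub>F r in at_right a. \<not> \<phi> r)"
proof -
  obtain \<Psi> where \<Psi>: "finite \<Psi>" "\<forall>p\<in>\<Psi>. real_polynomial_function p"
      "\<And>x x'. same_signs \<Psi> x x' \<Longrightarrow> \<phi> x \<Longrightarrow> \<phi> x'"
    using assms unfolding definable_def by metis
  have "\<exists>s. \<forall>\<^sub>F r in at_right a. sgn (p r) = s" if p: "p \<in> \<Psi>" for p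
  proof -
    obtain c where "p = poly c"
      using p \<Psi>(2) real_polynomial_function_as_poly by blast
    then show ?thesis using poly_eventually_constant_sign[of c a] by simp
  qed
  then obtain s where "\<And>p. p \<in> \<Psi> \<Longrightarrow> \<forall>\<^sub>F r in at_right a. sgn (p r) = s p"
    by metis
  then have "\<forall>\<^sub>F r in at_right a. \<forall>p\<in>\<Psi>. sgn (p r) = s p"
    using \<Psi>(1) by (intro eventually_ball_finite) auto
  then obtain b where b: "b > a" "\<And>r. a < r \<Longrightarrow> r < b \<Longrightarrow> \<forall>p\<in>\<Psi>. sgn (p r) = s p"
    unfolding eventually_at_right_field by blast
  have same: "same_signs \<Psi> r r'" if "a < r" "r < b" "a < r'" "r' < b" for r r'
    using b(2)[OF that(1,2)] b(2)[OF that(3,4)] by (simp add: same_signs_def)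
  show ?thesis
  proof (cases "\<exists>r. a < r \<and> r < b \<and> \<phi> r")
    case True
    then obtain r0 where r0: "a < r0" "r0 < b" "\<phi> r0" by blast
    have "\<phi> r" if "a < r" "r < b" for r
      using \<Psi>(3)[OF same[OF r0(1,2) that] r0(3)] .
    then show ?thesis
      unfolding eventually_at_right_field using b(1) by blast
  next
    case False
    then show ?thesis
      unfolding eventually_at_right_field using b(1) by blast
  qed
qed

text \<open>
  The gaps to the right of the points are pairwise disjoint, and each contains a rational.
\<close>

lemma countable_if_right_isolated:
  fixes A :: "real set"
  assumes "\<And>r. r \<in> A \<Longrightarrow> \<forall>\<^sub>F s in at_right r. s \<notin> A"
  shows "countable A"
proof -
  have "\<exists>q\<in>\<rat>. r < q \<and> (\<forall>s. r < s \<longrightarrow> s \<le> q \<longrightarrow> s \<notin> A)" if r: "r \<in> A" for r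
  proof -
    obtain b where b: "b > r" "\<And>s. r < s \<Longrightarrow> s < b \<Longrightarrow> s \<notin> A"
      using assms[OF r] unfolding eventually_at_right_field by blast
    obtain q where "q \<in> \<rat>" "r < q" "q < b"
      using Rats_dense_in_real[OF b(1)] by blast
    then show ?thesis using b(2) by (meson le_less_trans)
  qed
  then obtain q where q: "\<And>r. r \<in> A \<Longrightarrow> q r \<in> \<rat>" "\<And>r. r \<in> A \<Longrightarrow> r < q r"
    "\<And>r s. r \<in> A \<Longrightarrow> r < s \<Longrightarrow> s \<le> q r \<Longrightarrow> s \<notin> A"
    by metis
  have "q ` A \<subseteq> \<rat>"
    using q(1) by blast
  then have "countable (q ` A)"
    using countable_rat countable_subset by blast
  moreover have "inj_on q A"
  proof (rule linorder_inj_onI)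
    fix r s assume "r < s" "r \<in> A" "s \<in> A"
    then have "q r < s" using q(3)[of r s] by force
    then show "q r \<noteq> q s" using q(2)[OF \<open>s \<in> A\<close>] by simp
  qed auto
  ultimately show ?thesis
    using countable_image_inj_on by blast
qed

text \<open>
  By the dichotomy, a discontinuity from the right at \<open>r\<close> means that some rational separates
  \<open>\<psi> r\<close> from all values just to the right of \<open>r\<close>. For a fixed rational, and a fixed side on which
  \<open>\<psi> r\<close> lies, such points are isolated from the right.
\<close>

lemma definable_fun_countable_right_discontinuities:
  fixes \<psi> :: "real \<Rightarrow> real"
  assumes \<psi>: "definable_fun \<psi>"
  shows "countable {r. \<not> (\<psi> \<longlongrightarrow> \<psi> r) (at_right r)}"
proof -
  define A where "A = (\<lambda>q. {r. \<psi> r < q \<and> (\<forall>\<^sub>F s in at_right r. q < \<psi> s)})"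
  define B where "B = (\<lambda>q. {r. q < \<psi> r \<and> (\<forall>\<^sub>F s in at_right r. \<psi> s < q)})"
  have "countable (A q)" "countable (B q)" for q
    by (intro countable_if_right_isolated; auto simp: A_def B_def elim!: eventually_mono)+
  then have "countable (\<Union>q\<in>\<rat>. A q \<union> B q)"
    using countable_rat by auto
  moreover have "{r. \<not> (\<psi> \<longlongrightarrow> \<psi> r) (at_right r)} \<subseteq> (\<Union>q\<in>\<rat>. A q \<union> B q)"
  proof
    fix r assume "r \<in> {r. \<not> (\<psi> \<longlongrightarrow> \<psi> r) (at_right r)}"
    then consider l where "l < \<psi> r" "\<not> (\<forall>\<^sub>F s in at_right r. l < \<psi> s)"
      | u where "\<psi> r < u" "\<not> (\<forall>\<^sub>F s in at_right r. \<psi> s < u)"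
      by (auto simp: order_tendsto_iff)
    then show "r \<in> (\<Union>q\<in>\<rat>. A q \<union> B q)"
    proof cases
      case 1
      obtain q where q: "q \<in> \<rat>" "l < q" "q < \<psi> r"
        using Rats_dense_in_real[OF 1(1)] by blast
      have "definable (\<lambda>s. l < \<psi> s)"
        by (intro definable_intros \<psi>)
      then have "\<forall>\<^sub>F s in at_right r. \<not> l < \<psi> s"
        using definable_dichotomy_at_right 1(2) by blast
      then have "\<forall>\<^sub>F s in at_right r. \<psi> s < q"
        by (rule eventually_mono) (use q in auto)
      then show ?thesis using q by (auto simp: B_def)
    next
      case 2
      obtain q where q: "q \<in> \<rat>" "\<psi> r < q" "q < u"
        using Rats_dense_in_real[OF 2(1)] by blast
      have "definable (\<lambda>s. \<psi> s < u)"
        by (intro definable_intros \<psi>)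
      then have "\<forall>\<^sub>F s in at_right r. \<not> \<psi> s < u"
        using definable_dichotomy_at_right 2(2) by blast
      then have "\<forall>\<^sub>F s in at_right r. q < \<psi> s"
        by (rule eventually_mono) (use q in auto)
      then show ?thesis using q by (auto simp: A_def)
    qed
  qed
  ultimately show ?thesis using countable_subset by blast
qed

text \<open>
  Continuity is a definable condition, so it holds or fails throughout some interval
  \<open>(a, b)\<close>; it cannot fail at uncountably many points.
\<close>

lemma definable_fun_eventually_isCont:
  fixes \<psi> :: "real \<Rightarrow> real"
  assumes \<psi>: "definable_fun \<psi>"
  shows "\<forall>\<^sub>F r in at_right a. isCont \<psi> r"
proof -
  have "definable_fun (\<lambda>r. \<psi> (-r))"
    by (intro definable_fun_comp[OF \<psi>] definable_intros)
  then have "countable {r. \<not> ((\<lambda>r. \<psi> (-r)) \<longlongrightarrow> \<psi> (-r)) (at_right r)}"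
    by (rule definable_fun_countable_right_discontinuities)
  then have "countable (uminus ` {r. \<not> ((\<lambda>r. \<psi> (-r)) \<longlongrightarrow> \<psi> (-r)) (at_right r)})"
    by (rule countable_image)
  moreover have "uminus ` {r. \<not> ((\<lambda>r. \<psi> (-r)) \<longlongrightarrow> \<psi> (-r)) (at_right r)} = {r. \<not> (\<psi> \<longlongrightarrow> \<psi> r) (at_left r)}"
  proof -
    have "((\<lambda>r. \<psi> (-r)) \<longlongrightarrow> \<psi> (-r)) (at_right r) \<longleftrightarrow> (\<psi> \<longlongrightarrow> \<psi> (-r)) (at_left (-r))" for r
      by (simp add: at_left_minus[of "-r"] filterlim_filtermap)
    then show ?thesis
      by (auto simp: image_iff) (metis minus_minus)
  qed
  ultimately have "countable ({r. \<not> (\<psi> \<longlongrightarrow> \<psi> r) (at_left r)} \<union> {r. \<not> (\<psi> \<longlongrightarrow> \<psi> r) (at_right r)})"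
    using definable_fun_countable_right_discontinuities[OF \<psi>] by simp
  moreover have "{r. \<not> isCont \<psi> r} \<subseteq> {r. \<not> (\<psi> \<longlongrightarrow> \<psi> r) (at_left r)} \<union> {r. \<not> (\<psi> \<longlongrightarrow> \<psi> r) (at_right r)}"
    unfolding isCont_def filterlim_at_split by auto
  ultimately have countable: "countable {r. \<not> isCont \<psi> r}"
    using countable_subset by blast
  have "definable (\<lambda>r. \<forall>e. 0 < e \<longrightarrow> (\<exists>d. 0 < d \<and> (\<forall>s. norm (s - r) < d \<longrightarrow> \<bar>\<psi> s - \<psi> r\<bar> < e)))"
    by (intro definable_intros definable_fun_comp[OF \<psi>])
  then have "definable (isCont \<psi>)"
    unfolding continuous_at_real_range[of _ \<psi>, abs_def] by simp
  then consider "\<forall>\<^sub>F r in at_right a. isCont \<psi> r" | "\<forall>\<^sub>F r in at_right a. \<not> isCont \<psi> r"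
    using definable_dichotomy_at_right by blast
  then show ?thesis
  proof cases
    case 2
    then obtain b where "b > a" "{a<..<b} \<subseteq> {r. \<not> isCont \<psi> r}"
      unfolding eventually_at_right_field by (metis (mono_tags, lifting) greaterThanLessThan_iff mem_Collect_eq subsetI)
    then show ?thesis
      using countable countable_subset uncountable_open_interval by blast
  qed
qed

section \<open>Algebraicity and generic differentiability\<close>

text \<open>
  On each line through \<open>u\<close> the polynomial vanishes near \<open>u\<close>, hence identically.
\<close>

lemma real_polynomial_function_eq_0:
  fixes p :: "'a::euclidean_space \<Rightarrow> real"
  assumes p: "real_polynomial_function p" and U: "open U" "u \<in> U" "\<And>x. x \<in> U \<Longrightarrow> p x = 0"
  shows "p x = 0"
proof -
  have "real_polynomial_function (p \<circ> (\<lambda>t. u + t *\<^sub>R (x - u)))"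
    by (intro real_polynomial_function_compose p polynomial_function_intros)
  then obtain c where c: "p \<circ> (\<lambda>t. u + t *\<^sub>R (x - u)) = poly c"
    using real_polynomial_function_as_poly by blast
  have "open ((\<lambda>t. u + t *\<^sub>R (x - u)) -` U)"
    by (intro open_vimage U continuous_intros)
  then obtain e where e: "e > 0" "ball 0 e \<subseteq> (\<lambda>t::real. u + t *\<^sub>R (x - u)) -` U"
    using U(2) by (metis (no_types, lifting) add.right_neutral open_contains_ball scaleR_zero_left vimageI)
  have "poly c t = 0" if "t \<in> ball 0 e" for t
    using fun_cong[OF c, of t] U(3) e(2) that by auto
  moreover have "infinite (ball (0::real) e)"
    using e(1) by (simp add: ball_eq_greaterThanLessThan infinite_Ioo)
  ultimately have "infinite {t. poly c t = 0}"
    using infinite_super[of "ball 0 e" "{t. poly c t = 0}"] by blast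
  then have "c = 0"
    using poly_roots_finite by blast
  then show ?thesis
    using fun_cong[OF c, of 1] by simp
qed

lemma real_polynomial_function_prod_nonzero:
  fixes \<Phi> :: "('a::euclidean_space \<Rightarrow> real) set"
  assumes "finite \<Phi>" "\<And>p. p \<in> \<Phi> \<Longrightarrow> real_polynomial_function p \<and> (\<exists>x. p x \<noteq> 0)"
  shows "\<exists>x. (\<Prod>p\<in>\<Phi>. p x) \<noteq> 0"
  using assms
proof (induction \<Phi>)
  case (insert p \<Phi>)
  then obtain y where y: "(\<Prod>p\<in>\<Phi>. p y) \<noteq> 0" by auto
  have P: "real_polynomial_function (\<lambda>x. \<Prod>p\<in>\<Phi>. p x)"
    using insert by (intro real_polynomial_function_prod) auto
  show ?case
  proof (rule ccontr)
    assume "\<not> ?thesis"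
    then have "p x = 0 \<or> (\<Prod>p\<in>\<Phi>. p x) = 0" for x
      using insert.hyps by auto
    then have zero: "p x = 0" if "x \<in> {x. (\<Prod>p\<in>\<Phi>. p x) \<noteq> 0}" for x
      using that by blast
    have "continuous_on UNIV (\<lambda>x. \<Prod>p\<in>\<Phi>. p x)"
      using P by (metis continuous_at_imp_continuous_on continuous_polymonial_function real_polynomial_function_eq)
    then have "open {x. (\<Prod>p\<in>\<Phi>. p x) \<noteq> 0}"
      by (rule open_Collect_neq) (rule continuous_on_const)
    then have "p x = 0" for x
      using real_polynomial_function_eq_0[of p _ y] insert.prems y zero by blast
    then show False using insert.prems by blast
  qed
qed auto

text \<open>
  If every polynomial describing the graph were nonzero at \<open>(w, h w)\<close> or identically zero, then
  all signs would persist at \<open>(w, t)\<close> for \<open>t\<close> close to \<open>h w\<close>, and the graph would contain a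
  second point above \<open>w\<close>. Hence the product of the polynomials that are not identically zero
  vanishes on the graph.
\<close>

lemma definable_fun_algebraic:
  fixes h :: "'a::euclidean_space \<Rightarrow> real"
  assumes h: "definable_fun h"
  obtains q where "real_polynomial_function q" "\<exists>z. q z \<noteq> 0" "\<And>w. q (w, h w) = 0"
proof -
  obtain \<Psi> where \<Psi>: "finite \<Psi>" "\<forall>p\<in>\<Psi>. real_polynomial_function p"
      "\<And>z z'. same_signs \<Psi> z z' \<Longrightarrow> snd z = h (fst z) \<Longrightarrow> snd z' = h (fst z')"
    using h unfolding definable_fun_def definable_def by metis
  let ?\<Phi> = "{p\<in>\<Psi>. \<exists>z. p z \<noteq> 0}"
  have vanish: "\<exists>p\<in>?\<Phi>. p (w, h w) = 0" for w
  proof (rule ccontr)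
    assume none: "\<not> ?thesis"
    have "\<forall>\<^sub>F t in at (h w). sgn (p (w, t)) = sgn (p (w, h w))" if p: "p \<in> \<Psi>" for p
    proof (cases "p (w, h w) = 0")
      case True
      then show ?thesis using none p by auto
    next
      case False
      have "real_polynomial_function (p \<circ> (\<lambda>t. (w, t)))"
        using \<Psi>(2) p by (intro real_polynomial_function_compose polynomial_function_intros) auto
      then have "isCont (\<lambda>t. p (w, t)) (h w)"
        using continuous_polymonial_function by (simp add: real_polynomial_function_eq o_def)
      then have lim: "((\<lambda>t. p (w, t)) \<longlongrightarrow> p (w, h w)) (at (h w))"
        by (simp add: isCont_def)
      show ?thesis
      proof (cases "p (w, h w) > 0")
        case True
        show ?thesis
          using order_tendstoD(1)[OF lim True] by (rule eventually_mono) (use True in simp)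
      next
        case notpos: False
        then have neg: "p (w, h w) < 0" using False by simp
        show ?thesis
          using order_tendstoD(2)[OF lim neg] by (rule eventually_mono) (use neg in simp)
      qed
    qed
    then have "\<forall>\<^sub>F t in at (h w). \<forall>p\<in>\<Psi>. sgn (p (w, t)) = sgn (p (w, h w))"
      using \<Psi>(1) by (intro eventually_ball_finite) auto
    moreover have "\<forall>\<^sub>F t in at (h w). t \<noteq> h w"
      by (simp add: eventually_at_filter)
    ultimately have "\<forall>\<^sub>F t in at (h w). t \<noteq> h w \<and> (\<forall>p\<in>\<Psi>. sgn (p (w, t)) = sgn (p (w, h w)))"
      by (intro eventually_conj) auto
    then obtain t where t: "t \<noteq> h w" "\<forall>p\<in>\<Psi>. sgn (p (w, t)) = sgn (p (w, h w))"
      using eventually_happens' at_neq_bot by blast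
    then have "same_signs \<Psi> (w, h w) (w, t)"
      by (simp add: same_signs_def)
    then show False
      using \<Psi>(3)[of "(w, h w)" "(w, t)"] t(1) by simp
  qed
  show thesis
  proof (rule that[of "\<lambda>z. \<Prod>p\<in>?\<Phi>. p z"])
    show "real_polynomial_function (\<lambda>z. \<Prod>p\<in>?\<Phi>. p z)"
      using \<Psi>(1,2) by (intro real_polynomial_function_prod) auto
    show "\<exists>z. (\<Prod>p\<in>?\<Phi>. p z) \<noteq> 0"
      using \<Psi>(1,2) by (intro real_polynomial_function_prod_nonzero) auto
    show "(\<Prod>p\<in>?\<Phi>. p (w, h w)) = 0" for w
      using vanish[of w] \<Psi>(1) by (intro prod_zero) auto
  qed
qed

text \<open>
  The existence and continuity of the implicit function \<open>h\<close> are given, so that differentiability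
  of \<open>G\<close> at the single point suffices.
\<close>

lemma implicit_differentiable:
  fixes G :: "'a::euclidean_space \<times> real \<Rightarrow> real" and h :: "'a \<Rightarrow> real"
  assumes G: "(G has_derivative D) (at (w0, h w0))" and \<beta>: "D (0, 1) \<noteq> 0"
    and h: "isCont h w0" and V: "open V" "w0 \<in> V" "\<And>w. w \<in> V \<Longrightarrow> G (w, h w) = 0"
  shows "h differentiable (at w0)"
proof -
  define \<beta> where "\<beta> = D (0, 1)"
  define A where "A = (\<lambda>u. D (u, 0))"
  interpret D: bounded_linear D
    using G by (rule has_derivative_bounded_linear)
  have D_eq: "D (u, s) = A u + \<beta> * s" for u s
  proof -
    have "D (u, s) = D ((u, 0) + s *\<^sub>R (0, 1))" by simp
    then show ?thesis unfolding D.add D.scaleR by (simp add: A_def \<beta>_def)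
  qed
  have A: "bounded_linear A"
    unfolding A_def
    by (intro bounded_linear_compose[OF D.bounded_linear_axioms] bounded_linear_Pair
        bounded_linear_ident bounded_linear_zero)
  then obtain B where B: "B > 0" "\<And>u. \<bar>A u\<bar> \<le> norm u * B"
    using bounded_linear.pos_bounded by (metis real_norm_def)
  have b: "\<bar>\<beta>\<bar> > 0" using assms(2) by (simp add: \<beta>_def)
  define K where "K = 1 + 2 * B / \<bar>\<beta>\<bar>"
  have K: "K > 0" using B(1) b by (simp add: K_def add_pos_pos)
  have "(h has_derivative (\<lambda>u. - A u / \<beta>)) (at w0)"
    unfolding has_derivative_at_alt
  proof (intro conjI allI impI)
    show "bounded_linear (\<lambda>u. - A u / \<beta>)"
      using bounded_linear_compose[OF bounded_linear_divide[of \<beta>] bounded_linear_minus[OF A]] by simp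
    fix e :: real assume e: "e > 0"
    \<comment> \<open>The first bound allows \<open>\<bar>s\<bar>\<close> to be absorbed, which gives \<open>\<bar>s\<bar> \<le> K * norm u\<close>; the second then
      makes the error at most \<open>e * norm u\<close>.\<close>
    define e' where "e' = min (\<bar>\<beta>\<bar> / 2) (e * \<bar>\<beta>\<bar> / (1 + K))"
    have e': "e' > 0" "e' \<le> \<bar>\<beta>\<bar> / 2" "e' \<le> e * \<bar>\<beta>\<bar> / (1 + K)"
      using e b K unfolding e'_def by (simp_all only: min.cobounded1 min.cobounded2) simp
    obtain d where d: "d > 0" "\<And>z. norm (z - (w0, h w0)) < d \<Longrightarrow>
        norm (G z - G (w0, h w0) - D (z - (w0, h w0))) \<le> e' * norm (z - (w0, h w0))"
      using G e'(1) unfolding has_derivative_at_alt by blast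
    obtain d1 where d1: "d1 > 0" "\<And>w. norm (w - w0) < d1 \<Longrightarrow> \<bar>h w - h w0\<bar> < d / 2"
      using h d(1) unfolding continuous_at_real_range by (metis half_gt_zero)
    obtain d2 where d2: "d2 > 0" "ball w0 d2 \<subseteq> V"
      using V(1,2) open_contains_ball by blast
    define d3 where "d3 = min (min d1 d2) (d / 2)"
    show "\<exists>d>0. \<forall>w. norm (w - w0) < d \<longrightarrow>
      norm (h w - h w0 - (- A (w - w0) / \<beta>)) \<le> e * norm (w - w0)"
    proof (intro exI[of _ d3] conjI allI impI)
      show "d3 > 0" using d(1) d1(1) d2(1) by (simp add: d3_def)
      fix w assume w: "norm (w - w0) < d3"
      define u where "u = w - w0"
      define s where "s = h w - h w0"
      have "w \<in> V"
        using w d2(2) by (auto simp: d3_def dist_norm norm_minus_commute)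
      then have Gz: "G (w, h w) = 0" "G (w0, h w0) = 0"
        using V by auto
      have n: "norm (u, s) \<le> norm u + \<bar>s\<bar>"
        using norm_Pair_le[of u s] by simp
      also have "\<dots> < d"
        using w d1(2)[of w] by (simp add: d3_def u_def s_def)
      finally have "norm ((w, h w) - (w0, h w0)) < d"
        by (simp add: u_def s_def)
      from d(2)[OF this] have "\<bar>A u + \<beta> * s\<bar> \<le> e' * norm (u, s)"
        by (simp add: Gz D_eq u_def s_def)
      also have "\<dots> \<le> e' * (norm u + \<bar>s\<bar>)"
        using n e'(1) by (intro mult_left_mono) auto
      finally have main: "\<bar>A u + \<beta> * s\<bar> \<le> e' * (norm u + \<bar>s\<bar>)" .
      have "\<bar>\<beta>\<bar> * \<bar>s\<bar> \<le> \<bar>A u + \<beta> * s\<bar> + \<bar>A u\<bar>"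
        by (simp flip: abs_mult)
      also have "\<dots> \<le> \<bar>\<beta>\<bar> / 2 * (norm u + \<bar>s\<bar>) + norm u * B"
        using order_trans[OF main mult_right_mono[OF e'(2)]] B(2)[of u] by (intro add_mono) auto
      finally have "\<bar>\<beta>\<bar> * \<bar>s\<bar> \<le> \<bar>\<beta>\<bar> * norm u + 2 * B * norm u"
        by (simp add: field_simps)
      also have "\<dots> = \<bar>\<beta>\<bar> * (K * norm u)"
        using b by (simp add: K_def field_simps)
      finally have "\<bar>\<beta>\<bar> * \<bar>s\<bar> \<le> \<bar>\<beta>\<bar> * (K * norm u)" .
      then have s: "\<bar>s\<bar> \<le> K * norm u"
        using b by simp
      have "\<bar>\<beta>\<bar> * \<bar>s + A u / \<beta>\<bar> = \<bar>A u + \<beta> * s\<bar>"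
        using b by (simp add: field_simps flip: abs_mult)
      also have "\<dots> \<le> e' * (norm u + K * norm u)"
        using main s e'(1) by (smt (verit) mult_left_mono)
      also have "\<dots> = e' * ((1 + K) * norm u)"
        by (simp add: algebra_simps)
      also have "\<dots> \<le> (e * \<bar>\<beta>\<bar> / (1 + K)) * ((1 + K) * norm u)"
        using e'(3) K by (intro mult_right_mono) auto
      also have "\<dots> = \<bar>\<beta>\<bar> * (e * norm u)"
        using K by simp
      finally have "\<bar>s + A u / \<beta>\<bar> \<le> e * norm u"
        using b by simp
      then show "norm (h w - h w0 - (- A (w - w0) / \<beta>)) \<le> e * norm (w - w0)"
        by (simp add: u_def s_def)
    qed
  qed
  then show ?thesis by (rule differentiableI)
qed

lemma poly_family_real_polynomial_function:
  assumes c: "poly_family n c"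
  shows "real_polynomial_function (\<lambda>z. poly (c (fst z)) (snd z))"
proof -
  have "poly (c x) t = (\<Sum>i\<le>n. coeff (c x) i * t ^ i)" for x t
    using poly_family_degree[OF c, of x]
    unfolding poly_altdef by (intro sum.mono_neutral_left) (auto simp: coeff_eq_0)
  moreover have "real_polynomial_function (\<lambda>z::'a \<times> real. \<Sum>i\<le>n. coeff (c (fst z)) i * snd z ^ i)"
  proof (intro real_polynomial_function_sum real_polynomial_function.intros(4) real_polynomial_function_power)
    fix i
    show "real_polynomial_function (\<lambda>z::'a \<times> real. coeff (c (fst z)) i)"
      using real_polynomial_function_compose[OF polynomial_function_fst[OF polynomial_function_id]
          poly_family_coeff[OF c, of i]] by (simp add: o_def)
    show "real_polynomial_function (snd :: 'a \<times> real \<Rightarrow> real)"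
      by (intro real_polynomial_function.intros(1) bounded_linear_snd)
  qed auto
  ultimately show ?thesis by simp
qed

text \<open>
  Among all polynomial equations satisfied by the graph over some open subset of \<open>U\<close>, one of
  minimal degree in the last variable is used. The degree is positive, as a polynomial in
  \<open>w\<close> alone would vanish on an open set. The derivative in the last variable has smaller degree, so
  it cannot vanish along the graph over an open set, and the implicit function argument applies at a point where
  it does not.
\<close>

lemma definable_fun_dense_differentiable:
  fixes h :: "'a::euclidean_space \<Rightarrow> real"
  assumes h: "definable_fun h" and cont: "continuous_on U h" and U: "open U" "U \<noteq> {}"
  shows "\<exists>w\<in>U. h differentiable (at w)"
proof -
  define P where "P = (\<lambda>n. \<exists>c V. poly_family n c \<and> (\<exists>x. c x \<noteq> 0) \<and> open V \<and> V \<noteq> {} \<and> V \<subseteq> U \<and>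
    (\<forall>w\<in>V. poly (c w) (h w) = 0))"
  obtain q where q: "real_polynomial_function q" "\<exists>z. q z \<noteq> 0" "\<And>w. q (w, h w) = 0"
    using definable_fun_algebraic[OF h] by blast
  obtain n0 c0 where c0: "poly_family n0 c0" "\<And>x t. q (x, t) = poly (c0 x) t"
    using real_polynomial_function_as_poly_family[OF q(1)] by blast
  have "\<exists>x. c0 x \<noteq> 0"
  proof -
    obtain x t where "q (x, t) \<noteq> 0" using q(2) by (metis surj_pair)
    then have "c0 x \<noteq> 0" using c0(2)[of x t] by auto
    then show ?thesis by blast
  qed
  moreover have "\<forall>w\<in>U. poly (c0 w) (h w) = 0"
    using q(3) c0(2) by simp
  ultimately have "P n0"
    unfolding P_def using U c0(1) by blast
  define n where "n = (LEAST n. P n)"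
  have n: "P n" "\<And>m. P m \<Longrightarrow> n \<le> m"
    using \<open>P n0\<close> unfolding n_def by (auto intro: LeastI Least_le)
  obtain c V where c: "poly_family n c" "\<exists>x. c x \<noteq> 0" and V: "open V" "V \<noteq> {}" "V \<subseteq> U"
    and vanish: "\<And>w. w \<in> V \<Longrightarrow> poly (c w) (h w) = 0"
    using n(1) unfolding P_def by blast
  have "\<exists>w\<in>V. poly (pderiv (c w)) (h w) \<noteq> 0"
  proof (rule ccontr)
    assume *: "\<not> ?thesis"
    have "n = 0"
    proof (rule ccontr)
      assume "n \<noteq> 0"
      have "pderiv (c x) = 0" for x
      proof (rule ccontr)
        assume "pderiv (c x) \<noteq> 0"
        then have "P (n - 1)"
          unfolding P_def using poly_family_pderiv[OF c(1)] V * by (intro exI[of _ "\<lambda>x. pderiv (c x)"] exI[of _ V]) auto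
        then show False using n(2)[of "n - 1"] \<open>n \<noteq> 0\<close> by simp
      qed
      then have "poly_family 0 c"
        using poly_family_coeff[OF c(1)] unfolding poly_family_def by (simp add: pderiv_eq_0_iff)
      then have "P 0"
        unfolding P_def using c(2) V vanish by blast
      then show False using n(2)[of 0] \<open>n \<noteq> 0\<close> by simp
    qed
    then have deg: "degree (c x) = 0" for x
      using poly_family_degree[OF c(1), of x] by simp
    obtain v where "v \<in> V" using V(2) by blast
    then have "coeff (c x) 0 = 0" for x
      using real_polynomial_function_eq_0[OF poly_family_coeff[OF c(1)] V(1) \<open>v \<in> V\<close>, of 0 x]
        vanish poly_const_eval[OF deg] by metis
    then have "c x = 0" for x
      using deg[of x] by (metis leading_coeff_0_iff)
    then show False using c(2) by blast
  qed
  then obtain w where w: "w \<in> V" "poly (pderiv (c w)) (h w) \<noteq> 0" by blast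
  define G where "G = (\<lambda>z. poly (c (fst z)) (snd z))"
  have "G differentiable (at (w, h w))"
    unfolding G_def using differentiable_at_real_polynomial_function[OF poly_family_real_polynomial_function[OF c(1)]] .
  then obtain D where D: "(G has_derivative D) (at (w, h w))"
    unfolding differentiable_def by blast
  have "((\<lambda>t. (w, t)) has_derivative (\<lambda>t. (0, t))) (at (h w))"
    by (intro has_derivative_Pair has_derivative_const has_derivative_ident)
  then have "((\<lambda>t. G (w, t)) has_derivative (\<lambda>t. D (0, t))) (at (h w))"
    by (rule has_derivative_compose) (rule D)
  moreover have "((\<lambda>t. G (w, t)) has_derivative (\<lambda>t. poly (pderiv (c w)) (h w) * t)) (at (h w))"
    using poly_DERIV[of "c w" "h w"] by (simp add: G_def has_field_derivative_def)
  ultimately have "D (0, 1) = poly (pderiv (c w)) (h w)"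
    using has_derivative_unique by (metis mult.right_neutral)
  moreover have "isCont h w"
    using cont V w(1) U(1) continuous_on_eq_continuous_at by blast
  ultimately have "h differentiable (at w)"
    using implicit_differentiable[where h = h, OF D _ _ V(1) w(1)] vanish w(2) by (simp add: G_def)
  then show ?thesis using w(1) V(3) by blast
qed

section \<open>Definable choice\<close>

text \<open>
  The chosen point is the infimum of the fibre if this belongs to the fibre. If not, the fibre
  contains an interval starting at the infimum, and the chosen point is the midpoint of the longest
  such interval of length at most \<open>1\<close>. Both descriptions are first-order.
\<close>

lemma definable_choice_real:
  fixes \<phi> :: "'a::euclidean_space \<Rightarrow> real \<Rightarrow> bool"
  assumes \<phi>: "definable (\<lambda>z. \<phi> (fst z) (snd z))" and bdd: "\<And>x. bdd_below {t. \<phi> x t}"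
  shows "\<exists>f. definable_fun f \<and> (\<forall>x t. \<phi> x t \<longrightarrow> \<phi> x (f x))"
proof -
  define is_inf where "is_inf = (\<lambda>x i. (\<forall>s. \<phi> x s \<longrightarrow> i \<le> s) \<and> (\<forall>j. i < j \<longrightarrow> (\<exists>s. \<phi> x s \<and> s < j)))"
  define gap where "gap = (\<lambda>x i \<delta>. 0 < \<delta> \<and> \<delta> \<le> 1 \<and> (\<forall>s. i < s \<and> s < i + \<delta> \<longrightarrow> \<phi> x s))"
  define mid where "mid = (\<lambda>x t i \<delta>. is_inf x i \<and> \<not> \<phi> x i \<and> gap x i \<delta> \<and>
    (\<forall>\<delta>'. gap x i \<delta>' \<longrightarrow> \<delta>' \<le> \<delta>) \<and> t = i + (1/2) * \<delta>)"
  \<comment> \<open>\<open>CH x t\<close> describes the chosen point \<open>t\<close> of the fibre over \<open>x\<close>.\<close>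
  define CH where "CH = (\<lambda>x t. (\<phi> x t \<and> is_inf x t) \<or> (\<exists>i \<delta>. mid x t i \<delta>))"
  have inf_unique: "i = j" if "is_inf x i" "is_inf x j" for x i j
    using that unfolding is_inf_def by (metis leD linorder_neqE_linordered_idom)
  have CH_unique: "t = t'" if "CH x t" "CH x t'" for x t t'
    using that inf_unique unfolding CH_def mid_def by (metis order_antisym)
  have CH_\<phi>: "\<phi> x t" if "CH x t" for x t
    using that unfolding CH_def mid_def gap_def by auto
  have CH_ex: "\<exists>t. CH x t" if t0: "\<phi> x t0" for x t0
  proof -
    define i where "i = Inf {t. \<phi> x t}"
    have i: "is_inf x i"
      unfolding is_inf_def
    proof (intro conjI allI impI)
      show "i \<le> s" if "\<phi> x s" for s
        using that bdd[of x] unfolding i_def by (intro cInf_lower) auto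
      show "\<exists>s. \<phi> x s \<and> s < j" if "i < j" for j
        using cInf_lessD[of "{t. \<phi> x t}" j] t0 that unfolding i_def by auto
    qed
    show ?thesis
    proof (cases "\<phi> x i")
      case True
      then show ?thesis using i unfolding CH_def by blast
    next
      case False
      have "definable (\<phi> x)"
        by (intro definable_rel2[OF \<phi>] definable_intros)
      then consider "\<forall>\<^sub>F s in at_right i. \<phi> x s" | "\<forall>\<^sub>F s in at_right i. \<not> \<phi> x s"
        using definable_dichotomy_at_right by blast
      then obtain b where b: "b > i" "\<And>s. i < s \<Longrightarrow> s < b \<Longrightarrow> \<phi> x s"
      proof cases
        case 1
        then show ?thesis using that unfolding eventually_at_right_field by blast
      next
        case 2
        then obtain b where "b > i" "\<And>s. i < s \<Longrightarrow> s < b \<Longrightarrow> \<not> \<phi> x s"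
          unfolding eventually_at_right_field by blast
        moreover from this obtain s where "\<phi> x s" "s < b"
          using i unfolding is_inf_def by blast
        moreover from this have "i < s"
          using i False unfolding is_inf_def by (metis order_le_less)
        ultimately show ?thesis by blast
      qed
      have gap0: "gap x i (min 1 (b - i))"
        using b unfolding gap_def by auto
      define \<delta> where "\<delta> = Sup {\<delta>. gap x i \<delta>}"
      have bddS: "bdd_above {\<delta>. gap x i \<delta>}"
        unfolding bdd_above_def gap_def by auto
      have le: "\<delta>' \<le> \<delta>" if "gap x i \<delta>'" for \<delta>'
        using that bddS unfolding \<delta>_def by (intro cSup_upper) auto
      have "gap x i \<delta>"
        unfolding gap_def
      proof (intro conjI allI impI)
        show "0 < \<delta>"
          using le[OF gap0] gap0 unfolding gap_def by linarith
        show "\<delta> \<le> 1"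
          unfolding \<delta>_def
        proof (rule cSup_least)
          show "{\<delta>. gap x i \<delta>} \<noteq> {}" using gap0 by blast
        qed (simp add: gap_def)
        fix s assume s: "i < s \<and> s < i + \<delta>"
        then have "s - i < \<delta>" by simp
        then obtain \<delta>' where "gap x i \<delta>'" "s - i < \<delta>'"
          using less_cSupD[of "{\<delta>. gap x i \<delta>}" "s - i"] gap0 unfolding \<delta>_def by auto
        then show "\<phi> x s"
          using s unfolding gap_def by (auto simp: diff_less_eq algebra_simps)
      qed
      then have "mid x (i + (1/2) * \<delta>) i \<delta>"
        using i False le unfolding mid_def by blast
      then show ?thesis unfolding CH_def by blast
    qed
  qed
  define f where "f = (\<lambda>x. if \<exists>t. CH x t then THE t. CH x t else 0)"
  have f_iff: "t = f x \<longleftrightarrow> CH x t \<or> \<not> (\<exists>s. CH x s) \<and> t = 0" for x t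
  proof (cases "\<exists>s. CH x s")
    case True
    then obtain s where s: "CH x s" by blast
    then have "(THE t. CH x t) = s"
      using CH_unique by blast
    then show ?thesis using s CH_unique unfolding f_def by auto
  next
    case False
    then show ?thesis unfolding f_def by auto
  qed
  have is_inf: "definable (\<lambda>z. is_inf (a z) (b z))" if "definable_fun a" "definable_fun b"
    for a :: "'c::euclidean_space \<Rightarrow> 'a" and b
    unfolding is_inf_def
    by (intro definable_rel2[OF \<phi>] definable_intros definable_fun_comp[OF that(1)] definable_fun_comp[OF that(2)])
  have gap: "definable (\<lambda>z. gap (a z) (b z) (c z))" if "definable_fun a" "definable_fun b" "definable_fun c"
    for a :: "'c::euclidean_space \<Rightarrow> 'a" and b c
    unfolding gap_def
    by (intro definable_rel2[OF \<phi>] definable_intros definable_fun_comp[OF that(1)]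
        definable_fun_comp[OF that(2)] definable_fun_comp[OF that(3)])
  have CH: "definable (\<lambda>z. CH (a z) (b z))" if "definable_fun a" "definable_fun b"
    for a :: "'c::euclidean_space \<Rightarrow> 'a" and b
    unfolding CH_def mid_def
    by (intro definable_rel2[OF \<phi>] is_inf gap definable_intros definable_fun_comp[OF that(1)]
        definable_fun_comp[OF that(2)] that)
  have "definable_fun f"
    unfolding definable_fun_def f_iff by (intro CH definable_intros)
  moreover have "\<phi> x (f x)" if "\<phi> x t" for x t
    using CH_ex[OF that] CH_\<phi> f_iff[of "f x" x] by blast
  ultimately show ?thesis by blast
qed

text \<open>
  The coordinates of the chosen point are selected one after the other.
\<close>

lemma definable_choice:
  fixes \<phi> :: "'a::euclidean_space \<Rightarrow> 'b::euclidean_space \<Rightarrow> bool"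
  assumes \<phi>: "definable (\<lambda>z. \<phi> (fst z) (snd z))" and bdd: "\<And>x. bounded {w. \<phi> x w}"
  shows "\<exists>f. definable_fun f \<and> (\<forall>x w. \<phi> x w \<longrightarrow> \<phi> x (f x))"
proof -
  have coords: "\<exists>f. definable_fun f \<and>
      (\<forall>x. (\<exists>w. \<phi> x w) \<longrightarrow> (\<exists>w. \<phi> x w \<and> (\<forall>b\<in>B. w \<bullet> b = f x \<bullet> b)))"
    if "finite B" "B \<subseteq> Basis" for B :: "'b set"
    using that
  proof (induction B)
    case empty
    then show ?case
      by (intro exI[of _ "\<lambda>x. 0"]) (simp add: definable_fun_const)
  next
    case (insert c B)
    then obtain f where f1: "definable_fun f"
      and f2: "\<forall>x. (\<exists>w. \<phi> x w) \<longrightarrow> (\<exists>w. \<phi> x w \<and> (\<forall>b\<in>B. w \<bullet> b = f x \<bullet> b))"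
      by auto
    note f = f1 f2[rule_format, OF exI]
    define \<phi>' where "\<phi>' = (\<lambda>x t. \<exists>w. \<phi> x w \<and> (\<forall>b\<in>B. w \<bullet> b = f x \<bullet> b) \<and> w \<bullet> c = t)"
    have "definable (\<lambda>z. \<phi>' (fst z) (snd z))"
      unfolding \<phi>'_def using insert.hyps(1)
      by (intro definable_ex definable_conj definable_rel2[OF \<phi>] definable_finite_Ball definable_eq
          definable_fun_inner definable_fun_comp[OF f(1)] definable_fun_fst definable_fun_snd
          definable_fun_id definable_fun_const)
    moreover have "bdd_below {t. \<phi>' x t}" for x
    proof -
      obtain M where M: "\<And>w. \<phi> x w \<Longrightarrow> norm w \<le> M"
        using bdd[of x] unfolding bounded_iff by auto
      have "- M \<le> t" if t: "\<phi>' x t" for t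
      proof -
        obtain w where "\<phi> x w" "w \<bullet> c = t"
          using t unfolding \<phi>'_def by blast
        moreover from this have "\<bar>w \<bullet> c\<bar> \<le> norm w"
          using insert.prems by (intro Basis_le_norm) auto
        ultimately show ?thesis using M[of w] by linarith
      qed
      then show ?thesis unfolding bdd_below_def by auto
    qed
    ultimately obtain g where g: "definable_fun g" "\<And>x t. \<phi>' x t \<Longrightarrow> \<phi>' x (g x)"
      using definable_choice_real[of \<phi>'] by blast
    define f' where "f' = (\<lambda>x. f x + (g x - f x \<bullet> c) *\<^sub>R c)"
    have "definable_fun f'"
      unfolding f'_def by (intro definable_intros f g)
    moreover have "\<exists>w. \<phi> x w \<and> (\<forall>b\<in>insert c B. w \<bullet> b = f' x \<bullet> b)" if w: "\<phi> x w0" for x w0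
    proof -
      have "\<exists>t. \<phi>' x t" using f(2)[OF w] unfolding \<phi>'_def by blast
      then have "\<phi>' x (g x)" using g(2) by blast
      then obtain w where w: "\<phi> x w" "\<forall>b\<in>B. w \<bullet> b = f x \<bullet> b" "w \<bullet> c = g x"
        unfolding \<phi>'_def by blast
      have "c \<bullet> b = 0" if "b \<in> B" for b
        using insert.prems insert.hyps(2) that by (intro inner_not_same_Basis) auto
      moreover have "c \<bullet> c = 1"
        using insert.prems by (simp add: inner_same_Basis)
      ultimately show ?thesis
        using w by (intro exI[of _ w]) (auto simp: f'_def inner_add_left)
    qed
    ultimately show ?case by (intro exI[of _ f']) blast
  qed
  obtain f where f: "definable_fun f"
    "\<And>x w. \<phi> x w \<Longrightarrow> \<exists>w. \<phi> x w \<and> (\<forall>b\<in>Basis. w \<bullet> b = f x \<bullet> b)"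
    using coords[of Basis] by auto
  then have "\<phi> x (f x)" if "\<phi> x w" for x w
    using that euclidean_eqI by metis
  with f(1) show ?thesis by blast
qed

section \<open>Radial behaviour of definable curves\<close>

lemma definable_fun_eventually_has_derivative:
  fixes \<psi> :: "real \<Rightarrow> real"
  assumes \<psi>: "definable_fun \<psi>"
  shows "\<forall>\<^sub>F r in at_right a. \<exists>D. (\<psi> has_real_derivative D) (at r)"
proof -
  have "definable (\<lambda>r. \<exists>D. GDERIV \<psi> r :> D)"
    by (intro definable_intros definable_GDERIV \<psi>)
  then consider "\<forall>\<^sub>F r in at_right a. \<exists>D. GDERIV \<psi> r :> D" | "\<forall>\<^sub>F r in at_right a. \<not> (\<exists>D. GDERIV \<psi> r :> D)"
    using definable_dichotomy_at_right by blast
  then show ?thesis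
  proof cases
    case 1
    then show ?thesis by simp
  next
    case 2
    then have "\<forall>\<^sub>F r in at_right a. isCont \<psi> r \<and> \<not> (\<exists>D. GDERIV \<psi> r :> D)"
      using definable_fun_eventually_isCont[OF \<psi>] eventually_conj by blast
    then obtain b where b: "b > a" "\<And>r. a < r \<Longrightarrow> r < b \<Longrightarrow> isCont \<psi> r \<and> \<not> (\<exists>D. GDERIV \<psi> r :> D)"
      unfolding eventually_at_right_field by blast
    have "continuous_on {a<..<b} \<psi>"
      using b(2) by (intro continuous_at_imp_continuous_on) auto
    then obtain r where r: "r \<in> {a<..<b}" "\<psi> differentiable (at r)"
      using definable_fun_dense_differentiable[OF \<psi>, of "{a<..<b}"] b(1) by auto
    then have "\<exists>D. GDERIV \<psi> r :> D"
      by (simp add: real_differentiable_def)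
    then show ?thesis using b(2) r(1) by auto
  qed
qed

text \<open>
  If \<open>r \<psi>'(r) - \<psi> r > e r\<close> just to the right of \<open>0\<close>, then \<open>\<psi> r / r - e ln r\<close> is
  nondecreasing there, which forces \<open>\<psi> r / r\<close> to tend to \<open>- \<infinity>\<close> as \<open>r\<close> tends to \<open>0\<close>, contrary to linear
  growth. By the dichotomy the only alternative is the asserted one.
\<close>

lemma definable_fun_radial_upper_bound:
  fixes \<psi> :: "real \<Rightarrow> real"
  assumes \<psi>: "definable_fun \<psi>" and K: "\<forall>\<^sub>F r in at_right 0. \<bar>\<psi> r\<bar> \<le> K * r" and e: "e > 0"
  shows "\<forall>\<^sub>F r in at_right 0. \<not> (\<exists>D. (\<psi> has_real_derivative D) (at r) \<and> e * r < r * D - \<psi> r)"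
proof -
  have "definable (\<lambda>r. \<exists>D. GDERIV \<psi> r :> D \<and> e * r < r * D - \<psi> r)"
    by (intro definable_ex definable_conj definable_GDERIV definable_intros definable_fun_comp[OF \<psi>] \<psi>)
  then consider "\<forall>\<^sub>F r in at_right 0. \<exists>D. GDERIV \<psi> r :> D \<and> e * r < r * D - \<psi> r"
    | "\<forall>\<^sub>F r in at_right 0. \<not> (\<exists>D. GDERIV \<psi> r :> D \<and> e * r < r * D - \<psi> r)"
    using definable_dichotomy_at_right by blast
  then show ?thesis
  proof cases
    case 1
    then have "\<forall>\<^sub>F r in at_right 0. \<bar>\<psi> r\<bar> \<le> K * r \<and> (\<exists>D. GDERIV \<psi> r :> D \<and> e * r < r * D - \<psi> r)"
      using K eventually_conj by blast
    then obtain b where b: "b > 0" "\<And>r. 0 < r \<Longrightarrow> r < b \<Longrightarrow> \<bar>\<psi> r\<bar> \<le> K * r"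
      "\<And>r. 0 < r \<Longrightarrow> r < b \<Longrightarrow> \<exists>D. (\<psi> has_real_derivative D) (at r) \<and> e * r < r * D - \<psi> r"
      unfolding eventually_at_right_field by (metis gderiv_deriv)
    define \<alpha> where "\<alpha> = (\<lambda>r. \<psi> r / r - e * ln r)"
    have deriv: "\<exists>y. (\<alpha> has_real_derivative y) (at r) \<and> 0 \<le> y" if r: "0 < r" "r < b" for r
    proof -
      obtain D where D: "(\<psi> has_real_derivative D) (at r)" "e * r < r * D - \<psi> r"
        using b(3)[OF r] by blast
      have "(\<alpha> has_real_derivative ((D * r - \<psi> r * 1) / (r * r) - e * (1 / r))) (at r)"
        unfolding \<alpha>_def using r D(1) by (auto intro!: derivative_eq_intros simp: field_simps)
      moreover have "0 \<le> (D * r - \<psi> r * 1) / (r * r) - e * (1 / r)"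
      proof -
        have "(D * r - \<psi> r * 1) / (r * r) - e * (1 / r) = (D * r - \<psi> r - e * r) / (r * r)"
          using r(1) by (simp add: field_simps)
        then show ?thesis using D(2) by (simp add: mult.commute)
      qed
      ultimately show ?thesis by blast
    qed
    define r1 where "r1 = b / 2"
    define l where "l = (- K - \<alpha> r1) / e"
    \<comment> \<open>Monotonicity of \<open>\<alpha>\<close> forces \<open>ln r \<ge> l\<close>, which fails for this \<open>r\<close>.\<close>
    define r where "r = min (r1 / 2) (exp (l - 1))"
    have r: "0 < r" "r < r1" "r < b" "r1 < b"
      using b(1) by (auto simp: r_def r1_def min_def)
    have "\<alpha> r \<le> \<alpha> r1"
      using r deriv by (intro DERIV_nonneg_imp_nondecreasing[of r r1 \<alpha>]) auto
    moreover have "- K \<le> \<psi> r / r"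
      using b(2)[OF r(1,3)] r(1) by (simp add: field_simps)
    ultimately have "- K - \<alpha> r1 \<le> e * ln r"
      by (simp add: \<alpha>_def)
    then have "l \<le> ln r"
      using e by (simp add: l_def field_simps)
    moreover have "ln r \<le> l - 1"
      using r(1) by (metis ln_exp ln_le_cancel_iff exp_gt_zero min.cobounded2 r_def)
    ultimately show ?thesis by simp
  next
    case 2
    then show ?thesis by simp
  qed
qed

text \<open>
  A function of linear growth is radially almost homogeneous: its graph is nearly tangent to the
  ray from the origin through each of its points. The upper bound is applied to \<open>\<psi>\<close> and \<open>- \<psi>\<close>.
\<close>

lemma definable_fun_radial_bound:
  fixes \<psi> :: "real \<Rightarrow> real"
  assumes \<psi>: "definable_fun \<psi>" and K: "\<forall>\<^sub>F r in at_right 0. \<bar>\<psi> r\<bar> \<le> K * r" and e: "e > 0"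
  shows "\<forall>\<^sub>F r in at_right 0. \<exists>D. (\<psi> has_real_derivative D) (at r) \<and> \<bar>\<psi> r - r * D\<bar> \<le> e * r"
proof -
  have "\<forall>\<^sub>F r in at_right 0. \<not> (\<exists>D. ((\<lambda>r. - \<psi> r) has_real_derivative D) (at r) \<and> e * r < r * D - - \<psi> r)"
    using K by (intro definable_fun_radial_upper_bound[where K = K] definable_fun_minus \<psi> e) simp_all
  with definable_fun_eventually_has_derivative[OF \<psi>, of 0] definable_fun_radial_upper_bound[OF assms]
  show ?thesis
  proof eventually_elim
    case (elim r)
    then obtain D where D: "(\<psi> has_real_derivative D) (at r)" by blast
    have "\<not> e * r < r * D - \<psi> r"
      using elim(2) D by blast
    moreover have "\<not> e * r < r * (- D) - - \<psi> r"
      using elim(3) DERIV_minus[OF D] by blast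
    ultimately show ?case using D by (intro exI[of _ D]) auto
  qed
qed

section \<open>Semismoothness at a point\<close>

lemma norm_gradient_le_lipschitz:
  fixes h :: "'a::euclidean_space \<Rightarrow> real"
  assumes L: "L-lipschitz_on U h" and U: "open U" "w \<in> U" and v: "GDERIV h w :> v"
  shows "norm v \<le> L"
proof (cases "v = 0")
  case True
  then show ?thesis using lipschitz_on_nonneg[OF L] by simp
next
  case False
  then have nv: "norm v > 0" by simp
  obtain d1 where d1: "d1 > 0" "ball w d1 \<subseteq> U"
    using U open_contains_ball by blast
  show ?thesis
  proof (rule field_le_epsilon)
    fix e :: real assume e: "e > 0"
    obtain d2 where d2: "d2 > 0" "\<And>u. norm (u - w) < d2 \<Longrightarrow>
        \<bar>h u - h w - (u - w) \<bullet> v\<bar> \<le> e * norm (u - w)"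
      using v e unfolding GDERIV_iff by blast
    define t where "t = min d1 d2 / (2 * norm v)"
    have t: "t > 0" using d1 d2 nv by (simp add: t_def)
    have "t * norm v < d1 \<and> t * norm v < d2"
      using nv d1 d2 by (auto simp: t_def min_def)
    then have "w + t *\<^sub>R v \<in> U" "norm ((w + t *\<^sub>R v) - w) < d2"
      using t d1(2) by (auto simp: dist_norm)
    then have "\<bar>h (w + t *\<^sub>R v) - h w - t * (v \<bullet> v)\<bar> \<le> e * (t * norm v)"
      "\<bar>h (w + t *\<^sub>R v) - h w\<bar> \<le> L * (t * norm v)"
      using d2(2)[of "w + t *\<^sub>R v"] lipschitz_onD[OF L, of "w + t *\<^sub>R v" w] U(2) t
      by (simp_all add: dist_norm)
    then have "t * (v \<bullet> v) \<le> L * (t * norm v) + e * (t * norm v)"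
      by linarith
    then have "(t * norm v) * norm v \<le> (t * norm v) * (L + e)"
      by (simp add: power2_norm_eq_inner[symmetric] power2_eq_square algebra_simps)
    then show "norm v \<le> L + e"
      using t nv by simp
  qed
qed

lemma definable_fun_curve_radial_bound:
  fixes f :: "real \<Rightarrow> 'a::euclidean_space"
  assumes f: "definable_fun f" and K: "\<forall>\<^sub>F r in at_right 0. norm (f r) \<le> K * r" and e: "e > 0"
  shows "\<forall>\<^sub>F r in at_right 0. \<exists>F'. (f has_vector_derivative F') (at r) \<and>
    norm (f r - r *\<^sub>R F') \<le> real DIM('a) * e * r"
proof -
  have "\<forall>\<^sub>F r in at_right 0. \<exists>D. ((\<lambda>r. f r \<bullet> b) has_real_derivative D) (at r) \<and> \<bar>f r \<bullet> b - r * D\<bar> \<le> e * r"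
    if b: "b \<in> Basis" for b
  proof (rule definable_fun_radial_bound[where K = K])
    show "definable_fun (\<lambda>r. f r \<bullet> b)"
      by (intro definable_intros f)
    show "\<forall>\<^sub>F r in at_right 0. \<bar>f r \<bullet> b\<bar> \<le> K * r"
      using K by (rule eventually_mono) (use Basis_le_norm[OF b] order_trans in blast)
  qed (rule e)
  then have "\<forall>\<^sub>F r in at_right 0. \<forall>b\<in>Basis. \<exists>D. ((\<lambda>r. f r \<bullet> b) has_real_derivative D) (at r) \<and>
      \<bar>f r \<bullet> b - r * D\<bar> \<le> e * r"
    by (intro eventually_ball_finite) auto
  then show ?thesis
  proof (rule eventually_mono)
    fix r
    assume "\<forall>b\<in>Basis. \<exists>D. ((\<lambda>r. f r \<bullet> b) has_real_derivative D) (at r) \<and> \<bar>f r \<bullet> b - r * D\<bar> \<le> e * r"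
    then obtain D where D: "\<And>b. b \<in> Basis \<Longrightarrow> ((\<lambda>r. f r \<bullet> b) has_real_derivative D b) (at r)"
      "\<And>b. b \<in> Basis \<Longrightarrow> \<bar>f r \<bullet> b - r * D b\<bar> \<le> e * r"
      by metis
    define F' where "F' = (\<Sum>b\<in>Basis. D b *\<^sub>R b)"
    have F': "F' \<bullet> b = D b" if "b \<in> Basis" for b
      using that by (simp add: F'_def)
    have "((\<lambda>r. \<Sum>b\<in>Basis. (f r \<bullet> b) *\<^sub>R b) has_vector_derivative F') (at r)"
      unfolding F'_def
      by (intro has_vector_derivative_sum)
        (use D(1) in \<open>auto intro!: derivative_eq_intros simp: has_real_derivative_iff_has_vector_derivative\<close>)
    then have "(f has_vector_derivative F') (at r)"
      by (simp add: euclidean_representation)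
    moreover have "norm (f r - r *\<^sub>R F') \<le> (\<Sum>b\<in>Basis. \<bar>(f r - r *\<^sub>R F') \<bullet> b\<bar>)"
      by (rule norm_le_l1)
    moreover have "\<dots> \<le> (\<Sum>b\<in>(Basis :: 'a set). e * r)"
      using D(2) by (intro sum_mono) (simp add: inner_diff_left F')
    ultimately show "\<exists>F'. (f has_vector_derivative F') (at r) \<and> norm (f r - r *\<^sub>R F') \<le> real DIM('a) * e * r"
      by (intro exI[of _ F']) (simp add: mult.assoc)
  qed
qed

text \<open>
  Curve selection. If the defect is not \<open>o(\<parallel>w\<parallel>)\<close>, a definable curve \<open>f\<close> with
  \<open>\<parallel>f r\<parallel> = r\<close> runs through bad points. Along it \<open>f r\<close> is close to \<open>r f'(r)\<close> and \<open>h (f r)\<close> to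
  \<open>r (h \<circ> f)'(r) = (r f'(r)) \<bullet> v\<close>, whence \<open>h (f r)\<close> is close to \<open>f r \<bullet> v\<close>. The Lipschitz
  condition enters through the bound on \<open>v\<close>.
\<close>

lemma semismooth_little_o:
  fixes h :: "'a::euclidean_space \<Rightarrow> real"
  assumes h: "definable_fun h" and L: "L-lipschitz_on (ball 0 \<rho>) h" and \<rho>: "\<rho> > 0"
    and h0: "h 0 = 0" and c: "c > 0"
  shows "\<exists>\<epsilon>>0. \<forall>w v. norm w < \<epsilon> \<longrightarrow> GDERIV h w :> v \<longrightarrow> \<bar>h w - w \<bullet> v\<bar> \<le> c * norm w"
proof -
  define \<phi> where "\<phi> = (\<lambda>r w. norm w = r \<and> (\<exists>v. GDERIV h w :> v \<and> c * r < \<bar>h w - w \<bullet> v\<bar>))"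
  have \<phi>: "definable (\<lambda>z. \<phi> (fst z) (snd z))"
    unfolding \<phi>_def
    by (intro definable_conj definable_ex definable_GDERIV definable_intros definable_fun_comp[OF h] h)
  then consider "\<forall>\<^sub>F r in at_right 0. \<exists>w. \<phi> r w" | "\<forall>\<^sub>F r in at_right 0. \<not> (\<exists>w. \<phi> r w)"
    using definable_dichotomy_at_right[OF definable_ex] by blast
  then show ?thesis
  proof cases
    case 2
    then obtain b where b: "b > 0" "\<And>r w. 0 < r \<Longrightarrow> r < b \<Longrightarrow> \<not> \<phi> r w"
      unfolding eventually_at_right_field by blast
    show ?thesis
    proof (intro exI[of _ b] conjI allI impI b(1))
      fix w v assume w: "norm w < b" "GDERIV h w :> v"
      show "\<bar>h w - w \<bullet> v\<bar> \<le> c * norm w"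
      proof (cases "w = 0")
        case False
        then show ?thesis
          using b(2)[of "norm w" w] w unfolding \<phi>_def by (simp add: not_less)
      qed (simp add: h0)
    qed
  next
    case 1
    have "bounded {w. \<phi> r w}" for r
      unfolding bounded_iff \<phi>_def by (intro exI[of _ r]) auto
    then obtain f where f: "definable_fun f" "\<And>r w. \<phi> r w \<Longrightarrow> \<phi> r (f r)"
      using definable_choice[OF \<phi>] by blast
    have ev: "\<forall>\<^sub>F r in at_right 0. \<phi> r (f r)"
      using 1 by (rule eventually_mono) (use f(2) in blast)
    have Lnn: "L \<ge> 0" using lipschitz_on_nonneg[OF L] .
    \<comment> \<open>Error \<open>e r\<close> from \<open>h \<circ> f\<close>, and \<open>e r\<close> from each coordinate of \<open>f\<close>, multiplied by \<open>\<parallel>v\<parallel> \<le> L\<close>.\<close>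
    define e where "e = c / (1 + real DIM('a) * L)"
    have e: "e > 0" "e * (1 + real DIM('a) * L) = c"
      using c Lnn by (auto simp: e_def add_pos_nonneg intro!: divide_pos_pos)
        (metis add_pos_nonneg less_irrefl mult_nonneg_nonneg of_nat_0_le_iff zero_less_one)
    have small: "\<forall>\<^sub>F r in at_right 0. r \<in> {0<..<\<rho>}"
      using \<rho> by (intro eventually_at_right_real)
    have fr: "\<forall>\<^sub>F r in at_right 0. norm (f r) = r \<and> r \<in> {0<..<\<rho>}"
      using ev small by eventually_elim (simp add: \<phi>_def)
    have "\<forall>\<^sub>F r in at_right 0. \<exists>D. ((\<lambda>r. h (f r)) has_real_derivative D) (at r) \<and> \<bar>h (f r) - r * D\<bar> \<le> e * r"
    proof (rule definable_fun_radial_bound[where K = L])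
      show "\<forall>\<^sub>F r in at_right 0. \<bar>h (f r)\<bar> \<le> L * r"
        using fr
      proof (rule eventually_mono)
        fix r assume r: "norm (f r) = r \<and> r \<in> {0<..<\<rho>}"
        then have "\<bar>h (f r) - h 0\<bar> \<le> L * norm (f r - 0)"
          using lipschitz_onD[OF L, of "f r" 0] \<rho> by (simp add: dist_norm)
        then show "\<bar>h (f r)\<bar> \<le> L * r" using r h0 by simp
      qed
    qed (intro definable_fun_comp[OF h] f e)+
    moreover have "\<forall>\<^sub>F r in at_right 0. norm (f r) \<le> 1 * r"
      using fr by (rule eventually_mono) auto
    note definable_fun_curve_radial_bound[OF f(1) this e(1)]
    ultimately have "\<forall>\<^sub>F r::real in at_right 0. r \<noteq> r"
      using ev fr
    proof eventually_elim
      case (elim r)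
      then obtain D F' v where D: "((\<lambda>r. h (f r)) has_real_derivative D) (at r)" "\<bar>h (f r) - r * D\<bar> \<le> e * r"
        and F': "(f has_vector_derivative F') (at r)" "norm (f r - r *\<^sub>R F') \<le> real DIM('a) * e * r"
        and v: "GDERIV h (f r) :> v" "c * r < \<bar>h (f r) - f r \<bullet> v\<bar>" and r: "norm (f r) = r" "0 < r" "r < \<rho>"
        unfolding \<phi>_def by auto
      have "((\<lambda>r. h (f r)) has_derivative (\<lambda>t. (t *\<^sub>R F') \<bullet> v)) (at r)"
        using F'(1) v(1) unfolding has_vector_derivative_def gderiv_def
        by (rule has_derivative_compose)
      then have "((\<lambda>r. h (f r)) has_real_derivative (F' \<bullet> v)) (at r)"
        unfolding has_field_derivative_def by (rule has_derivative_eq_rhs) (simp add: fun_eq_iff)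
      then have D_eq: "D = F' \<bullet> v"
        using D(1) DERIV_unique by blast
      have nv: "norm v \<le> L"
        using norm_gradient_le_lipschitz[OF L open_ball _ v(1)] r by simp
      have "h (f r) - f r \<bullet> v = (h (f r) - r * D) - (f r - r *\<^sub>R F') \<bullet> v"
        by (simp add: D_eq inner_diff_left)
      then have "\<bar>h (f r) - f r \<bullet> v\<bar> \<le> \<bar>h (f r) - r * D\<bar> + \<bar>(f r - r *\<^sub>R F') \<bullet> v\<bar>"
        by linarith
      also have "\<bar>(f r - r *\<^sub>R F') \<bullet> v\<bar> \<le> norm (f r - r *\<^sub>R F') * norm v"
        by (rule Cauchy_Schwarz_ineq2)
      also have "\<dots> \<le> (real DIM('a) * e * r) * L"
        using F'(2) nv Lnn e(1) r by (intro mult_mono) auto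
      finally have "\<bar>h (f r) - f r \<bullet> v\<bar> \<le> e * r + (real DIM('a) * e * r) * L"
        using D(2) by linarith
      also have "\<dots> = (e * (1 + real DIM('a) * L)) * r"
        by (simp add: algebra_simps)
      finally show ?case using v(2) e(2) by simp
    qed
    then show ?thesis by simp
  qed
qed

text \<open>
  A Lojasiewicz inequality for the fibres of a planar set. A definable \<open>\<sigma>\<close> with \<open>\<sigma> r\<close> at least
  half the supremum of the fibre over \<open>r\<close> satisfies \<open>q (r, \<sigma> r) = 0\<close>. After division by the largest
  power of \<open>r\<close> dividing \<open>q\<close>, this reads \<open>a (\<sigma> r) = O(r)\<close> with a nonzero polynomial \<open>a\<close> in one
  variable, and \<open>a t\<close> behaves like a multiple of \<open>t\<^sup>j\<close> near \<open>0\<close>.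
\<close>

lemma definable_lojasiewicz:
  fixes S :: "real \<Rightarrow> real \<Rightarrow> bool"
  assumes S: "definable (\<lambda>z. S (fst z) (snd z))" and nonneg: "\<And>r s. S r s \<Longrightarrow> 0 \<le> s"
    and small: "\<And>c. c > 0 \<Longrightarrow> \<forall>\<^sub>F r in at_right 0. \<forall>s. S r s \<longrightarrow> s \<le> c"
  shows "\<exists>C n. C > 0 \<and> n > 0 \<and> (\<forall>\<^sub>F r in at_right 0. \<forall>s. S r s \<longrightarrow> s ^ n \<le> C * r)"
proof -
  define \<phi> where "\<phi> = (\<lambda>r t. S r t \<and> (\<forall>s. S r s \<longrightarrow> s \<le> 2 * t))"
  have \<phi>: "definable (\<lambda>z. \<phi> (fst z) (snd z))"
    unfolding \<phi>_def by (intro definable_intros definable_rel2[OF S])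
  moreover have "bdd_below {t. \<phi> r t}" for r
    unfolding bdd_below_def \<phi>_def using nonneg by blast
  ultimately obtain \<sigma> where \<sigma>: "definable_fun \<sigma>" "\<And>r t. \<phi> r t \<Longrightarrow> \<phi> r (\<sigma> r)"
    using definable_choice_real[of \<phi>] by blast
  have half_sup: "\<exists>t. \<phi> r t" if bound: "\<forall>s. S r s \<longrightarrow> s \<le> 1" and s0: "S r s0" for r s0
  proof (cases "\<forall>s. S r s \<longrightarrow> s \<le> 0")
    case True
    then have "\<phi> r s0"
      using s0 nonneg[OF s0] unfolding \<phi>_def by auto
    then show ?thesis by blast
  next
    case False
    have bdd: "bdd_above {s. S r s}"
      unfolding bdd_above_def using bound by blast
    define M where "M = Sup {s. S r s}"
    have le: "s \<le> M" if "S r s" for s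
      using that bdd unfolding M_def by (intro cSup_upper) auto
    then have "M > 0" using False by (meson less_le_trans not_le)
    then obtain t where "S r t" "M / 2 < t"
      using less_cSupD[of "{s. S r s}" "M / 2"] s0 unfolding M_def by auto
    then have "\<phi> r t"
      using le unfolding \<phi>_def by force
    then show ?thesis by blast
  qed
  obtain q where q: "real_polynomial_function q" "\<exists>z. q z \<noteq> 0" "\<And>r. q (r, \<sigma> r) = 0"
    using definable_fun_algebraic[OF \<sigma>(1)] by blast
  have "real_polynomial_function (q \<circ> (\<lambda>z. (snd z, fst z)))"
    by (intro real_polynomial_function_compose q polynomial_function_intros)
  then obtain n c where c: "poly_family n c" "\<And>t r. q (r, t) = poly (c t) r"
    using real_polynomial_function_as_poly_family[of "q \<circ> (\<lambda>z. (snd z, fst z))"] by auto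
  have "\<exists>k t. coeff (c t) k \<noteq> 0"
  proof -
    obtain r t where "q (r, t) \<noteq> 0" using q(2) by (metis surj_pair)
    then have "c t \<noteq> 0" using c(2) by auto
    then show ?thesis using leading_coeff_0_iff by blast
  qed
  \<comment> \<open>Regarding \<open>q\<close> as a polynomial in \<open>r\<close>, the power \<open>r ^ k\<close> splits off.\<close>
  define k where "k = (LEAST k. \<exists>t. coeff (c t) k \<noteq> 0)"
  have k: "\<exists>t. coeff (c t) k \<noteq> 0" "\<And>i t. i < k \<Longrightarrow> coeff (c t) i = 0"
    using LeastI_ex[OF \<open>\<exists>k t. coeff (c t) k \<noteq> 0\<close>] not_less_Least unfolding k_def by blast+
  define a where "a = (\<lambda>t. coeff (c t) k)"
  define d where "d = (\<lambda>t. poly_shift (Suc k) (c t))"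
  have c_eq: "c t = monom 1 k * (pCons (a t) (d t))" for t
    by (rule poly_eqI) (auto simp: coeff_monom_mult a_def d_def coeff_poly_shift k(2) coeff_pCons split: nat.split)
  have "poly_family n d"
    unfolding poly_family_def
  proof (intro conjI allI)
    show "real_polynomial_function (\<lambda>x. coeff (d x) i)" for i
      using poly_family_coeff[OF c(1)] by (simp add: d_def coeff_poly_shift)
    show "degree (d x) \<le> n" for x
      using poly_family_degree[OF c(1), of x]
      by (intro degree_le) (auto simp: d_def coeff_poly_shift intro!: coeff_eq_0)
  qed
  then have "real_polynomial_function (\<lambda>z. poly (d (fst z)) (snd z))"
    by (rule poly_family_real_polynomial_function)
  then have "continuous_on ({0..1} \<times> {0..1}) (\<lambda>z. poly (d (fst z)) (snd z))"
    by (metis continuous_at_imp_continuous_on continuous_polymonial_function real_polynomial_function_eq)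
  then have "bounded ((\<lambda>z. poly (d (fst z)) (snd z)) ` ({0..1} \<times> {0..1}))"
    by (intro compact_imp_bounded compact_continuous_image compact_Times) auto
  then obtain M where M: "M > 0" "\<And>t r. t \<in> {0..1} \<Longrightarrow> r \<in> {0..1} \<Longrightarrow> \<bar>poly (d t) r\<bar> \<le> M"
    unfolding bounded_pos by force
  have a_small: "\<bar>a (\<sigma> r)\<bar> \<le> M * r" if r: "0 < r" "r \<le> 1" "\<sigma> r \<in> {0..1}" for r
  proof -
    have "r ^ k * (a (\<sigma> r) + r * poly (d (\<sigma> r)) r) = 0"
      using q(3)[of r] unfolding c(2) c_eq poly_mult poly_monom poly_pCons by simp
    then have "a (\<sigma> r) = - (r * poly (d (\<sigma> r)) r)"
      using r(1) by simp
    then show ?thesis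
      using M(2)[OF r(3), of r] r by (simp add: abs_mult mult.commute mult_right_mono)
  qed
  obtain A where A: "a = poly A"
    using real_polynomial_function_as_poly[OF poly_family_coeff[OF c(1), of k]] unfolding a_def by blast
  have "A \<noteq> 0" using k(1) A unfolding a_def by (metis poly_0)
  then obtain u where u: "A = [:- 0, 1:] ^ order 0 A * u" "\<not> [:- 0, 1:] dvd u"
    using order_decomp by blast
  define j where "j = order 0 A"
  have a_eq: "a t = t ^ j * poly u t" for t
    unfolding A by (subst u(1)) (simp add: j_def)
  have u0: "poly u 0 \<noteq> 0"
    using u(2) poly_eq_0_iff_dvd[of u 0] by simp
  define m where "m = \<bar>poly u 0\<bar> / 2"
  have m: "m > 0" using u0 by (simp add: m_def)
  have "isCont (poly u) 0" by (rule poly_isCont)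
  then obtain s0 where s0: "s0 > 0" "\<And>t. \<bar>t\<bar> < s0 \<Longrightarrow> \<bar>poly u t - poly u 0\<bar> < m"
    unfolding continuous_at_real_range using m by (metis diff_zero real_norm_def)
  have u_large: "m \<le> \<bar>poly u t\<bar>" if "\<bar>t\<bar> < s0" for t
    using s0(2)[OF that] unfolding m_def by linarith
  define C where "C = 2 ^ Suc j * (M / m)"
  have "\<forall>\<^sub>F r in at_right 0. (\<forall>s. S r s \<longrightarrow> s \<le> min 1 (s0 / 2)) \<and> r \<in> {0<..<1}"
    using s0(1) by (intro eventually_conj small eventually_at_right_real) auto
  then have "\<forall>\<^sub>F r in at_right 0. \<forall>s. S r s \<longrightarrow> s ^ Suc j \<le> C * r"
  proof (rule eventually_mono, intro allI impI)
    fix r s assume r: "(\<forall>s. S r s \<longrightarrow> s \<le> min 1 (s0 / 2)) \<and> r \<in> {0<..<1}" and s: "S r s"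
    have "\<phi> r (\<sigma> r)"
      using half_sup[of r s] r s \<sigma>(2) by force
    then have \<sigma>r: "S r (\<sigma> r)" "s \<le> 2 * \<sigma> r"
      using s unfolding \<phi>_def by auto
    have range: "0 \<le> \<sigma> r" "\<sigma> r \<le> 1" "\<bar>\<sigma> r\<bar> < s0"
      using nonneg[OF \<sigma>r(1)] r \<sigma>r(1) s0(1) by force+
    have "\<sigma> r ^ j * m \<le> \<sigma> r ^ j * \<bar>poly u (\<sigma> r)\<bar>"
      using u_large[OF range(3)] range(1) by (intro mult_left_mono) auto
    also have "\<dots> = \<bar>a (\<sigma> r)\<bar>"
      using range(1) by (simp add: a_eq abs_mult)
    also have "\<dots> \<le> M * r"
      using a_small[of r] r range by auto
    finally have "\<sigma> r ^ j \<le> M / m * r"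
      using m by (simp add: field_simps)
    \<comment> \<open>The exponent \<open>Suc j\<close> is positive even if \<open>j = 0\<close>.\<close>
    moreover have "\<sigma> r ^ Suc j \<le> \<sigma> r ^ j"
      using range by (intro power_decreasing) auto
    ultimately have "\<sigma> r ^ Suc j \<le> M / m * r" by linarith
    moreover have "s ^ Suc j \<le> (2 * \<sigma> r) ^ Suc j"
      using \<sigma>r(2) nonneg[OF s] by (intro power_mono) auto
    ultimately show "s ^ Suc j \<le> C * r"
      unfolding power_mult_distrib C_def by (smt (verit) mult.assoc mult_left_mono zero_le_power)
  qed
  moreover have "C > 0" using M(1) m by (simp add: C_def)
  ultimately show ?thesis by blast
qed

text \<open>
  The previous two lemmas combined, for the set of pairs of a radius \<open>r\<close> and a quotient of a
  defect on the sphere of radius \<open>r\<close> by \<open>r\<close>.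
\<close>

lemma semismooth_power_bound:
  fixes h :: "'a::euclidean_space \<Rightarrow> real"
  assumes h: "definable_fun h" and L: "L-lipschitz_on (ball 0 \<rho>) h" and \<rho>: "\<rho> > 0" and h0: "h 0 = 0"
  shows "\<exists>C \<eta> \<epsilon>. C > 0 \<and> 0 < \<eta> \<and> \<eta> \<le> 1 \<and> \<epsilon> > 0 \<and>
    (\<forall>w v. norm w < \<epsilon> \<longrightarrow> GDERIV h w :> v \<longrightarrow> \<bar>h w - w \<bullet> v\<bar> \<le> C * norm w powr (1 + \<eta>))"
proof -
  define S where "S = (\<lambda>r s. 0 < r \<and> (\<exists>w v. norm w = r \<and> GDERIV h w :> v \<and> \<bar>h w - w \<bullet> v\<bar> = s * r))"
  have "definable (\<lambda>z. S (fst z) (snd z))"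
    unfolding S_def
    by (intro definable_conj definable_ex definable_GDERIV definable_intros definable_fun_comp[OF h] h)
  moreover have "0 \<le> s" if "S r s" for r s
    using that unfolding S_def by (metis abs_ge_zero zero_le_mult_iff not_less)
  moreover have "\<forall>\<^sub>F r in at_right 0. \<forall>s. S r s \<longrightarrow> s \<le> c" if c: "c > 0" for c
  proof -
    obtain \<epsilon> where \<epsilon>: "\<epsilon> > 0"
      "\<And>w v. norm w < \<epsilon> \<Longrightarrow> GDERIV h w :> v \<Longrightarrow> \<bar>h w - w \<bullet> v\<bar> \<le> c * norm w"
      using semismooth_little_o[OF h L \<rho> h0 c] by blast
    have "s \<le> c" if "0 < r" "r < \<epsilon>" "S r s" for r s
    proof -
      obtain w v where "norm w = r" "GDERIV h w :> v" "\<bar>h w - w \<bullet> v\<bar> = s * r"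
        using \<open>S r s\<close> unfolding S_def by blast
      then have "s * r \<le> c * r" using \<epsilon>(2)[of w v] that by simp
      then show ?thesis using that(1) by simp
    qed
    then show ?thesis
      unfolding eventually_at_right_field using \<epsilon>(1) by blast
  qed
  ultimately obtain C n where C: "C > 0" "n > 0" "\<forall>\<^sub>F r in at_right 0. \<forall>s. S r s \<longrightarrow> s ^ n \<le> C * r"
    using definable_lojasiewicz[of S] by blast
  then obtain \<epsilon> where \<epsilon>: "\<epsilon> > 0" "\<And>r s. 0 < r \<Longrightarrow> r < \<epsilon> \<Longrightarrow> S r s \<Longrightarrow> s ^ n \<le> C * r"
    unfolding eventually_at_right_field by blast
  define \<eta> where "\<eta> = 1 / real n"
  have "\<bar>h w - w \<bullet> v\<bar> \<le> (C powr \<eta>) * norm w powr (1 + \<eta>)" if w: "norm w < \<epsilon>" "GDERIV h w :> v" for w v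
  proof (cases "w = 0")
    case False
    define r where "r = norm w"
    define s where "s = \<bar>h w - w \<bullet> v\<bar> / r"
    have r: "0 < r" using False by (simp add: r_def)
    have "S r s"
      unfolding S_def using w(2) r by (intro conjI exI[of _ w] exI[of _ v]) (auto simp: r_def s_def)
    then have sn: "s ^ n \<le> C * r"
      using \<epsilon>(2) r w(1) by (simp add: r_def)
    have s: "s \<ge> 0" using r by (simp add: s_def)
    have "s = (s ^ n) powr \<eta>"
      using s C(2) by (cases "s = 0") (simp_all add: \<eta>_def powr_realpow[symmetric] powr_powr)
    also have "\<dots> \<le> (C * r) powr \<eta>"
      using sn s by (intro powr_mono2) (auto simp: \<eta>_def)
    also have "\<dots> = C powr \<eta> * r powr \<eta>"
      using C(1) r by (simp add: powr_mult)
    finally have "s * r \<le> C powr \<eta> * r powr \<eta> * r"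
      using r by (intro mult_right_mono) auto
    also have "\<dots> = C powr \<eta> * r powr (1 + \<eta>)"
      using r by (simp add: powr_add)
    finally show ?thesis using r by (simp add: s_def r_def)
  qed (simp add: h0)
  moreover have "0 < \<eta>" "\<eta> \<le> 1" "C powr \<eta> > 0"
    using C(1,2) by (auto simp: \<eta>_def)
  ultimately show ?thesis using \<epsilon>(1) by blast
qed

section \<open>Clarke subdifferentials of definable functions\<close>

lemma differentiable_imp_GDERIV:
  fixes h :: "'a::euclidean_space \<Rightarrow> real"
  assumes "h differentiable (at w)"
  shows "\<exists>v. GDERIV h w :> v"
proof -
  obtain D where D: "(h has_derivative D) (at w)"
    using assms unfolding differentiable_def by blast
  interpret bounded_linear D using D by (rule has_derivative_bounded_linear)
  have "D x = x \<bullet> (\<Sum>b\<in>Basis. D b *\<^sub>R b)" for x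
  proof -
    have "D x = D (\<Sum>b\<in>Basis. (x \<bullet> b) *\<^sub>R b)"
      by (simp add: euclidean_representation)
    also have "\<dots> = (\<Sum>b\<in>Basis. (x \<bullet> b) * D b)"
      by (simp add: sum scaleR)
    finally show ?thesis
      by (simp add: inner_sum_right mult.commute)
  qed
  then have "D = (\<lambda>x. x \<bullet> (\<Sum>b\<in>Basis. D b *\<^sub>R b))" by blast
  then show ?thesis using D unfolding gderiv_def by metis
qed

lemma clarke_subdifferential_subset:
  assumes "convex T" and "\<And>u G v. u \<longlonglongrightarrow> w \<Longrightarrow> (\<And>i. GDERIV h (u i) :> G i) \<Longrightarrow> G \<longlonglongrightarrow> v \<Longrightarrow> v \<in> T"
  shows "clarke_subdifferential h w \<subseteq> T"
  unfolding clarke_subdifferential_def using assms by (intro hull_minimal) blast+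

lemma clarke_subdifferential_norm_le:
  fixes h :: "'a::euclidean_space \<Rightarrow> real"
  assumes L: "L-lipschitz_on U h" and U: "open U" "w \<in> U"
    and v: "v \<in> clarke_subdifferential h w"
  shows "norm v \<le> L"
proof -
  have "clarke_subdifferential h w \<subseteq> cball 0 L"
  proof (rule clarke_subdifferential_subset)
    fix u G v assume u: "u \<longlonglongrightarrow> w" and G: "\<And>i. GDERIV h (u i) :> G i" and lim: "G \<longlonglongrightarrow> v"
    have "\<forall>\<^sub>F i in sequentially. u i \<in> U"
      using u U topological_tendstoD by blast
    then have "\<forall>\<^sub>F i in sequentially. norm (G i) \<le> L"
      by (rule eventually_mono) (use norm_gradient_le_lipschitz[OF L U(1)] G in blast)
    then have "norm v \<le> L"
      by (intro tendsto_upperbound[OF tendsto_norm[OF lim]]) auto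
    then show "v \<in> cball 0 L" by simp
  qed (rule convex_cball)
  then show ?thesis using v by auto
qed

lemma locally_lipschitz_isCont:
  fixes h :: "'a::euclidean_space \<Rightarrow> real"
  assumes "locally_lipschitz h"
  shows "isCont h w"
proof -
  obtain r L where "r > 0" "L-lipschitz_on (ball w r) h"
    using assms unfolding locally_lipschitz_def by blast
  then have "continuous_on (ball w r) h" "w \<in> ball w r"
    using lipschitz_on_continuous_on by auto
  then show ?thesis
    using continuous_on_eq_continuous_at[OF open_ball] by blast
qed

text \<open>
  Points of differentiability accumulate at \<open>w\<close>, and the gradients there are bounded, so a
  subsequence of them converges.
\<close>

lemma clarke_subdifferential_nonempty:
  fixes h :: "'a::euclidean_space \<Rightarrow> real"
  assumes h: "definable_fun h" and lip: "locally_lipschitz h"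
  shows "clarke_subdifferential h w \<noteq> {}"
proof -
  obtain r L where r: "r > 0" and L: "L-lipschitz_on (ball w r) h"
    using lip unfolding locally_lipschitz_def by blast
  have "\<exists>u v. u \<in> ball w (r / real (Suc n)) \<and> GDERIV h u :> v" for n
  proof -
    have "continuous_on (ball w (r / real (Suc n))) h"
      using locally_lipschitz_isCont[OF lip] continuous_at_imp_continuous_on by blast
    moreover have "w \<in> ball w (r / real (Suc n))"
      using divide_pos_pos[OF r, of "real (Suc n)"] by simp
    ultimately show ?thesis
      using definable_fun_dense_differentiable[OF h _ open_ball] differentiable_imp_GDERIV
      by (metis empty_iff)
  qed
  then obtain u G where u: "\<And>n. u n \<in> ball w (r / real (Suc n))" and G: "\<And>n. GDERIV h (u n) :> G n"
    by metis
  have "u \<longlonglongrightarrow> w"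
  proof (rule metric_LIMSEQ_I)
    fix e :: real assume "e > 0"
    then obtain N where N: "r / e < real N" using reals_Archimedean2 by blast
    have "dist (u n) w < e" if "n \<ge> N" for n
    proof -
      have "r / e < real (Suc n)" using N that by linarith
      then have "r / real (Suc n) < e"
        using \<open>e > 0\<close> by (simp add: field_simps)
      then show ?thesis using u[of n] by (simp add: dist_commute)
    qed
    then show "\<exists>N. \<forall>n\<ge>N. dist (u n) w < e" by blast
  qed
  have "G n \<in> cball 0 L" for n
  proof -
    have "r / real (Suc n) \<le> r" using r by (simp add: field_simps)
    then have "u n \<in> ball w r" using u[of n] by auto
    then show ?thesis using norm_gradient_le_lipschitz[OF L open_ball _ G] by simp
  qed
  then obtain l s where s: "strict_mono (s :: nat \<Rightarrow> nat)" "(G \<circ> s) \<longlonglongrightarrow> l"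
    using compact_cball unfolding compact_def by metis
  have "(u \<circ> s) \<longlonglongrightarrow> w"
    using \<open>u \<longlonglongrightarrow> w\<close> s(1) by (rule LIMSEQ_subseq_LIMSEQ)
  moreover have "\<forall>i. GDERIV h ((u \<circ> s) i) :> (G \<circ> s) i"
    using G by simp
  ultimately have "l \<in> clarke_subdifferential h w"
    unfolding clarke_subdifferential_def using s(2) by (intro hull_inc) blast
  then show ?thesis by blast
qed

text \<open>
  A Lipschitz constant near \<open>w\<close> bounds the subgradients at \<open>w\<close>; finitely many neighbourhoods
  cover the closure of \<open>S\<close>.
\<close>

lemma clarke_subdifferential_locally_bounded:
  fixes h :: "'a::euclidean_space \<Rightarrow> real"
  assumes lip: "locally_lipschitz h" and S: "bounded S"
  obtains M where "M \<ge> 0" "\<And>w v. w \<in> S \<Longrightarrow> v \<in> clarke_subdifferential h w \<Longrightarrow> norm v \<le> M"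
proof -
  obtain r L where rL: "\<And>w. r w > 0" "\<And>w. (L w)-lipschitz_on (ball w (r w)) h"
    using lip unfolding locally_lipschitz_def by metis
  have "compact (closure S)" using S by simp
  moreover have "closure S \<subseteq> (\<Union>w\<in>closure S. ball w (r w))"
    using rL(1) by force
  ultimately obtain W where W: "finite W" "closure S \<subseteq> (\<Union>w\<in>W. ball w (r w))"
    using compactE_image[of "closure S" "closure S" "\<lambda>w. ball w (r w)"] by (metis open_ball)
  have Lnn: "L w \<ge> 0" for w using lipschitz_on_nonneg[OF rL(2)] .
  show thesis
  proof (rule that)
    show "sum L W \<ge> 0" using Lnn by (simp add: sum_nonneg)
    fix w v assume w: "w \<in> S" and v: "v \<in> clarke_subdifferential h w"
    have "w \<in> closure S" using w closure_subset by blast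
    then obtain c where c: "c \<in> W" "w \<in> ball c (r c)"
      using W(2) by blast
    have "norm v \<le> L c"
      using clarke_subdifferential_norm_le[OF rL(2) open_ball c(2) v] .
    also have "\<dots> \<le> sum L W"
      using W(1) c(1) Lnn by (intro member_le_sum) auto
    finally show "norm v \<le> sum L W" .
  qed
qed

lemma gradient_semismooth_at:
  fixes h :: "'a::euclidean_space \<Rightarrow> real" and y :: 'a
  assumes h: "definable_fun h" and lip: "locally_lipschitz h"
  shows "\<exists>C \<eta> \<epsilon>. C > 0 \<and> 0 < \<eta> \<and> \<eta> \<le> 1 \<and> \<epsilon> > 0 \<and>
    (\<forall>w v. norm (w - y) < \<epsilon> \<longrightarrow> GDERIV h w :> v \<longrightarrow>
      \<bar>h w - h y - (w - y) \<bullet> v\<bar> \<le> C * norm (w - y) powr (1 + \<eta>))"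
proof -
  obtain \<rho> L where \<rho>: "\<rho> > 0" and L: "L-lipschitz_on (ball y \<rho>) h"
    using lip unfolding locally_lipschitz_def by blast
  define k where "k = (\<lambda>u. h (y + u) - h y)"
  have "definable_fun k"
    unfolding k_def by (intro definable_intros definable_fun_comp[OF h])
  moreover have "L-lipschitz_on (ball 0 \<rho>) k"
  proof (rule lipschitz_onI)
    fix u u' :: 'a assume "u \<in> ball 0 \<rho>" "u' \<in> ball 0 \<rho>"
    then have "dist (h (y + u)) (h (y + u')) \<le> L * dist (y + u) (y + u')"
      by (intro lipschitz_onD[OF L]) (auto simp: dist_norm)
    then show "dist (k u) (k u') \<le> L * dist u u'"
      by (simp add: k_def dist_norm)
  qed (rule lipschitz_on_nonneg[OF L])
  ultimately obtain C \<eta> \<epsilon> where *: "C > 0" "0 < \<eta>" "\<eta> \<le> 1" "\<epsilon> > 0"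
    "\<And>u v. norm u < \<epsilon> \<Longrightarrow> GDERIV k u :> v \<Longrightarrow> \<bar>k u - u \<bullet> v\<bar> \<le> C * norm u powr (1 + \<eta>)"
    using semismooth_power_bound[of k L \<rho>] \<rho> by (auto simp: k_def)
  have "\<bar>h w - h y - (w - y) \<bullet> v\<bar> \<le> C * norm (w - y) powr (1 + \<eta>)"
    if w: "norm (w - y) < \<epsilon>" and v: "GDERIV h w :> v" for w v
  proof -
    have "((\<lambda>u. y + u) has_derivative (\<lambda>u. u)) (at (w - y))"
      by (auto intro!: derivative_eq_intros)
    moreover have "(h has_derivative (\<lambda>u. u \<bullet> v)) (at (y + (w - y)))"
      using v by (simp add: gderiv_def)
    ultimately have "((\<lambda>u. h (y + u)) has_derivative (\<lambda>u. u \<bullet> v)) (at (w - y))"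
      by (rule has_derivative_compose)
    then have "GDERIV k (w - y) :> v"
      unfolding k_def gderiv_def by (auto intro!: derivative_eq_intros)
    then show ?thesis using *(5)[OF w] by (simp add: k_def)
  qed
  with *(1-4) show ?thesis by blast
qed

text \<open>
  For fixed \<open>w\<close> the admissible \<open>v\<close> form an intersection of two closed half-spaces, and the
  estimate passes to limits in \<open>w\<close> and \<open>v\<close>. It is thus inherited by the convex hull of limits of
  gradients.
\<close>

theorem clarke_semismooth_at:
  fixes h :: "'a::euclidean_space \<Rightarrow> real" and y :: 'a
  assumes h: "definable_fun h" and lip: "locally_lipschitz h"
  shows "\<exists>C \<eta> \<epsilon>. C > 0 \<and> 0 < \<eta> \<and> \<eta> \<le> 1 \<and> \<epsilon> > 0 \<and>
    (\<forall>w\<in>ball y \<epsilon>. \<forall>v\<in>clarke_subdifferential h w.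
      \<bar>h w - h y - (w - y) \<bullet> v\<bar> \<le> C * norm (w - y) powr (1 + \<eta>))"
proof -
  obtain C \<eta> \<epsilon> where *: "C > 0" "0 < \<eta>" "\<eta> \<le> 1" "\<epsilon> > 0"
    and est: "\<And>w v. norm (w - y) < \<epsilon> \<Longrightarrow> GDERIV h w :> v \<Longrightarrow>
      \<bar>h w - h y - (w - y) \<bullet> v\<bar> \<le> C * norm (w - y) powr (1 + \<eta>)"
    using gradient_semismooth_at[OF h lip, of y] by blast
  have "\<bar>h w - h y - (w - y) \<bullet> v\<bar> \<le> C * norm (w - y) powr (1 + \<eta>)"
    if w: "w \<in> ball y \<epsilon>" and v: "v \<in> clarke_subdifferential h w" for w v
  proof -
    define R where "R = C * norm (w - y) powr (1 + \<eta>)"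
    define T where "T = {v. (w - y) \<bullet> v \<ge> h w - h y - R} \<inter> {v. (w - y) \<bullet> v \<le> h w - h y + R}"
    have "clarke_subdifferential h w \<subseteq> T"
    proof (rule clarke_subdifferential_subset)
      show "convex T"
        unfolding T_def by (intro convex_Int convex_halfspace_ge convex_halfspace_le)
      fix u G v assume u: "u \<longlonglongrightarrow> w" and G: "\<And>i. GDERIV h (u i) :> G i" and lim: "G \<longlonglongrightarrow> v"
      have "\<forall>\<^sub>F i in sequentially. u i \<in> ball y \<epsilon>"
        using u w topological_tendstoD open_ball by blast
      then have "\<forall>\<^sub>F i in sequentially.
          \<bar>h (u i) - h y - (u i - y) \<bullet> G i\<bar> \<le> C * norm (u i - y) powr (1 + \<eta>)"
        by (rule eventually_mono) (use est G in \<open>simp add: dist_norm norm_minus_commute[of y]\<close>)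
      moreover have "(\<lambda>i. \<bar>h (u i) - h y - (u i - y) \<bullet> G i\<bar>) \<longlonglongrightarrow> \<bar>h w - h y - (w - y) \<bullet> v\<bar>"
        by (intro tendsto_intros isCont_tendsto_compose[OF locally_lipschitz_isCont[OF lip]] u lim)
      moreover have "(\<lambda>i. C * norm (u i - y) powr (1 + \<eta>)) \<longlonglongrightarrow> R"
        unfolding R_def using *(2)
        by (intro tendsto_mult tendsto_const tendsto_powr' tendsto_norm tendsto_diff u) auto
      ultimately have "\<bar>h w - h y - (w - y) \<bullet> v\<bar> \<le> R"
        using tendsto_le[OF sequentially_bot] by blast
      then show "v \<in> T"
        unfolding T_def by (simp add: abs_le_iff)
    qed
    then have "v \<in> T" using v by blast
    then show ?thesis unfolding T_def R_def by (simp add: abs_le_iff)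
  qed
  with * show ?thesis by blast
qed

section \<open>Composition with a smooth map\<close>

text \<open>
  Second-order Taylor bounds that are uniform over pairs of points of a compact ball. The
  quadratic one is the mean value inequality for \<open>\<lambda>u. F u - F' x u\<close>, whose derivative at \<open>u\<close> is
  \<open>F' u - F' x\<close>.
\<close>

lemma C2_smooth_quadratic_remainder:
  fixes F :: "'a::euclidean_space \<Rightarrow> 'b::euclidean_space"
  assumes "C2_smooth F"
  shows "\<exists>F' :: 'a \<Rightarrow> 'a \<Rightarrow>\<^sub>L 'b. (\<forall>x. (F has_derivative blinfun_apply (F' x)) (at x)) \<and>
    continuous_on UNIV F' \<and>
    (\<forall>a. \<exists>K M. K > 0 \<and> M > 0 \<and> (\<forall>x\<in>cball a 1. \<forall>z\<in>cball a 1.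
       norm (F z - F x) \<le> K * norm (z - x) \<and> norm (F z - F x - F' x (z - x)) \<le> M * (norm (z - x))\<^sup>2))"
proof -
  obtain F' :: "'a \<Rightarrow> 'a \<Rightarrow>\<^sub>L 'b" and F'' :: "'a \<Rightarrow> 'a \<Rightarrow>\<^sub>L 'a \<Rightarrow>\<^sub>L 'b"
    where *: "(\<forall>x. (F has_derivative blinfun_apply (F' x)) (at x)) \<and>
      (\<forall>x. (F' has_derivative blinfun_apply (F'' x)) (at x)) \<and> continuous_on UNIV F''"
    using assms unfolding C2_smooth_def by (elim exE)
  then have F': "(F has_derivative blinfun_apply (F' x)) (at x)"
    and F'': "(F' has_derivative blinfun_apply (F'' x)) (at x)" and cont: "continuous_on UNIV F''" for x
    by simp_all
  have contF': "continuous_on UNIV F'"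
    by (intro continuous_at_imp_continuous_on ballI has_derivative_continuous[OF F''])
  have bound: "\<exists>B>0. \<forall>x\<in>cball a 1. norm (f x) \<le> B"
    if "continuous_on UNIV f" for f :: "'a \<Rightarrow> 'c::real_normed_vector" and a
  proof -
    have "compact (f ` cball a 1)"
      using that by (intro compact_continuous_image) (auto intro: continuous_on_subset)
    then have "bounded (f ` cball a 1)" by (rule compact_imp_bounded)
    then obtain B where "B > 0 \<and> (\<forall>y\<in>f ` cball a 1. norm y \<le> B)"
      unfolding bounded_pos by (elim exE)
    then show ?thesis by (intro exI[of _ B]) simp
  qed
  have "\<exists>K M. K > 0 \<and> M > 0 \<and> (\<forall>x\<in>cball a 1. \<forall>z\<in>cball a 1.
       norm (F z - F x) \<le> K * norm (z - x) \<and> norm (F z - F x - F' x (z - x)) \<le> M * (norm (z - x))\<^sup>2)" for a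
  proof -
    obtain K where K: "K > 0" "\<And>x. x \<in> cball a 1 \<Longrightarrow> norm (F' x) \<le> K"
      using bound[OF contF'] by blast
    obtain M where M: "M > 0" "\<And>x. x \<in> cball a 1 \<Longrightarrow> norm (F'' x) \<le> M"
      using bound[OF cont] by blast
    have "norm (F z - F x) \<le> K * norm (z - x) \<and> norm (F z - F x - F' x (z - x)) \<le> M * (norm (z - x))\<^sup>2"
      if x: "x \<in> cball a 1" and z: "z \<in> cball a 1" for x z
    proof
      show "norm (F z - F x) \<le> K * norm (z - x)"
        using x z K(2)
        by (intro differentiable_bound[OF convex_cball, of a 1 F "\<lambda>u. blinfun_apply (F' u)"])
          (auto intro: has_derivative_at_withinI[OF F'] simp flip: norm_blinfun.rep_eq)
      have F'_lip: "norm (F' u - F' x) \<le> M * norm (u - x)" if "u \<in> cball a 1" for u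
        using x that M(2)
        by (intro differentiable_bound[OF convex_cball, of a 1 F' "\<lambda>u. blinfun_apply (F'' u)"])
          (auto intro: has_derivative_at_withinI[OF F''] simp flip: norm_blinfun.rep_eq)
      have "norm ((F z - F' x z) - (F x - F' x x)) \<le> (M * norm (z - x)) * norm (z - x)"
      proof (rule differentiable_bound[OF convex_closed_segment[of x z], of "\<lambda>u. F u - F' x u"
            "\<lambda>u. blinfun_apply (F' u - F' x)"])
        fix u assume u: "u \<in> closed_segment x z"
        then have "u \<in> cball a 1"
          using x z convex_contains_segment[of "cball a 1"] convex_cball by blast
        then have "norm (F' u - F' x) \<le> M * norm (u - x)" by (rule F'_lip)
        also have "\<dots> \<le> M * norm (z - x)"
          using segment_bound(1)[OF u] M(1) by (simp add: mult_left_mono)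
        finally show "onorm (blinfun_apply (F' u - F' x)) \<le> M * norm (z - x)"
          by (simp flip: norm_blinfun.rep_eq)
        show "((\<lambda>u. F u - F' x u) has_derivative blinfun_apply (F' u - F' x)) (at u within closed_segment x z)"
          unfolding blinfun.diff_left
          by (intro has_derivative_diff has_derivative_at_withinI[OF F'] bounded_linear_imp_has_derivative
              blinfun.bounded_linear_right)
      qed auto
      then show "norm (F z - F x - F' x (z - x)) \<le> M * (norm (z - x))\<^sup>2"
        by (simp add: blinfun.diff_right power2_eq_square algebra_simps)
    qed
    with K(1) M(1) show ?thesis by blast
  qed
  with F' contF' show ?thesis by (intro exI[of _ F'] conjI allI)
qed

theorem proposition2p1:
  fixes F :: "real ^ 'd \<Rightarrow> real ^ 'm"
    and h :: "real ^ 'm \<Rightarrow> real"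
    and y :: "real ^ 'm"
    and Xs :: "(real ^ 'd) set"
    and f :: "real ^ 'd \<Rightarrow> real"
    and g :: "real ^ 'd \<Rightarrow> (real ^ 'd) set"
    and xbar :: "real ^ 'd"
  assumes "C2_smooth F"
    and "locally_lipschitz h"
    and "semialgebraic_function h"
    and "isolated_minimum h y"
    and Xs: "Xs = F -` {y}"
    and f: "\<And>x. f x = h (F x)"
    and g: "\<And>x. g x = {transpose (jacobian F (at x)) *v w | w. w \<in> clarke_subdifferential h (F x)}"
    and "xbar \<in> Xs"
  shows "b_regular_along f Xs xbar g"
proof -
  have h: "definable_fun h"
    using \<open>semialgebraic_function h\<close> by (rule semialgebraic_function_definable_fun)
  obtain F' where *: "(\<forall>x. (F has_derivative blinfun_apply (F' x)) (at x)) \<and> continuous_on UNIV F' \<and>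
    (\<forall>a. \<exists>K M. K > 0 \<and> M > 0 \<and> (\<forall>x\<in>cball a 1. \<forall>z\<in>cball a 1.
       norm (F z - F x) \<le> K * norm (z - x) \<and> norm (F z - F x - F' x (z - x)) \<le> M * (norm (z - x))\<^sup>2))"
    using C2_smooth_quadratic_remainder[OF \<open>C2_smooth F\<close>] by (elim exE)
  then have F': "\<And>x. (F has_derivative blinfun_apply (F' x)) (at x)"
    and F'_cont: "continuous_on UNIV F'"
    and F_bounds: "\<And>a. \<exists>K M. K > 0 \<and> M > 0 \<and> (\<forall>x\<in>cball a 1. \<forall>z\<in>cball a 1.
       norm (F z - F x) \<le> K * norm (z - x) \<and> norm (F z - F x - F' x (z - x)) \<le> M * (norm (z - x))\<^sup>2)"
    by blast+
  have adjoint: "(transpose (jacobian F (at x)) *v w) \<bullet> u = w \<bullet> F' x u" for x w u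
  proof -
    have "jacobian F (at x) = matrix (blinfun_apply (F' x))"
      unfolding jacobian_def using frechet_derivative_at[OF F'] by metis
    then have "jacobian F (at x) *v u = F' x u"
      by (simp add: matrix_works linear_matrix_vector_mul_eq blinfun.bounded_linear_right bounded_linear.linear)
    then show ?thesis
      by (simp add: transpose_matrix_vector dot_lmul_matrix)
  qed
  have norm_g: "norm v \<le> norm (F' x) * norm w" if v: "v = transpose (jacobian F (at x)) *v w" for x v w
  proof -
    have "norm v * norm v = w \<bullet> F' x v"
      using adjoint[of x w v] v by (simp flip: power2_eq_square power2_norm_eq_inner)
    also have "\<dots> \<le> norm w * norm (F' x v)"
      using Cauchy_Schwarz_ineq2[of w "F' x v"] by linarith
    also have "\<dots> \<le> norm w * (norm (F' x) * norm v)"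
      by (intro mult_left_mono norm_blinfun) auto
    finally have "norm v * norm v \<le> (norm (F' x) * norm w) * norm v"
      by (simp add: mult_ac)
    then show ?thesis
      by (cases "norm v = 0") auto
  qed
  have nonempty: "g x \<noteq> {}" for x
    using clarke_subdifferential_nonempty[OF h \<open>locally_lipschitz h\<close>, of "F x"] unfolding g by blast
  have loc_bounded: "locally_bounded_map g"
    unfolding locally_bounded_map_def
  proof (intro allI impI)
    fix S :: "(real ^ 'd) set" assume "bounded S"
    then have "compact (closure S)" by simp
    have F_cont: "continuous_on UNIV F"
      by (intro continuous_at_imp_continuous_on ballI has_derivative_continuous[OF F'])
    have "bounded (F ` closure S)" "bounded (F' ` closure S)"
      using \<open>compact (closure S)\<close> F_cont F'_cont
      by (auto intro!: compact_imp_bounded compact_continuous_image intro: continuous_on_subset)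
    then have "bounded (F ` S)" "bounded (F' ` S)"
      by (meson bounded_subset closure_subset image_mono)+
    obtain M where M: "M \<ge> 0"
      "\<And>w v. w \<in> F ` S \<Longrightarrow> v \<in> clarke_subdifferential h w \<Longrightarrow> norm v \<le> M"
      using clarke_subdifferential_locally_bounded[OF \<open>locally_lipschitz h\<close> \<open>bounded (F ` S)\<close>] by metis
    obtain B where B: "\<And>x. x \<in> S \<Longrightarrow> norm (F' x) \<le> B"
      using \<open>bounded (F' ` S)\<close> unfolding bounded_iff by auto
    have "norm v \<le> B * M" if x: "x \<in> S" and v: "v \<in> g x" for x v
    proof -
      obtain w where w: "w \<in> clarke_subdifferential h (F x)" "v = transpose (jacobian F (at x)) *v w"
        using v unfolding g by blast
      have "norm v \<le> norm (F' x) * norm w" using norm_g[OF w(2)] .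
      also have "\<dots> \<le> B * M"
        using B[OF x] M(2)[OF _ w(1)] x order_trans[OF norm_ge_zero B[OF x]] by (intro mult_mono) auto
      finally show ?thesis .
    qed
    then show "bounded (\<Union>x\<in>S. g x)"
      unfolding bounded_iff by (intro exI[of _ "B * M"]) auto
  qed
  obtain C \<eta> \<epsilon>0 where C: "C > 0" "0 < \<eta>" "\<eta> \<le> 1" "\<epsilon>0 > 0"
    and semismooth: "\<And>w v. w \<in> ball y \<epsilon>0 \<Longrightarrow> v \<in> clarke_subdifferential h w \<Longrightarrow>
      \<bar>h w - h y - (w - y) \<bullet> v\<bar> \<le> C * norm (w - y) powr (1 + \<eta>)"
    using clarke_semismooth_at[OF h \<open>locally_lipschitz h\<close>, of y] by blast
  obtain L where L: "L \<ge> 0" "\<And>w v. w \<in> ball y \<epsilon>0 \<Longrightarrow> v \<in> clarke_subdifferential h w \<Longrightarrow> norm v \<le> L"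
    using clarke_subdifferential_locally_bounded[OF \<open>locally_lipschitz h\<close> bounded_ball] by metis
  obtain K M where K: "K > 0" and M: "M > 0"
    and F_lip: "\<And>x z. x \<in> cball xbar 1 \<Longrightarrow> z \<in> cball xbar 1 \<Longrightarrow> norm (F z - F x) \<le> K * norm (z - x)"
    and F_quad: "\<And>x z. x \<in> cball xbar 1 \<Longrightarrow> z \<in> cball xbar 1 \<Longrightarrow>
      norm (F z - F x - F' x (z - x)) \<le> M * (norm (z - x))\<^sup>2"
    using F_bounds[of xbar] by blast
  define \<delta> where "\<delta> = min (1 / 3) (\<epsilon>0 / K)"
  define A where "A = C * K powr (1 + \<eta>) + L * M"
  have \<delta>: "\<delta> > 0" "\<delta> \<le> 1 / 3" "K * \<delta> \<le> \<epsilon>0"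
    using C(4) K by (auto simp: \<delta>_def min_def field_simps)
  have A: "A > 0"
    using C(1) K L(1) M by (simp add: A_def add_pos_nonneg)
  have estimate: "\<bar>f x + v \<bullet> (z - x) - f z\<bar> \<le> A * norm (z - x) powr (1 + \<eta>)"
    if x: "x \<in> ball xbar \<delta>" and v: "v \<in> g x" and z: "z \<in> Xs \<inter> ball xbar (2 * \<delta>)" for x v z
  proof -
    obtain w where w: "w \<in> clarke_subdifferential h (F x)" "v = transpose (jacobian F (at x)) *v w"
      using v unfolding g by blast
    define n where "n = norm (z - x)"
    have xz: "x \<in> cball xbar 1" "z \<in> cball xbar 1"
      using x z \<delta> by auto
    have n: "0 \<le> n" "n \<le> 1"
      using x z \<delta> dist_triangle[of z x xbar] by (auto simp: n_def dist_norm norm_minus_commute)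
    have Fz: "F z = y" "F xbar = y"
      using z \<open>xbar \<in> Xs\<close> Xs by auto
    have "norm (F x - F xbar) \<le> K * norm (x - xbar)"
      using F_lip[of xbar x] xz by simp
    also have "\<dots> < K * \<delta>"
      using x K by (simp add: dist_norm norm_minus_commute)
    finally have Fx: "F x \<in> ball y \<epsilon>0"
      using \<delta>(3) Fz by (simp add: dist_norm norm_minus_commute)
    define R where "R = F z - F x - F' x (z - x)"
    have "v \<bullet> (z - x) = w \<bullet> F' x (z - x)"
      unfolding w(2) by (rule adjoint)
    moreover have "w \<bullet> R = w \<bullet> y - w \<bullet> F x - w \<bullet> F' x (z - x)"
      by (simp add: R_def Fz inner_diff_right)
    moreover have "(F x - y) \<bullet> w = w \<bullet> F x - w \<bullet> y"
      by (simp add: inner_commute[of _ w] inner_diff_right)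
    ultimately have "f x + v \<bullet> (z - x) - f z = (h (F x) - h y - (F x - y) \<bullet> w) - w \<bullet> R"
      by (simp add: f Fz)
    then have "\<bar>f x + v \<bullet> (z - x) - f z\<bar> \<le> \<bar>h (F x) - h y - (F x - y) \<bullet> w\<bar> + \<bar>w \<bullet> R\<bar>"
      by linarith
    also have "\<bar>h (F x) - h y - (F x - y) \<bullet> w\<bar> \<le> C * norm (F x - y) powr (1 + \<eta>)"
      by (rule semismooth[OF Fx w(1)])
    also have "C * norm (F x - y) powr (1 + \<eta>) \<le> C * (K * n) powr (1 + \<eta>)"
      using F_lip[OF xz] C Fz
      by (intro mult_left_mono powr_mono2) (auto simp: n_def norm_minus_commute)
    also have "(K * n) powr (1 + \<eta>) = K powr (1 + \<eta>) * n powr (1 + \<eta>)"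
      by (simp add: powr_mult)
    also have "\<bar>w \<bullet> R\<bar> \<le> norm w * norm R"
      by (rule Cauchy_Schwarz_ineq2)
    also have "\<dots> \<le> L * (M * n\<^sup>2)"
      using L F_quad[OF xz] Fx w(1) M by (intro mult_mono) (auto simp: R_def n_def)
    also have "L * (M * n\<^sup>2) \<le> L * (M * n powr (1 + \<eta>))"
    proof (intro mult_left_mono)
      show "n\<^sup>2 \<le> n powr (1 + \<eta>)"
        using n C(3) powr_mono'[of "1 + \<eta>" 2 n] by (cases "n = 0") auto
    qed (use L(1) M in auto)
    finally show ?thesis
      by (simp add: A_def n_def algebra_simps)
  qed
  show ?thesis
    unfolding b_regular_along_def
    using nonempty loc_bounded \<delta>(1) A C(2) estimate by blast
qed

end
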